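(* Let $k$ be a field, $R=k[x_1,\ldots,x_d]$ the standard graded polynomial ring, and $I\subseteq R$ a square-free monomial ideal. Then the limit $$\lim_{n\to\infty}\frac{a_i(R/I^{(n)})}{n}$$ exists for every $0\leq i\leq \dim R/I$. In particular, the limit $$\lim_{n\to\infty}\frac{\operatorname{reg}(R/I^{(n)})}{n}$$ exists.
   Context: Let $\mathfrak m=(x_1,\ldots,x_d)$. For $n\in\mathbb Z_{>0}$, the $n$-th symbolic power of $I$ is $I^{(n)}=\bigcap_{\mathfrak p\in \operatorname{Min}(R/I)} (I^nR_{\mathfrak p}\cap R)$, where $\operatorname{Min}(R/I)$ is the set of minimal primes of $I$. For a finitely generated graded $R$-module $M$ and $0\leq i\leq\dim M$, the $i$-th $a$-invariant is $a_i(M)=\max\{j\mid H^i_{\mathfrak m}(M)_j\neq 0\}$, with the convention $a_i(M)=-\infty$ if $H^i_{\mathfrak m}(M)=0$, where $H^i_{\mathfrak m}$ denotes local cohomology. The Castelnuovo–Mumford regularity is $\operatorname{reg}(M)=\max_i\{a_i(M)+i\}$. The value $-\infty$ is allowed for the limit of $a_i(R/I^{(n)})/n$; this is the case in which $a_i(R/I^{(n)})=-\infty$ for every $n$. *)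

theory Defs
  imports
    "HOL-Algebra.Ideal_Product"
    "HOL-Algebra.QuotRing"
    "HOL-Algebra.Product_Groups"
    "HOL-Algebra.Module"
    "HOL-Library.Poly_Mapping"
    "HOL-Analysis.Extended_Real_Limits"
begin

section \<open>Commutative algebra over a general ring\<close>

text \<open>Supremum of the lengths of chains of primes; it is \<open>-\<infinity>\<close> for the zero ring.\<close>

definition krull_dim :: "('a, 'c) ring_scheme \<Rightarrow> ereal" where
  "krull_dim R = Sup {ereal (real n) |n.
     \<exists>P. (\<forall>i\<le>n. primeideal (P i) R) \<and> (\<forall>i<n. P i \<subset> P (Suc i))}"

definition annihilator :: "('a, 'c) ring_scheme \<Rightarrow> ('a, 'b, 'e) module_scheme \<Rightarrow> 'a set" where
  "annihilator R M = {r \<in> carrier R. \<forall>x\<in>carrier M. r \<odot>\<^bsub>M\<^esub> x = \<zero>\<^bsub>M\<^esub>}"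

definition module_dim :: "('a, 'c) ring_scheme \<Rightarrow> ('a, 'b, 'e) module_scheme \<Rightarrow> ereal" where
  "module_dim R M = krull_dim (R Quot annihilator R M)"

definition regular_module :: "('a, 'c) ring_scheme \<Rightarrow> ('a, 'a) module" where
  "regular_module R =
     \<lparr>carrier = carrier R, monoid.mult = monoid.mult R, monoid.one = monoid.one R,
      ring.zero = ring.zero R, ring.add = ring.add R, smult = monoid.mult R\<rparr>"

definition quot_module :: "('a, 'c) ring_scheme \<Rightarrow> 'a set \<Rightarrow> ('a, 'a set) module" where
  "quot_module R J =
     \<lparr>carrier = carrier (R Quot J), monoid.mult = monoid.mult (R Quot J),
      monoid.one = monoid.one (R Quot J), ring.zero = ring.zero (R Quot J),
      ring.add = ring.add (R Quot J), smult = (\<lambda>r X. (J +>\<^bsub>R\<^esub> r) \<otimes>\<^bsub>R Quot J\<^esub> X)\<rparr>"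

text \<open>Localization of a module \<open>M\<close> at a multiplicatively closed subset \<open>W\<close> of the base ring:
  the fraction \<open>x/s\<close> is the class of the pair \<open>(x, s)\<close>.\<close>

definition frac_rel :: "('a, 'b, 'e) module_scheme \<Rightarrow> 'a set \<Rightarrow> (('b \<times> 'a) \<times> ('b \<times> 'a)) set" where
  "frac_rel M W = {((x, s), (y, t)). x \<in> carrier M \<and> y \<in> carrier M \<and> s \<in> W \<and> t \<in> W \<and>
     (\<exists>u\<in>W. u \<odot>\<^bsub>M\<^esub> (t \<odot>\<^bsub>M\<^esub> x) = u \<odot>\<^bsub>M\<^esub> (s \<odot>\<^bsub>M\<^esub> y))}"

definition mod_frac :: "('a, 'b, 'e) module_scheme \<Rightarrow> 'a set \<Rightarrow> 'b \<Rightarrow> 'a \<Rightarrow> ('b \<times> 'a) set" where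
  "mod_frac M W x s = frac_rel M W `` {(x, s)}"

text \<open>Only the additive group of the localization is recorded; it is written multiplicatively,
  as required by \<open>product_group\<close> and \<open>Mod\<close>.\<close>

definition loc_group ::
  "('a, 'c) ring_scheme \<Rightarrow> ('a, 'b, 'e) module_scheme \<Rightarrow> 'a set \<Rightarrow> ('b \<times> 'a) set monoid" where
  "loc_group R M W =
     \<lparr>carrier = (carrier M \<times> W) // frac_rel M W,
      monoid.mult = (\<lambda>X Y. \<Union>(x, s)\<in>X. \<Union>(y, t)\<in>Y.
        mod_frac M W (t \<odot>\<^bsub>M\<^esub> x \<oplus>\<^bsub>M\<^esub> s \<odot>\<^bsub>M\<^esub> y) (s \<otimes>\<^bsub>R\<^esub> t)),
      monoid.one = mod_frac M W \<zero>\<^bsub>M\<^esub> \<one>\<^bsub>R\<^esub>\<rparr>"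

definition minimal_primes :: "('a, 'c) ring_scheme \<Rightarrow> 'a set \<Rightarrow> 'a set set" where
  "minimal_primes R I = {P. primeideal P R \<and> I \<subseteq> P \<and>
     (\<forall>Q. primeideal Q R \<and> I \<subseteq> Q \<and> Q \<subseteq> P \<longrightarrow> Q = P)}"

text \<open>\<open>J R\<^sub>P \<inter> R\<close>: the elements of \<open>R\<close> whose image in \<open>R\<^sub>P\<close> lies in
  the extended ideal \<open>J R\<^sub>P = {a/s | a \<in> J, s \<notin> P}\<close>.\<close>

definition loc_contraction :: "('a, 'c) ring_scheme \<Rightarrow> 'a set \<Rightarrow> 'a set \<Rightarrow> 'a set" where
  "loc_contraction R P J =
     (let W = carrier R - P; M = regular_module R
      in {r \<in> carrier R. \<exists>a\<in>J. \<exists>s\<in>W. mod_frac M W r \<one>\<^bsub>R\<^esub> = mod_frac M W a s})"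

text \<open>The ideals of \<open>R\<close> form a monoid \<open>ideals_set R\<close> under the ideal product, with unit \<open>R\<close>,
  so \<open>I^n\<close> is a power in that monoid. For \<open>I = R\<close> there are no minimal primes and
  every symbolic power is \<open>R\<close>.\<close>

definition symbolic_power :: "('a, 'c) ring_scheme \<Rightarrow> 'a set \<Rightarrow> nat \<Rightarrow> 'a set" where
  "symbolic_power R I n =
     carrier R \<inter> (\<Inter>P\<in>minimal_primes R I. loc_contraction R P (I [^]\<^bsub>ideals_set R\<^esub> n))"


section \<open>The standard graded polynomial ring\<close>

text \<open>Exponent vectors are finitely supported functions on \<open>nat\<close>; the variables of
  \<open>poly_ring d\<close> are those with index \<open>0, \<dots>, d - 1\<close>.\<close>

type_synonym 'k mpoly = "(nat \<Rightarrow>\<^sub>0 nat) \<Rightarrow>\<^sub>0 'k"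

definition poly_ring :: "nat \<Rightarrow> 'k::field mpoly ring" where
  "poly_ring d =
     \<lparr>carrier = {f. \<forall>m\<in>Poly_Mapping.keys f. Poly_Mapping.keys m \<subseteq> {..<d}},
      monoid.mult = (*), monoid.one = 1, ring.zero = 0, ring.add = (+)\<rparr>"

lemma poly_ring_carrier_iff:
  "f \<in> carrier (poly_ring d) \<longleftrightarrow> (\<forall>m\<in>Poly_Mapping.keys f. Poly_Mapping.keys m \<subseteq> {..<d})"
  by (simp add: poly_ring_def)

lemma poly_ring_simps:
  "monoid.mult (poly_ring d) = (*)" "monoid.one (poly_ring d) = 1"
  "ring.zero (poly_ring d) = 0" "ring.add (poly_ring d) = (+)"
  by (simp_all add: poly_ring_def)

lemma cring_poly_ring: "cring (poly_ring d :: 'k::field mpoly ring)"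
proof (rule cringI)
  have add_closed: "f + g \<in> carrier (poly_ring d)"
    if "f \<in> carrier (poly_ring d)" "g \<in> carrier (poly_ring d)" for f g :: "'k mpoly"
    using that keys_add[of f g] unfolding poly_ring_carrier_iff by blast
  have mult_closed: "f * g \<in> carrier (poly_ring d)"
    if f: "f \<in> carrier (poly_ring d)" and g: "g \<in> carrier (poly_ring d)" for f g :: "'k mpoly"
    unfolding poly_ring_carrier_iff
  proof
    fix m assume "m \<in> Poly_Mapping.keys (f * g)"
    then obtain a b where m: "m = a + b" "a \<in> Poly_Mapping.keys f" "b \<in> Poly_Mapping.keys g"
      using keys_mult[of f g] by blast
    then have "Poly_Mapping.keys a \<subseteq> {..<d}" "Poly_Mapping.keys b \<subseteq> {..<d}"
      using f g unfolding poly_ring_carrier_iff by blast+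
    then show "Poly_Mapping.keys m \<subseteq> {..<d}"
      unfolding m(1) using keys_add[of a b] by blast
  qed
  have uminus_closed: "- f \<in> carrier (poly_ring d)" if "f \<in> carrier (poly_ring d)" for f :: "'k mpoly"
    using that by (simp add: poly_ring_carrier_iff)
  have zero_closed: "(0 :: 'k mpoly) \<in> carrier (poly_ring d)"
    by (simp add: poly_ring_carrier_iff)
  have one_closed: "(1 :: 'k mpoly) \<in> carrier (poly_ring d)"
    by (simp add: poly_ring_carrier_iff)
  show "abelian_group (poly_ring d :: 'k mpoly ring)"
  proof (rule abelian_groupI, unfold poly_ring_simps)
    fix f :: "'k mpoly"
    assume "f \<in> carrier (poly_ring d)"
    then show "\<exists>g\<in>carrier (poly_ring d). g + f = 0"
      using uminus_closed[of f] by (intro bexI[of _ "- f"]) simp_all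
  qed (rule add_closed zero_closed add.assoc add.commute add_0; assumption?)+
  show "comm_monoid (poly_ring d :: 'k mpoly ring)"
    by (rule comm_monoidI, unfold poly_ring_simps)
      (rule mult_closed one_closed mult.assoc mult.commute mult_1; assumption?)+
qed (unfold poly_ring_simps, rule distrib_right)

definition mdeg :: "(nat \<Rightarrow>\<^sub>0 nat) \<Rightarrow> nat" where
  "mdeg m = (\<Sum>v\<in>Poly_Mapping.keys m. Poly_Mapping.lookup m v)"

definition monomial :: "(nat \<Rightarrow>\<^sub>0 nat) \<Rightarrow> 'k::field mpoly" where
  "monomial m = Poly_Mapping.single m 1"

definition homogeneous :: "nat \<Rightarrow> int \<Rightarrow> 'k::field mpoly set" where
  "homogeneous d j = {f \<in> carrier (poly_ring d). \<forall>m\<in>Poly_Mapping.keys f. int (mdeg m) = j}"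

definition squarefree_monomial_ideal :: "nat \<Rightarrow> 'k::field mpoly set \<Rightarrow> bool" where
  "squarefree_monomial_ideal d I \<longleftrightarrow>
     (\<exists>E. (\<forall>m\<in>E. Poly_Mapping.keys m \<subseteq> {..<d} \<and> (\<forall>v. Poly_Mapping.lookup m v \<le> 1)) \<and>
          I = Idl\<^bsub>poly_ring d\<^esub> (monomial ` E))"


section \<open>Local cohomology at the irrelevant ideal\<close>

text \<open>Throughout, \<open>M\<close> is a module over \<open>poly_ring d\<close> and \<open>G j\<close> is its component of degree \<open>j\<close>.
  Local cohomology with support in \<open>(x\<^sub>0, \<dots>, x\<^bsub>d-1\<^esub>)\<close> is the cohomology of the Cech complex
  \<open>C\<^sup>p = \<Prod>\<^bsub>card S = p\<^esub> M\<^bsub>x\<^sub>S\<^esub>\<close>, where \<open>x\<^sub>S = \<Prod>v\<in>S. x\<^sub>v\<close>. Here \<open>M\<^bsub>x\<^sub>S\<^esub>\<close> is the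
  localization at the multiplicative set generated by the variables in \<open>S\<close> (equivalently, at the
  powers of \<open>x\<^sub>S\<close>). These sets increase with \<open>S\<close>, so the localization map
  \<open>M\<^bsub>x\<^sub>S\<^esub> \<rightarrow> M\<^bsub>x\<^sub>T\<^esub>\<close> for \<open>S \<subseteq> T\<close> sends a class to the bigger class generated by it.\<close>

definition monomials_on :: "nat set \<Rightarrow> 'k::field mpoly set" where
  "monomials_on S = {monomial m |m. Poly_Mapping.keys m \<subseteq> S}"

definition cech_loc ::
  "nat \<Rightarrow> ('k::field mpoly, 'b, 'e) module_scheme \<Rightarrow> nat set \<Rightarrow> ('b \<times> 'k mpoly) set monoid" where
  "cech_loc d M S = loc_group (poly_ring d) M (monomials_on S)"

definition cech_loc_component ::
  "('k::field mpoly, 'b, 'e) module_scheme \<Rightarrow> (int \<Rightarrow> 'b set) \<Rightarrow> nat set \<Rightarrow> int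
   \<Rightarrow> ('b \<times> 'k mpoly) set set" where
  "cech_loc_component M G S j =
     {mod_frac M (monomials_on S) x (monomial m) |x m.
        Poly_Mapping.keys m \<subseteq> S \<and> x \<in> G (j + int (mdeg m))}"

definition loc_map ::
  "('k::field mpoly, 'b, 'e) module_scheme \<Rightarrow> nat set \<Rightarrow> ('b \<times> 'k mpoly) set
   \<Rightarrow> ('b \<times> 'k mpoly) set" where
  "loc_map M T X = frac_rel M (monomials_on T) `` X"

definition cech_index :: "nat \<Rightarrow> nat \<Rightarrow> nat set set" where
  "cech_index d p = {S. S \<subseteq> {..<d} \<and> card S = p}"

definition cech_group ::
  "nat \<Rightarrow> ('k::field mpoly, 'b, 'e) module_scheme \<Rightarrow> nat
   \<Rightarrow> (nat set \<Rightarrow> ('b \<times> 'k mpoly) set) monoid" where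
  "cech_group d M p = product_group (cech_index d p) (cech_loc d M)"

text \<open>\<open>(\<delta> c)\<^sub>T = \<Sum>v\<in>T. (-1)^(number of elements of T below v) c\<^bsub>T - {v}\<^esub>|\<^sub>T\<close>,
  in multiplicative notation.\<close>

definition cech_diff ::
  "nat \<Rightarrow> ('k::field mpoly, 'b, 'e) module_scheme \<Rightarrow> nat
   \<Rightarrow> (nat set \<Rightarrow> ('b \<times> 'k mpoly) set) \<Rightarrow> (nat set \<Rightarrow> ('b \<times> 'k mpoly) set)" where
  "cech_diff d M p c = (\<lambda>T\<in>cech_index d (Suc p).
     finprod (cech_loc d M T)
       (\<lambda>v. let y = loc_map M T (c (T - {v}))
            in if even (card {u \<in> T. u < v}) then y else inv\<^bsub>cech_loc d M T\<^esub> y)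
       T)"

definition cech_cocycles ::
  "nat \<Rightarrow> ('k::field mpoly, 'b, 'e) module_scheme \<Rightarrow> nat
   \<Rightarrow> (nat set \<Rightarrow> ('b \<times> 'k mpoly) set) set" where
  "cech_cocycles d M i = kernel (cech_group d M i) (cech_group d M (Suc i)) (cech_diff d M i)"

definition cech_coboundaries ::
  "nat \<Rightarrow> ('k::field mpoly, 'b, 'e) module_scheme \<Rightarrow> nat
   \<Rightarrow> (nat set \<Rightarrow> ('b \<times> 'k mpoly) set) set" where
  "cech_coboundaries d M i =
     (case i of 0 \<Rightarrow> {\<one>\<^bsub>cech_group d M 0\<^esub>}
      | Suc p \<Rightarrow> cech_diff d M p ` carrier (cech_group d M p))"

definition local_cohomology ::
  "nat \<Rightarrow> ('k::field mpoly, 'b, 'e) module_scheme \<Rightarrow> nat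
   \<Rightarrow> (nat set \<Rightarrow> ('b \<times> 'k mpoly) set) set monoid" where
  "local_cohomology d M i =
     (cech_group d M i)\<lparr>carrier := cech_cocycles d M i\<rparr> Mod cech_coboundaries d M i"

text \<open>The component \<open>H\<^sup>i(M)\<^sub>j\<close>: the classes of the cocycles that are homogeneous of degree \<open>j\<close>.\<close>

definition local_cohomology_component ::
  "nat \<Rightarrow> ('k::field mpoly, 'b, 'e) module_scheme \<Rightarrow> (int \<Rightarrow> 'b set) \<Rightarrow> nat \<Rightarrow> int
   \<Rightarrow> (nat set \<Rightarrow> ('b \<times> 'k mpoly) set) set set" where
  "local_cohomology_component d M G i j =
     {cech_coboundaries d M i #>\<^bsub>cech_group d M i\<^esub> z |z.
        z \<in> cech_cocycles d M i \<and> (\<forall>S\<in>cech_index d i. z S \<in> cech_loc_component M G S j)}"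

text \<open>A supremum of integers in the extended reals: the maximum when the set is nonempty and
  bounded above, and \<open>-\<infinity>\<close> when it is empty.\<close>

definition a_invariant ::
  "nat \<Rightarrow> ('k::field mpoly, 'b, 'e) module_scheme \<Rightarrow> (int \<Rightarrow> 'b set) \<Rightarrow> nat \<Rightarrow> ereal" where
  "a_invariant d M G i =
     Sup {ereal (real_of_int j) |j.
       local_cohomology_component d M G i j \<noteq> {\<one>\<^bsub>local_cohomology d M i\<^esub>}}"

definition regularity ::
  "nat \<Rightarrow> ('k::field mpoly, 'b, 'e) module_scheme \<Rightarrow> (int \<Rightarrow> 'b set) \<Rightarrow> ereal" where
  "regularity d M G =
     Sup {a_invariant d M G i + ereal (real i) |i. ereal (real i) \<le> module_dim (poly_ring d) M}"


section \<open>Graded quotients of the polynomial ring\<close>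

definition quot_grading :: "nat \<Rightarrow> 'k::field mpoly set \<Rightarrow> int \<Rightarrow> 'k mpoly set set" where
  "quot_grading d J j = {J +>\<^bsub>poly_ring d\<^esub> f |f. f \<in> homogeneous d j}"

definition a_invariant_quot :: "nat \<Rightarrow> 'k::field mpoly set \<Rightarrow> nat \<Rightarrow> ereal" where
  "a_invariant_quot d J i = a_invariant d (quot_module (poly_ring d) J) (quot_grading d J) i"

definition regularity_quot :: "nat \<Rightarrow> 'k::field mpoly set \<Rightarrow> ereal" where
  "regularity_quot d J = regularity d (quot_module (poly_ring d) J) (quot_grading d J)"

end

theory Submission
  imports Defs
begin

text \<open>
  The minimal primes of \<open>I\<close> are the ideals \<open>(x\<^sub>v | v \<in> P)\<close> of the minimal vertex covers \<open>P\<close> of the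
  generating exponents, and \<open>I\<^sup>(\<^sup>n\<^sup>)\<close> is spanned by the monomials \<open>x\<^sup>m\<close> with \<open>\<Sum>v\<in>P. m\<^sub>v \<ge> n\<close> for all of
  them. The Cech complex of \<open>R/I\<^sup>(\<^sup>n\<^sup>)\<close> splits by multidegree: in multidegree \<open>a \<in> \<int>\<^sup>d\<close> it is the cochain
  complex of the set family
    \<open>K\<^sub>n(a) = {S. {v. a\<^sub>v < 0} \<subseteq> S \<and> (\<exists>P. P \<inter> S = {} \<and> (\<Sum>v\<in>P. a\<^sub>v) < n)}\<close>
  (as in Takayama's formula). If \<open>N = q n + r\<close> with \<open>r < n \<le> q\<close>, an integer \<open>s\<close> satisfies \<open>s < n\<close> iff
  \<open>(q + 1) s < N\<close>, so \<open>K\<^sub>N((q + 1) a) = K\<^sub>n(a)\<close>. Hence a degree \<open>j\<close> occurring in \<open>H\<^sup>i(R/I\<^sup>(\<^sup>n\<^sup>))\<close> yields the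
  degree \<open>(q + 1) j\<close> in \<open>H\<^sup>i(R/I\<^sup>(\<^sup>N\<^sup>))\<close>. Moreover \<open>a\<^sub>v > n\<close> makes \<open>K\<^sub>n(a)\<close> a cone with apex \<open>v\<close>, so
  all degrees are at most \<open>d n\<close>. These two facts force \<open>a\<^sub>i(R/I\<^sup>(\<^sup>n\<^sup>))/n\<close> to converge to its supremum.
  The regularity differs by at most \<open>d\<close> from the maximum of the \<open>a\<^sub>i\<close>.
\<close>

section \<open>Monomial ideals\<close>

text \<open>The factor \<open>q + 1\<close> is dictated by the remainder \<open>r\<close>: scaling
  by \<open>q\<close> fails at \<open>s = n\<close> when \<open>r > 0\<close>, since
  \<open>q n < N\<close> although \<open>s < n\<close> is false. The price is the condition
  \<open>n \<le> q\<close>, so the dilation only reaches \<open>N \<ge> n^2\<close>, which is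
  harmless for a limit. A single multidegree is dilated; degrees are never added, and the limit
  comes from \<open>(q + 1) / N\<close> tending to \<open>1 / n\<close>. The obstacle is that
  localizations are sets of equivalence classes and local cohomology is a quotient of groups of such
  families. The splitting by multidegree is therefore not built as a direct sum. Each class is
  replaced by its coefficient function on integer vectors; this assignment is additive, injective,
  and reaches every finitely supported function on the multidegrees where the localization is
  nonzero. Cocycles and coboundaries are then tested one multidegree at a time. Cohomology is never
  computed: equal families have equal cohomology, cones have none, and a one-element family supplies
  the nonvanishing for proper \<open>I\<close>.\<close>

abbreviation "keys \<equiv> Poly_Mapping.keys"
abbreviation "lookup \<equiv> Poly_Mapping.lookup"

definition mspan :: "(nat \<Rightarrow>\<^sub>0 nat) set \<Rightarrow> 'k::field mpoly set" where
  "mspan U = {f. keys f \<subseteq> U}"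

definition expo_upset :: "nat \<Rightarrow> (nat \<Rightarrow>\<^sub>0 nat) set \<Rightarrow> bool" where
  "expo_upset d U \<longleftrightarrow> (\<forall>m\<in>U. keys m \<subseteq> {..<d}) \<and>
     (\<forall>m\<in>U. \<forall>u. keys u \<subseteq> {..<d} \<longrightarrow> m + u \<in> U)"

text \<open>The order of the monomial along the prime \<open>(x_v | v \<in> P)\<close>. For
  \<open>P\<close> inside \<open>{..<d}\<close>, \<open>mspan (pdeg_ge d P n)\<close> is thus the
  \<open>n\<close>-th power of that prime.\<close>

definition pdeg :: "nat set \<Rightarrow> (nat \<Rightarrow>\<^sub>0 nat) \<Rightarrow> nat" where
  "pdeg P m = (\<Sum>v\<in>P. lookup m v)"

definition pdeg_ge :: "nat \<Rightarrow> nat set \<Rightarrow> nat \<Rightarrow> (nat \<Rightarrow>\<^sub>0 nat) set" where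
  "pdeg_ge d P n = {m. keys m \<subseteq> {..<d} \<and> n \<le> pdeg P m}"

lemma keys_add_nat: "keys (a + b) = keys a \<union> keys (b :: 'a \<Rightarrow>\<^sub>0 nat)"
  by (auto simp: in_keys_iff lookup_add)

lemma pdeg_add: "pdeg P (a + b) = pdeg P a + pdeg P b"
  by (simp add: pdeg_def lookup_add sum.distrib)

lemma expo_upset_pdeg_ge: "expo_upset d (pdeg_ge d P n)"
  by (auto simp: expo_upset_def pdeg_ge_def keys_add_nat pdeg_add)

lemma keys_sum_subset:
  assumes "\<And>x. x \<in> A \<Longrightarrow> keys (g x) \<subseteq> B"
  shows "keys (\<Sum>x\<in>A. g x) \<subseteq> B"
  using assms
proof (induction A rule: infinite_finite_induct)
  case (insert x A)
  then show ?case
    using keys_add[of "g x" "\<Sum>x\<in>A. g x"] by auto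
qed auto

lemma mpoly_expand: "f = (\<Sum>m\<in>keys f. Poly_Mapping.single m (lookup f m))"
proof (rule poly_mapping_eqI)
  fix e
  have "lookup (\<Sum>m\<in>keys f. Poly_Mapping.single m (lookup f m)) e =
      (\<Sum>m\<in>keys f. if m = e then lookup f e else 0)"
    unfolding lookup_sum by (rule sum.cong) (auto simp: lookup_single)
  also have "\<dots> = lookup f e"
    by (auto simp: in_keys_iff)
  finally show "lookup f e = lookup (\<Sum>m\<in>keys f. Poly_Mapping.single m (lookup f m)) e" ..
qed

lemma monomial_mult: "monomial a * monomial b = monomial (a + b)"
  by (simp add: monomial_def mult_single)

lemma monomial_0: "monomial 0 = 1"
  by (simp add: monomial_def)

lemma keys_monomial [simp]: "keys (monomial m :: 'k::field mpoly) = {m}"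
  by (simp add: monomial_def)

lemma monomial_inject [simp]: "(monomial a :: 'k::field mpoly) = monomial b \<longleftrightarrow> a = b"
  using keys_monomial by (metis singleton_inject)

lemma monomial_carrier: "keys m \<subseteq> {..<d} \<Longrightarrow> monomial m \<in> carrier (poly_ring d)"
  by (simp add: poly_ring_carrier_iff)

lemma single_carrier: "keys m \<subseteq> {..<d} \<Longrightarrow> Poly_Mapping.single m c \<in> carrier (poly_ring d)"
  by (simp add: poly_ring_carrier_iff)

lemma ring_poly_ring: "ring (poly_ring d :: 'k::field mpoly ring)"
  using cring_poly_ring cring.axioms(1) by blast

lemma poly_ring_uminus:
  assumes "f \<in> carrier (poly_ring d)"
  shows "\<ominus>\<^bsub>poly_ring d\<^esub> f = - (f :: 'k::field mpoly)"
proof -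
  interpret cring "poly_ring d :: 'k mpoly ring" by (rule cring_poly_ring)
  have "- f \<in> carrier (poly_ring d)"
    using assms by (simp add: poly_ring_carrier_iff)
  then show ?thesis
    using minus_equality[of "- f" f] assms by (simp add: poly_ring_simps)
qed

lemma poly_ring_minus:
  assumes "g \<in> carrier (poly_ring d)"
  shows "f \<ominus>\<^bsub>poly_ring d\<^esub> g = f - (g :: 'k::field mpoly)"
  using assms by (simp add: a_minus_def poly_ring_uminus poly_ring_simps)

lemma ideal_mspan:
  assumes "expo_upset d U"
  shows "ideal (mspan U :: 'k::field mpoly set) (poly_ring d)"
proof -
  interpret cring "poly_ring d :: 'k mpoly ring" by (rule cring_poly_ring)
  have sub: "f \<in> carrier (poly_ring d)" if "f \<in> mspan U" for f :: "'k mpoly"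
    using that assms unfolding mspan_def poly_ring_carrier_iff expo_upset_def by blast
  have mult: "g * f \<in> mspan U" if "f \<in> mspan U" "g \<in> carrier (poly_ring d)" for f g :: "'k mpoly"
    unfolding mspan_def
  proof (safe)
    fix m assume "m \<in> keys (g * f)"
    then obtain a b where m: "m = a + b" "a \<in> keys g" "b \<in> keys f"
      using keys_mult[of g f] by blast
    then have "b \<in> U" "keys a \<subseteq> {..<d}"
      using that unfolding mspan_def poly_ring_carrier_iff by auto
    then show "m \<in> U"
      using assms unfolding m expo_upset_def by (metis add.commute)
  qed
  show ?thesis
  proof (rule idealI)
    show "subgroup (mspan U) (add_monoid (poly_ring d :: 'k mpoly ring))"
    proof (rule subgroup.intro)
      show "mspan U \<subseteq> carrier (add_monoid (poly_ring d :: 'k mpoly ring))"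
        using sub by auto
      show "x \<otimes>\<^bsub>add_monoid (poly_ring d)\<^esub> y \<in> mspan U"
        if "x \<in> mspan U" "y \<in> mspan U" for x y :: "'k mpoly"
        using that keys_add[of x y] by (auto simp: mspan_def poly_ring_simps)
      show "\<one>\<^bsub>add_monoid (poly_ring d)\<^esub> \<in> (mspan U :: 'k mpoly set)"
        by (simp add: mspan_def poly_ring_simps)
      show "inv\<^bsub>add_monoid (poly_ring d)\<^esub> x \<in> mspan U" if "x \<in> mspan U" for x :: "'k mpoly"
        using poly_ring_uminus[OF sub[OF that]] that unfolding a_inv_def
        by (simp add: mspan_def)
    qed
  qed (auto intro: ring_poly_ring mult simp: poly_ring_simps, metis mult mult.commute)
qed

lemma mult_pdeg_ge:
  assumes "f \<in> mspan (pdeg_ge d P a)" "g \<in> mspan (pdeg_ge d P b)"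
  shows "f * (g :: 'k::field mpoly) \<in> mspan (pdeg_ge d P (a + b))"
  unfolding mspan_def
proof safe
  fix m assume "m \<in> keys (f * g)"
  then obtain x y where m: "m = x + y" "x \<in> keys f" "y \<in> keys g"
    using keys_mult[of f g] by blast
  then have "x \<in> pdeg_ge d P a" "y \<in> pdeg_ge d P b"
    using assms by (auto simp: mspan_def)
  then show "m \<in> pdeg_ge d P (a + b)"
    by (auto simp: m pdeg_ge_def keys_add_nat pdeg_add)
qed

section \<open>Cancellation and primality for ideals generated by variables\<close>

definition restrict_poly :: "(nat \<Rightarrow>\<^sub>0 nat) set \<Rightarrow> 'k::field mpoly \<Rightarrow> 'k mpoly" where
  "restrict_poly B f = (\<Sum>m\<in>keys f \<inter> B. Poly_Mapping.single m (lookup f m))"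

lemma lookup_restrict_poly: "lookup (restrict_poly B f) e = (if e \<in> B then lookup f e else 0)"
proof -
  have "lookup (restrict_poly B f) e = (\<Sum>m\<in>keys f \<inter> B. if m = e then lookup f e else 0)"
    unfolding restrict_poly_def lookup_sum by (rule sum.cong) (auto simp: lookup_single)
  also have "\<dots> = (if e \<in> B then lookup f e else 0)"
    by (auto simp: in_keys_iff)
  finally show ?thesis .
qed

lemma keys_restrict_poly: "keys (restrict_poly B f) = keys f \<inter> B"
  by (auto simp: in_keys_iff lookup_restrict_poly split: if_splits)

text \<open>The components of lowest \<open>P\<close>-degree of \<open>s\<close> and \<open>r\<close> multiply to a nonzero polynomial.\<close>

lemma pdeg_ge_cancel:
  fixes r s :: "'k::field mpoly"
  assumes r: "r \<in> carrier (poly_ring d)" and s: "s \<in> carrier (poly_ring d)"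
    and s0: "s \<notin> mspan (pdeg_ge d P 1)" and sr: "s * r \<in> mspan (pdeg_ge d P n)"
  shows "r \<in> mspan (pdeg_ge d P n)"
proof (rule ccontr)
  assume "r \<notin> mspan (pdeg_ge d P n)"
  then obtain m where m: "m \<in> keys r" "pdeg P m < n"
    using r by (auto simp: mspan_def pdeg_ge_def poly_ring_carrier_iff subset_iff not_le)
  define k where "k = (LEAST k. \<exists>m\<in>keys r. pdeg P m = k)"
  have ex: "\<exists>m\<in>keys r. pdeg P m = k"
    unfolding k_def by (rule LeastI_ex) (use m in blast)
  have kmin: "k \<le> pdeg P m" if "m \<in> keys r" for m
    unfolding k_def by (rule Least_le) (use that in blast)
  have kn: "k < n" using kmin[OF m(1)] m(2) by simp
  define rk where "rk = restrict_poly {m. pdeg P m = k} r"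
  define s0 where "s0 = restrict_poly {m. pdeg P m = 0} s"
  have rk_keys: "keys rk = {m \<in> keys r. pdeg P m = k}" and s0_keys: "keys s0 = {m \<in> keys s. pdeg P m = 0}"
    by (auto simp: rk_def s0_def keys_restrict_poly)
  have "rk \<noteq> 0"
    using ex rk_keys by auto
  have "s0 \<noteq> 0"
    using assms(3) s s0_keys
    by (auto simp: mspan_def pdeg_ge_def poly_ring_carrier_iff subset_iff not_le Suc_le_eq)
  have prod: "s0 * rk \<noteq> 0"
    using \<open>rk \<noteq> 0\<close> \<open>s0 \<noteq> 0\<close> by simp
  have keys_prod: "pdeg P m = k" if "m \<in> keys (s0 * rk)" for m
    using that keys_mult[of s0 rk] by (auto simp: rk_keys s0_keys pdeg_add)
  have carr: "s0 \<in> carrier (poly_ring d)" "rk \<in> carrier (poly_ring d)"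
      "s - s0 \<in> carrier (poly_ring d)" "r - rk \<in> carrier (poly_ring d)"
    using r s by (auto simp: poly_ring_carrier_iff rk_keys s0_keys in_keys_iff
        lookup_minus rk_def s0_def lookup_restrict_poly split: if_splits)
  have hi_s: "s - s0 \<in> mspan (pdeg_ge d P 1)"
    using carr(3) by (auto simp: mspan_def pdeg_ge_def poly_ring_carrier_iff in_keys_iff
        lookup_minus s0_def lookup_restrict_poly split: if_splits)
  have hi_r: "r - rk \<in> mspan (pdeg_ge d P (Suc k))"
    unfolding mspan_def
  proof safe
    fix m assume m: "m \<in> keys (r - rk)"
    then have "m \<in> keys r" "pdeg P m \<noteq> k"
      by (auto simp: in_keys_iff lookup_minus rk_def lookup_restrict_poly split: if_splits)
    then have "Suc k \<le> pdeg P m"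
      using kmin[of m] by simp
    then show "m \<in> pdeg_ge d P (Suc k)"
      using m carr(4) by (auto simp: pdeg_ge_def poly_ring_carrier_iff)
  qed
  have hi_rk: "rk \<in> mspan (pdeg_ge d P k)"
    using carr(2) by (auto simp: mspan_def pdeg_ge_def poly_ring_carrier_iff rk_keys)
  have hi_s': "s \<in> mspan (pdeg_ge d P 0)"
    using s by (auto simp: mspan_def pdeg_ge_def poly_ring_carrier_iff)
  \<comment> \<open>Both summands have \<open>P\<close>-degree above \<open>k\<close>, so the
    monomials of \<open>s0 * rk\<close> survive in \<open>s * r\<close>.\<close>
  have "s * r - s0 * rk = s * (r - rk) + (s - s0) * rk"
    by (simp add: algebra_simps)
  moreover have "s * (r - rk) \<in> mspan (pdeg_ge d P (Suc k))" "(s - s0) * rk \<in> mspan (pdeg_ge d P (Suc k))"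
    using mult_pdeg_ge[OF hi_s' hi_r] mult_pdeg_ge[OF hi_s hi_rk] by auto
  ultimately have "s * r - s0 * rk \<in> mspan (pdeg_ge d P (Suc k))"
    using keys_add[of "s * (r - rk)" "(s - s0) * rk"] unfolding mspan_def by auto
  moreover obtain m where m: "m \<in> keys (s0 * rk)"
    using prod by (metis keys_eq_empty equals0I)
  ultimately have "m \<notin> keys (s * r - s0 * rk)"
    using keys_prod[OF m] by (auto simp: mspan_def pdeg_ge_def)
  then have "m \<in> keys (s * r)"
    using m by (simp add: lookup_minus in_keys_iff)
  then show False
    using sr keys_prod[OF m] kn by (auto simp: mspan_def pdeg_ge_def)
qed

text \<open>Primality is \<open>pdeg_ge_cancel\<close> at exponent one: a factor outside the ideal
  can be cancelled.\<close>

lemma primeideal_var: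
  "primeideal (mspan (pdeg_ge d P (Suc 0)) :: 'k::field mpoly set) (poly_ring d)"
proof -
  interpret cring "poly_ring d :: 'k mpoly ring" by (rule cring_poly_ring)
  have one: "(1 :: 'k mpoly) \<notin> mspan (pdeg_ge d P (Suc 0))"
    by (simp add: mspan_def pdeg_ge_def pdeg_def)
  show ?thesis
  proof (intro primeideal.intro ideal_mspan expo_upset_pdeg_ge primeideal_axioms.intro)
    show "carrier (poly_ring d) \<noteq> (mspan (pdeg_ge d P (Suc 0)) :: 'k mpoly set)"
      using one one_closed by (auto simp: poly_ring_simps)
    show "a \<in> mspan (pdeg_ge d P (Suc 0)) \<or> b \<in> mspan (pdeg_ge d P (Suc 0))"
      if "a \<in> carrier (poly_ring d)" "b \<in> carrier (poly_ring d)"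
        "a \<otimes>\<^bsub>poly_ring d\<^esub> b \<in> mspan (pdeg_ge d P (Suc 0))" for a b :: "'k mpoly"
      using pdeg_ge_cancel[OF that(2,1), where n = "Suc 0" and P = P] that(3) by (auto simp: poly_ring_simps)
  qed (rule cring_poly_ring)
qed

section \<open>Symbolic powers of squarefree monomial ideals\<close>

text \<open>The generators are read as edges of a hypergraph on the variables. The boundary cases
  come out right: for \<open>E = {}\<close> (zero ideal) the empty set is the only minimal cover,
  and for \<open>0 \<in> E\<close> (unit ideal) there is no cover.\<close>

definition vertex_cover :: "nat \<Rightarrow> (nat \<Rightarrow>\<^sub>0 nat) set \<Rightarrow> nat set \<Rightarrow> bool" where
  "vertex_cover d E P \<longleftrightarrow> P \<subseteq> {..<d} \<and> (\<forall>m\<in>E. keys m \<inter> P \<noteq> {})"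

definition min_covers :: "nat \<Rightarrow> (nat \<Rightarrow>\<^sub>0 nat) set \<Rightarrow> nat set set" where
  "min_covers d E = {P. vertex_cover d E P \<and> (\<forall>Q. vertex_cover d E Q \<and> Q \<subseteq> P \<longrightarrow> Q = P)}"

abbreviation var_ideal :: "nat \<Rightarrow> nat set \<Rightarrow> 'k::field mpoly set" where
  "var_ideal d P \<equiv> mspan (pdeg_ge d P (Suc 0))"

lemma pdeg_pos_iff: "finite P \<Longrightarrow> Suc 0 \<le> pdeg P m \<longleftrightarrow> keys m \<inter> P \<noteq> {}"
  using sum_eq_0_iff[of P "lookup m"]
  by (auto simp: pdeg_def Suc_le_eq in_keys_iff simp flip: neq0_conv)

lemma subset_lessThan_finite: "P \<subseteq> {..<d::nat} \<Longrightarrow> finite P"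
  by (rule finite_subset) auto

lemma expo_decompose:
  assumes "v \<in> keys (m :: nat \<Rightarrow>\<^sub>0 nat)"
  shows "m = Poly_Mapping.single v 1 + (m - Poly_Mapping.single v 1)"
  using assms by (intro poly_mapping_eqI) (auto simp: lookup_add lookup_minus lookup_single in_keys_iff when_def)

lemma keys_diff_single: "keys (m - Poly_Mapping.single v (1::nat)) \<subseteq> keys m"
  by (auto simp: in_keys_iff lookup_minus)

lemma ideal_sum_mem:
  assumes "ideal Q (poly_ring d)" "\<And>x. x \<in> A \<Longrightarrow> g x \<in> Q"
  shows "(\<Sum>x\<in>A. g x :: 'k::field mpoly) \<in> Q"
proof -
  interpret ideal Q "poly_ring d" by fact
  have zero: "0 \<in> Q" and add: "a + b \<in> Q" if "a \<in> Q" "b \<in> Q" for a b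
    using additive_subgroup.zero_closed[OF ideal.axioms(1)[OF assms(1)]]
      additive_subgroup.a_closed[OF ideal.axioms(1)[OF assms(1)] that]
    by (simp_all add: poly_ring_simps)
  show ?thesis
    using assms(2)
  proof (induction A rule: infinite_finite_induct)
  qed (use additive_subgroup.zero_closed[OF ideal.axioms(1)[OF assms(1)]] in
      \<open>auto simp: poly_ring_simps intro: add\<close>)
qed

lemma mpoly_mem_idealI:
  assumes "ideal Q (poly_ring d)" "\<And>m. m \<in> keys f \<Longrightarrow> Poly_Mapping.single m (lookup f m) \<in> Q"
  shows "(f :: 'k::field mpoly) \<in> Q"
  using ideal_sum_mem[OF assms(1), of "keys f" "\<lambda>m. Poly_Mapping.single m (lookup f m)"] assms(2)
    mpoly_expand[of f] by simp

lemma ideal_mult_mem: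
  assumes "ideal Q (poly_ring d)" "f \<in> Q" "g \<in> carrier (poly_ring d)"
  shows "f * (g :: 'k::field mpoly) \<in> Q"
  using ideal.I_r_closed[OF assms] by (simp add: poly_ring_simps)

text \<open>Induction on the total degree: splitting off one variable, the prime contains that
  variable or the remaining monomial. The exponent \<open>0\<close> cannot be reached, as it would
  put \<open>1\<close> into \<open>Q\<close>.\<close>

lemma prime_monomial_var:
  assumes Q: "primeideal (Q :: 'k::field mpoly set) (poly_ring d)"
    and "keys m \<subseteq> {..<d}" "monomial m \<in> Q"
  shows "\<exists>v\<in>keys m. monomial (Poly_Mapping.single v 1) \<in> Q"
  using assms(2,3)
proof (induction "pdeg {..<d} m" arbitrary: m rule: less_induct)
  case less
  interpret primeideal Q "poly_ring d" by fact
  show ?case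
  proof (cases "keys m = {}")
    case True
    then have "(1 :: 'k mpoly) \<in> Q"
      using less.prems by (simp add: monomial_0)
    then have "Q = carrier (poly_ring d)"
      using one_imp_carrier by (simp add: poly_ring_simps)
    then show ?thesis
      using I_notcarr by simp
  next
    case False
    then obtain v where v: "v \<in> keys m" by blast
    define m' where "m' = m - Poly_Mapping.single v 1"
    have m: "m = Poly_Mapping.single v 1 + m'"
      unfolding m'_def by (rule expo_decompose[OF v])
    have "keys m' \<subseteq> keys m"
      unfolding m'_def by (rule keys_diff_single)
    have "v < d" using v less.prems by auto
    have "pdeg {..<d} (Poly_Mapping.single v 1) \<ge> 1"
      using \<open>v < d\<close> pdeg_pos_iff[of "{..<d}" "Poly_Mapping.single v 1"] by auto
    then have lt: "pdeg {..<d} m' < pdeg {..<d} m"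
      by (subst m) (simp add: pdeg_add)
    have "monomial (Poly_Mapping.single v 1) * monomial m' \<in> Q"
      using less.prems(2) by (subst (asm) m) (simp add: monomial_mult)
    moreover have "monomial (Poly_Mapping.single v 1) \<in> carrier (poly_ring d :: 'k mpoly ring)"
        "monomial m' \<in> carrier (poly_ring d :: 'k mpoly ring)"
      using \<open>v < d\<close> \<open>keys m' \<subseteq> keys m\<close> less.prems by (auto intro!: monomial_carrier)
    ultimately have "monomial (Poly_Mapping.single v 1) \<in> Q \<or> monomial m' \<in> Q"
      using I_prime by (simp add: poly_ring_simps)
    then show ?thesis
      using less.hyps[OF lt] less.prems \<open>keys m' \<subseteq> keys m\<close> v by blast
  qed
qed

lemma var_ideal_subset:
  assumes Q: "ideal (Q :: 'k::field mpoly set) (poly_ring d)" and P: "P \<subseteq> {..<d}"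
    and vars: "\<And>v. v \<in> P \<Longrightarrow> monomial (Poly_Mapping.single v 1) \<in> Q"
  shows "var_ideal d P \<subseteq> Q"
proof
  fix f :: "'k mpoly" assume f: "f \<in> var_ideal d P"
  show "f \<in> Q"
  proof (rule mpoly_mem_idealI[OF Q])
    fix m assume "m \<in> keys f"
    then have m: "keys m \<subseteq> {..<d}" "Suc 0 \<le> pdeg P m"
      using f by (auto simp: mspan_def pdeg_ge_def)
    then obtain v where v: "v \<in> keys m" "v \<in> P"
      using pdeg_pos_iff[of P m] subset_lessThan_finite[OF P] by auto
    have "Poly_Mapping.single m (lookup f m) =
        monomial (Poly_Mapping.single v 1) * Poly_Mapping.single (m - Poly_Mapping.single v 1) (lookup f m)"
      unfolding monomial_def mult_single by (subst expo_decompose[OF v(1)]) simp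
    also have "\<dots> \<in> Q"
      using m keys_diff_single[of m v] by (intro ideal_mult_mem[OF Q] vars v single_carrier) blast
    finally show "Poly_Mapping.single m (lookup f m) \<in> Q" .
  qed
qed

lemma var_mem_var_ideal:
  assumes "P \<subseteq> {..<d}"
  shows "monomial (Poly_Mapping.single v 1) \<in> (var_ideal d P :: 'k::field mpoly set) \<longleftrightarrow> v \<in> P"
  using assms pdeg_pos_iff[of P "Poly_Mapping.single v 1"] subset_lessThan_finite[OF assms]
  by (auto simp: mspan_def pdeg_ge_def)

lemma var_ideal_mono_iff:
  assumes "P \<subseteq> {..<d}" "P' \<subseteq> {..<d}"
  shows "(var_ideal d P :: 'k::field mpoly set) \<subseteq> var_ideal d P' \<longleftrightarrow> P \<subseteq> P'"
proof
  assume "(var_ideal d P :: 'k::field mpoly set) \<subseteq> var_ideal d P'"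
  then show "P \<subseteq> P'"
    using var_mem_var_ideal[OF assms(1), where 'k='k] var_mem_var_ideal[OF assms(2), where 'k='k] by blast
next
  assume "P \<subseteq> P'"
  then show "(var_ideal d P :: 'k::field mpoly set) \<subseteq> var_ideal d P'"
    using assms var_mem_var_ideal[OF assms(2), where 'k='k]
    by (intro var_ideal_subset ideal_mspan expo_upset_pdeg_ge) auto
qed

section \<open>Minimal primes of a squarefree monomial ideal\<close>

locale squarefree_monomials =
  fixes d :: nat and E :: "(nat \<Rightarrow>\<^sub>0 nat) set" and I :: "'k::field mpoly set"
  assumes E_vars: "m \<in> E \<Longrightarrow> keys m \<subseteq> {..<d}"
    and E_sqfree: "m \<in> E \<Longrightarrow> lookup m v \<le> 1"
    and I_def: "I = Idl\<^bsub>poly_ring d\<^esub> (monomial ` E)"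
begin

sublocale cring "poly_ring d :: 'k mpoly ring" by (rule cring_poly_ring)

lemma gens_carrier: "(monomial ` E :: 'k mpoly set) \<subseteq> carrier (poly_ring d)"
  using E_vars by (auto intro: monomial_carrier)

lemma ideal_I: "ideal I (poly_ring d)"
  unfolding I_def by (rule genideal_ideal[OF gens_carrier])

lemma gen_mem: "m \<in> E \<Longrightarrow> monomial m \<in> I"
  using genideal_self[OF gens_carrier] unfolding I_def by auto

lemma I_subset_iff:
  assumes "ideal Q (poly_ring d)"
  shows "I \<subseteq> Q \<longleftrightarrow> monomial ` E \<subseteq> Q"
  unfolding I_def using Idl_subset_ideal[OF assms gens_carrier] .

lemma I_subset_var_ideal:
  assumes "P \<subseteq> {..<d}"
  shows "I \<subseteq> var_ideal d P \<longleftrightarrow> vertex_cover d E P"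
proof -
  have "I \<subseteq> var_ideal d P \<longleftrightarrow> monomial ` E \<subseteq> (var_ideal d P :: 'k mpoly set)"
    by (rule I_subset_iff[OF ideal_mspan[OF expo_upset_pdeg_ge]])
  also have "\<dots> \<longleftrightarrow> (\<forall>m\<in>E. m \<in> pdeg_ge d P (Suc 0))"
    by (auto simp: mspan_def)
  also have "\<dots> \<longleftrightarrow> (\<forall>m\<in>E. keys m \<inter> P \<noteq> {})"
    using E_vars pdeg_pos_iff[OF subset_lessThan_finite[OF assms]] by (simp add: pdeg_ge_def)
  also have "\<dots> \<longleftrightarrow> vertex_cover d E P"
    using assms by (simp add: vertex_cover_def)
  finally show ?thesis .
qed

lemma min_coversD:
  assumes "P \<in> min_covers d E"
  shows "P \<subseteq> {..<d}" "vertex_cover d E P" "finite P"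
  using assms subset_lessThan_finite by (auto simp: min_covers_def vertex_cover_def)

lemma min_cover_below:
  assumes "vertex_cover d E P'"
  shows "\<exists>P\<in>min_covers d E. P \<subseteq> P'"
proof -
  let ?A = "{Q. vertex_cover d E Q \<and> Q \<subseteq> P'}"
  have "finite ?A"
    by (rule finite_subset[of _ "Pow {..<d}"]) (auto simp: vertex_cover_def)
  moreover have "?A \<noteq> {}" using assms by blast
  ultimately obtain P where "P \<in> ?A" "\<forall>Q\<in>?A. Q \<subseteq> P \<longrightarrow> P = Q"
    using finite_has_minimal[of ?A] by blast
  then have P: "vertex_cover d E P" "P \<subseteq> P'"
    and min: "\<And>Q. vertex_cover d E Q \<Longrightarrow> Q \<subseteq> P' \<Longrightarrow> Q \<subseteq> P \<Longrightarrow> P = Q"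
    by auto
  have "Q = P" if "vertex_cover d E Q" "Q \<subseteq> P" for Q
    using min[OF that(1) subset_trans[OF that(2) P(2)] that(2)] by simp
  then have "P \<in> min_covers d E"
    using P(1) by (simp add: min_covers_def)
  then show ?thesis using P(2) by blast
qed

text \<open>The variables in \<open>Q\<close> form a vertex cover, because \<open>Q\<close> contains
  each generator and hence one of its variables; a minimal cover below it does the job.\<close>

lemma prime_above_cover:
  assumes Q: "primeideal Q (poly_ring d)" "I \<subseteq> Q"
  shows "\<exists>P\<in>min_covers d E. var_ideal d P \<subseteq> Q"
proof -
  define P' where "P' = {v. v < d \<and> monomial (Poly_Mapping.single v 1) \<in> Q}"
  have "vertex_cover d E P'"
    unfolding vertex_cover_def
  proof (intro conjI ballI)
    fix m assume m: "m \<in> E"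
    then have "monomial m \<in> Q" using gen_mem Q by blast
    from prime_monomial_var[OF Q(1) E_vars[OF m] this]
    show "keys m \<inter> P' \<noteq> {}" using E_vars[OF m] unfolding P'_def by blast
  qed (auto simp: P'_def)
  then obtain P where "P \<in> min_covers d E" "P \<subseteq> P'"
    using min_cover_below by blast
  moreover from this have "var_ideal d P \<subseteq> Q"
    using min_coversD(1) by (intro var_ideal_subset primeideal.axioms(1)[OF Q(1)]) (auto simp: P'_def)
  ultimately show ?thesis by blast
qed

text \<open>Every prime over \<open>I\<close> contains one of these ideals, and none of them
  contains another, since inclusion of the ideals is inclusion of the covers.\<close>

lemma minimal_primes_eq: "minimal_primes (poly_ring d) I = var_ideal d ` min_covers d E"
proof (intro equalityI subsetI)
  fix Q assume "Q \<in> minimal_primes (poly_ring d) I"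
  then have Q: "primeideal Q (poly_ring d)" "I \<subseteq> Q"
    and min: "\<And>Q'. primeideal Q' (poly_ring d) \<Longrightarrow> I \<subseteq> Q' \<Longrightarrow> Q' \<subseteq> Q \<Longrightarrow> Q' = Q"
    unfolding minimal_primes_def by blast+
  obtain P where P: "P \<in> min_covers d E" "var_ideal d P \<subseteq> Q"
    using prime_above_cover[OF Q] by blast
  have "var_ideal d P = Q"
    using P min_coversD[OF P(1)] by (intro min primeideal_var) (simp_all add: I_subset_var_ideal)
  then show "Q \<in> var_ideal d ` min_covers d E" using P by blast
next
  fix Q :: "'k mpoly set" assume "Q \<in> var_ideal d ` min_covers d E"
  then obtain P where P: "P \<in> min_covers d E" and Q: "Q = var_ideal d P" by blast
  have "Q' = Q" if Q': "primeideal Q' (poly_ring d)" "I \<subseteq> Q'" "Q' \<subseteq> Q" for Q'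
  proof -
    obtain P' where P': "P' \<in> min_covers d E" "var_ideal d P' \<subseteq> Q'"
      using prime_above_cover[OF Q'(1,2)] by blast
    then have "(var_ideal d P' :: 'k mpoly set) \<subseteq> var_ideal d P" using Q' Q by blast
    then have "P' \<subseteq> P"
      using var_ideal_mono_iff min_coversD(1)[OF P] min_coversD(1)[OF P'(1)] by blast
    then have "P' = P" using P P' unfolding min_covers_def by blast
    then show ?thesis using P' Q Q' by blast
  qed
  then show "Q \<in> minimal_primes (poly_ring d) I"
    using P min_coversD[OF P] primeideal_var unfolding minimal_primes_def Q
    by (auto simp: I_subset_var_ideal)
qed

section \<open>Powers of the ideal, localized at a minimal prime\<close>

lemma pow_simps:
  "I [^]\<^bsub>ideals_set (poly_ring d)\<^esub> (0::nat) = carrier (poly_ring d)"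
  "I [^]\<^bsub>ideals_set (poly_ring d)\<^esub> Suc n = ideal_prod (poly_ring d) (I [^]\<^bsub>ideals_set (poly_ring d)\<^esub> n) I"
  by (simp_all add: ideals_set_def nat_pow_def)

lemma ideal_pow: "ideal (I [^]\<^bsub>ideals_set (poly_ring d)\<^esub> (n::nat)) (poly_ring d)"
  by (induction n) (simp_all only: pow_simps oneideal ideal_prod_is_ideal ideal_I)

lemma pow_subset:
  assumes "vertex_cover d E P"
  shows "I [^]\<^bsub>ideals_set (poly_ring d)\<^esub> n \<subseteq> mspan (pdeg_ge d P n)"
proof (induction n)
  case 0
  show ?case
    unfolding pow_simps by (simp add: mspan_def pdeg_ge_def poly_ring_carrier_iff subset_iff)
next
  case (Suc n)
  have I: "I \<subseteq> var_ideal d P"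
    using assms I_subset_var_ideal by (simp add: vertex_cover_def)
  interpret D: ideal "mspan (pdeg_ge d P (Suc n)) :: 'k mpoly set" "poly_ring d"
    by (rule ideal_mspan[OF expo_upset_pdeg_ge])
  show ?case unfolding pow_simps
  proof
    fix f assume "f \<in> ideal_prod (poly_ring d) (I [^]\<^bsub>ideals_set (poly_ring d)\<^esub> n) I"
    then show "f \<in> mspan (pdeg_ge d P (Suc n))"
    proof induction
      case (prod i j)
      then show ?case
        using mult_pdeg_ge[of i d P n j 1] Suc I by (auto simp: poly_ring_simps)
    next
      case (sum s1 s2)
      then show ?case by blast
    qed
  qed
qed

text \<open>Otherwise \<open>P - {v}\<close> would still be a cover. Such a generator shows that
  \<open>x_v\<close> lies in the localization of \<open>I\<close> at \<open>P\<close>, because its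
  other variables become units there.\<close>

lemma min_cover_private_gen:
  assumes P: "P \<in> min_covers d E" and v: "v \<in> P"
  shows "\<exists>e\<in>E. keys e \<inter> P = {v}"
proof (rule ccontr)
  assume no: "\<not> ?thesis"
  have "vertex_cover d E (P - {v})"
    unfolding vertex_cover_def
  proof (intro conjI ballI)
    show "P - {v} \<subseteq> {..<d}" using min_coversD[OF P] by blast
    fix m assume "m \<in> E"
    then show "keys m \<inter> (P - {v}) \<noteq> {}"
      using no min_coversD(2)[OF P] unfolding vertex_cover_def by blast
  qed
  then show False using P v unfolding min_covers_def by blast
qed

text \<open>The \<open>n\<close>-th power of the product of all variables outside \<open>P\<close>:
  a unit after localizing at \<open>P\<close>, and the denominator that brings powers of the prime
  into powers of \<open>I\<close>.\<close>

definition cofactor :: "nat set \<Rightarrow> nat \<Rightarrow> (nat \<Rightarrow>\<^sub>0 nat)" where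
  "cofactor P n = Abs_poly_mapping (\<lambda>v. if v < d \<and> v \<notin> P then n else 0)"

lemma lookup_cofactor: "lookup (cofactor P n) v = (if v < d \<and> v \<notin> P then n else 0)"
  unfolding cofactor_def by (subst lookup_Abs_poly_mapping) auto

lemma keys_cofactor: "keys (cofactor P n) \<subseteq> {..<d}"
  by (auto simp: in_keys_iff lookup_cofactor split: if_splits)

text \<open>Each induction step trades one variable \<open>x_v\<close> with
  \<open>v \<in> P\<close>, together with one copy of the outside variables, for a multiple of one
  generator; \<open>n\<close> trades give a product of \<open>n\<close> elements of
  \<open>I\<close>.\<close>

lemma monomial_cofactor_pow:
  assumes P: "P \<in> min_covers d E"
  shows "keys m \<subseteq> {..<d} \<Longrightarrow> n \<le> pdeg P m \<Longrightarrow>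
    monomial (m + cofactor P n) \<in> I [^]\<^bsub>ideals_set (poly_ring d)\<^esub> n"
proof (induction n arbitrary: m)
  case 0
  then show ?case using keys_cofactor by (simp only: pow_simps, intro monomial_carrier) (auto simp: keys_add_nat)
next
  case (Suc n)
  obtain v where v: "v \<in> keys m" "v \<in> P"
    using Suc.prems pdeg_pos_iff[of P m] min_coversD[OF P] by auto
  define m' where "m' = m - Poly_Mapping.single v 1"
  have m: "m = Poly_Mapping.single v 1 + m'"
    unfolding m'_def by (rule expo_decompose[OF v(1)])
  have km: "keys m' \<subseteq> {..<d}"
    using Suc.prems(1) keys_diff_single[of m v] unfolding m'_def by blast
  have "pdeg P (Poly_Mapping.single v 1) = 1"
    using v(2) min_coversD[OF P] by (simp add: pdeg_def lookup_single when_def)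
  then have "n \<le> pdeg P m'"
    using Suc.prems(2) by (subst (asm) m) (simp add: pdeg_add)
  then have 1: "monomial (m' + cofactor P n) \<in> I [^]\<^bsub>ideals_set (poly_ring d)\<^esub> n"
    using Suc.IH km by blast
  obtain e where e: "e \<in> E" "keys e \<inter> P = {v}"
    using min_cover_private_gen[OF P v(2)] by blast
  \<comment> \<open>The generator \<open>e\<close> is squarefree and meets \<open>P\<close> only in
    \<open>v\<close>, so it divides \<open>x_v\<close> times the product of the outside variables;
    \<open>r\<close> is the complementary exponent.\<close>
  define r where "r = Poly_Mapping.single v 1 + cofactor P 1 - e"
  have e_le: "lookup e w \<le> lookup (Poly_Mapping.single v 1 + cofactor P 1) w" for w
    using E_sqfree[OF e(1), of w] subsetD[OF E_vars[OF e(1)], of w] e(2)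
    by (cases "w \<in> keys e") (auto simp: lookup_add lookup_cofactor lookup_single when_def in_keys_iff)
  have re: "e + r = Poly_Mapping.single v 1 + cofactor P 1"
    using e_le by (intro poly_mapping_eqI) (simp add: r_def lookup_add lookup_minus)
  have "keys r \<subseteq> keys (Poly_Mapping.single v 1 + cofactor P 1)"
    unfolding re[symmetric] by (auto simp: keys_add_nat)
  also have "\<dots> \<subseteq> {..<d}"
    using keys_cofactor[of P 1] Suc.prems(1) v(1) by (auto simp: keys_add_nat)
  finally have "monomial e * monomial r \<in> I"
    by (intro ideal_mult_mem[OF ideal_I] gen_mem e monomial_carrier)
  then have 2: "monomial (Poly_Mapping.single v 1 + cofactor P 1) \<in> I"
    by (simp add: monomial_mult re)
  have "m + cofactor P (Suc n) = (m' + cofactor P n) + (Poly_Mapping.single v 1 + cofactor P 1)"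
    by (subst m, rule poly_mapping_eqI) (simp add: lookup_add lookup_cofactor)
  then have "monomial (m + cofactor P (Suc n)) =
      monomial (m' + cofactor P n) \<otimes>\<^bsub>poly_ring d\<^esub> (monomial (Poly_Mapping.single v 1 + cofactor P 1) :: 'k mpoly)"
    by (simp add: monomial_mult poly_ring_simps)
  then show ?case
    using ideal_prod.prod[OF 1 2, of "poly_ring d"] by (simp only: pow_simps)
qed

text \<open>The polynomials form a domain and \<open>0\<close> is not a denominator, so the
  auxiliary factor in \<open>frac_rel\<close> cancels and equality of fractions is
  cross-multiplication.\<close>

lemma mod_frac_regular_eq_iff:
  assumes W: "W \<subseteq> carrier (poly_ring d)" "0 \<notin> W" "1 \<in> W" and
    r: "r \<in> carrier (poly_ring d)" and a: "a \<in> carrier (poly_ring d)" and s: "s \<in> W"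
  shows "mod_frac (regular_module (poly_ring d)) W r 1 = mod_frac (regular_module (poly_ring d)) W a s
     \<longleftrightarrow> a = s * (r :: 'k mpoly)"
proof -
  have rel: "mod_frac (regular_module (poly_ring d)) W x t =
      {(y, u). y \<in> carrier (poly_ring d) \<and> u \<in> W \<and> u * x = t * y}"
    if "x \<in> carrier (poly_ring d)" "t \<in> W" for x t :: "'k mpoly"
    using that W by (auto simp: mod_frac_def frac_rel_def regular_module_def poly_ring_simps)
  show ?thesis
  proof
    assume "mod_frac (regular_module (poly_ring d)) W r 1 = mod_frac (regular_module (poly_ring d)) W a s"
    moreover have "(a, s) \<in> mod_frac (regular_module (poly_ring d)) W a s"
      using a s by (simp add: rel)
    ultimately have "(a, s) \<in> mod_frac (regular_module (poly_ring d)) W r 1"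
      by simp
    then show "a = s * r"
      using r W(3) by (simp add: rel)
  next
    assume "a = s * r"
    moreover have "s \<noteq> 0" using s W by blast
    ultimately show "mod_frac (regular_module (poly_ring d)) W r 1 = mod_frac (regular_module (poly_ring d)) W a s"
      using r a s W(3) by (auto simp: rel mult.left_commute)
  qed
qed

text \<open>At a minimal prime \<open>I\<close> and the prime have the same localization. One
  inclusion is that powers of a variable prime are primary (\<open>pdeg_ge_cancel\<close>), the
  other exhibits the denominator \<open>monomial (cofactor P n)\<close>.\<close>

lemma loc_contraction_eq:
  assumes P: "P \<in> min_covers d E"
  shows "loc_contraction (poly_ring d) (var_ideal d P) (I [^]\<^bsub>ideals_set (poly_ring d)\<^esub> n)
    = mspan (pdeg_ge d P n)" (is "?L = _")
proof -
  define W :: "'k mpoly set" where "W = carrier (poly_ring d) - var_ideal d P"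
  have W: "W \<subseteq> carrier (poly_ring d)" "0 \<notin> W" "1 \<in> W"
    using one_closed by (auto simp: W_def mspan_def pdeg_ge_def pdeg_def poly_ring_simps)
  have pow_carrier: "a \<in> carrier (poly_ring d)" if "a \<in> I [^]\<^bsub>ideals_set (poly_ring d)\<^esub> n" for a
    using ideal.Icarr[OF ideal_pow that] .
  have L: "?L = {r \<in> carrier (poly_ring d). \<exists>s\<in>W. s * r \<in> I [^]\<^bsub>ideals_set (poly_ring d)\<^esub> n}"
    unfolding loc_contraction_def Let_def W_def[symmetric]
    using mod_frac_regular_eq_iff[OF W] pow_carrier by (auto simp: poly_ring_simps; blast)
  show ?thesis
  proof (intro equalityI subsetI)
    fix r assume "r \<in> ?L"
    then obtain s where s: "r \<in> carrier (poly_ring d)" "s \<in> W" "s * r \<in> I [^]\<^bsub>ideals_set (poly_ring d)\<^esub> n"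
      unfolding L by blast
    then show "r \<in> mspan (pdeg_ge d P n)"
      using pdeg_ge_cancel[of r d s P n] pow_subset[OF min_coversD(2)[OF P]] unfolding W_def
      by (metis DiffD1 DiffD2 One_nat_def subsetD)
  next
    fix r :: "'k mpoly" assume r: "r \<in> mspan (pdeg_ge d P n)"
    then have rc: "r \<in> carrier (poly_ring d)"
      by (auto simp: mspan_def pdeg_ge_def poly_ring_carrier_iff)
    have "pdeg P (cofactor P n) = 0"
      by (simp add: pdeg_def lookup_cofactor)
    then have s: "monomial (cofactor P n) \<in> W"
      using monomial_carrier[OF keys_cofactor] by (simp add: W_def mspan_def pdeg_ge_def)
    \<comment> \<open>The coefficients are split off as constant factors, so that each term is a
      multiple of a monomial to which \<open>monomial_cofactor_pow\<close> applies.\<close>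
    have "monomial (cofactor P n) * r =
        (\<Sum>m\<in>keys r. monomial (m + cofactor P n) * Poly_Mapping.single 0 (lookup r m))"
      by (subst mpoly_expand[of r]) (simp add: sum_distrib_left monomial_def mult_single add.commute)
    also have "\<dots> \<in> I [^]\<^bsub>ideals_set (poly_ring d)\<^esub> n"
      using r by (intro ideal_sum_mem[OF ideal_pow] ideal_mult_mem[OF ideal_pow]
          monomial_cofactor_pow[OF P] single_carrier) (auto simp: mspan_def pdeg_ge_def)
    finally show "r \<in> ?L"
      unfolding L using rc s by blast
  qed
qed

text \<open>Without minimal covers the condition is vacuous and the span is the whole ring, as it
  should be for the unit ideal.\<close>

definition symbolic_expos :: "nat \<Rightarrow> (nat \<Rightarrow>\<^sub>0 nat) set" where
  "symbolic_expos n = {m. keys m \<subseteq> {..<d} \<and> (\<forall>P\<in>min_covers d E. n \<le> pdeg P m)}"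

lemma expo_upset_symbolic: "expo_upset d (symbolic_expos n)"
  by (auto simp: expo_upset_def symbolic_expos_def keys_add_nat pdeg_add intro: trans_le_add1)

lemma symbolic_power_eq: "symbolic_power (poly_ring d) I n = mspan (symbolic_expos n)"
proof -
  have "symbolic_power (poly_ring d) I n =
      carrier (poly_ring d) \<inter> (\<Inter>P\<in>min_covers d E. mspan (pdeg_ge d P n))"
    unfolding symbolic_power_def minimal_primes_eq using loc_contraction_eq by auto
  also have "\<dots> = mspan (symbolic_expos n)"
    by (simp add: mspan_def pdeg_ge_def symbolic_expos_def poly_ring_carrier_iff set_eq_iff subset_iff) blast
  finally show ?thesis .
qed

text \<open>The full set \<open>{..<d}\<close> is a cover unless some generator is \<open>1\<close>;
  conversely a cover places \<open>I\<close> inside a proper variable ideal.\<close>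

lemma min_covers_empty_iff: "min_covers d E = {} \<longleftrightarrow> I = carrier (poly_ring d)"
proof
  assume "min_covers d E = {}"
  then have "\<not> vertex_cover d E {..<d}"
    using min_cover_below by blast
  then obtain m where "m \<in> E" "keys m \<inter> {..<d} = {}"
    by (auto simp: vertex_cover_def)
  then have "m \<in> E" "m = 0"
    using E_vars[of m] by (metis Int_absorb2 keys_eq_empty)+
  then have "1 \<in> I" using gen_mem[of m] by (simp add: monomial_0)
  then show "I = carrier (poly_ring d)"
    using ideal.one_imp_carrier[OF ideal_I] by (simp add: poly_ring_simps)
next
  assume I: "I = carrier (poly_ring d)"
  have "P \<notin> min_covers d E" for P
  proof
    assume "P \<in> min_covers d E"
    then have "I \<subseteq> var_ideal d P"
      using min_coversD[of P] I_subset_var_ideal by blast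
    then have "(1 :: 'k mpoly) \<in> var_ideal d P"
      using I one_closed by (auto simp: poly_ring_simps)
    then show False by (simp add: mspan_def pdeg_ge_def pdeg_def)
  qed
  then show "min_covers d E = {}" by blast
qed

end

section \<open>Cochains on a family of sets\<close>

definition alt_sign :: "nat \<Rightarrow> nat set \<Rightarrow> 'a::ring_1" where
  "alt_sign v T = (if even (card {u \<in> T. u < v}) then 1 else - 1)"

text \<open>The families in question contain a fixed set of negative coordinates and are not closed
  under subsets. These are thus relative cochains: functions supported on \<open>K\<close>, with the
  differential cut off outside \<open>K\<close>.\<close>

definition comb_diff :: "nat set set \<Rightarrow> (nat set \<Rightarrow> 'k::field) \<Rightarrow> nat set \<Rightarrow> 'k" where
  "comb_diff K \<psi> T = (if T \<in> K then \<Sum>v\<in>T. alt_sign v T * \<psi> (T - {v}) else 0)"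

definition comb_cochain :: "nat set set \<Rightarrow> nat \<Rightarrow> (nat set \<Rightarrow> 'k::field) \<Rightarrow> bool" where
  "comb_cochain K p \<phi> \<longleftrightarrow> (\<forall>S. \<phi> S \<noteq> 0 \<longrightarrow> S \<in> K \<and> card S = p)"

definition comb_coboundary :: "nat set set \<Rightarrow> nat \<Rightarrow> (nat set \<Rightarrow> 'k::field) \<Rightarrow> bool" where
  "comb_coboundary K i \<phi> \<longleftrightarrow> (case i of 0 \<Rightarrow> \<forall>S. \<phi> S = 0
     | Suc p \<Rightarrow> \<exists>\<psi>. comb_cochain K p \<psi> \<and> (\<forall>T. card T = i \<longrightarrow> \<phi> T = comb_diff K \<psi> T))"

definition comb_cohomology_nonzero :: "'k::field itself \<Rightarrow> nat set set \<Rightarrow> nat \<Rightarrow> bool" where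
  "comb_cohomology_nonzero _ K i \<longleftrightarrow> (\<exists>\<phi> :: nat set \<Rightarrow> 'k. comb_cochain K i \<phi> \<and>
     (\<forall>T. card T = Suc i \<longrightarrow> comb_diff K \<phi> T = 0) \<and> \<not> comb_coboundary K i \<phi>)"

lemma alt_sign_square: "alt_sign v T * alt_sign v T = (1 :: 'a::ring_1)"
  by (simp add: alt_sign_def)

text \<open>Of \<open>u\<close> and \<open>v\<close> only the larger one has the other below it, so
  exactly one of the two signs changes. This is the sign rule behind the contracting
  homotopy.\<close>

lemma alt_sign_exchange:
  assumes "finite T" "u \<in> T" "v \<notin> T"
  shows "alt_sign u T * alt_sign v (insert v T - {u}) =
    - (alt_sign v (insert v T) * alt_sign u (insert v T) :: 'a::ring_1)"
proof (cases "u < v")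
  case True
  have "{w \<in> insert v T. w < u} = {w \<in> T. w < u}"
    using True by auto
  moreover have "{w \<in> insert v T. w < v} = insert u {w \<in> insert v T - {u}. w < v}"
    using True assms by auto
  moreover have "card (insert u {w \<in> insert v T - {u}. w < v}) = Suc (card {w \<in> insert v T - {u}. w < v})"
    using assms by (intro card_insert_disjoint) auto
  ultimately show ?thesis
    by (auto simp: alt_sign_def)
next
  case False
  then have "v < u" using assms by (metis linorder_neqE_nat)
  then have "{w \<in> insert v T. w < u} = insert v {w \<in> T. w < u}"
    by auto
  moreover have "{w \<in> insert v T - {u}. w < v} = {w \<in> insert v T. w < v}"
    using \<open>v < u\<close> by auto
  moreover have "card (insert v {w \<in> T. w < u}) = Suc (card {w \<in> T. w < u})"
    using assms by (intro card_insert_disjoint) auto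
  ultimately show ?thesis
    by (auto simp: alt_sign_def)
qed

text \<open>A family closed under adding and removing \<open>v\<close> is a cone with apex \<open>v\<close>; the contracting
  homotopy is \<open>\<psi> S = \<plusminus> \<phi> (insert v S)\<close>.\<close>

lemma comb_cone_acyclic:
  fixes K :: "nat set set"
  assumes cone: "\<And>S. v \<notin> S \<Longrightarrow> insert v S \<in> K \<longleftrightarrow> S \<in> K" and fin: "\<And>S. S \<in> K \<Longrightarrow> finite S"
  shows "\<not> comb_cohomology_nonzero TYPE('k::field) K i"
proof
  assume "comb_cohomology_nonzero TYPE('k::field) K i"
  then obtain \<phi> :: "nat set \<Rightarrow> 'k" where \<phi>: "comb_cochain K i \<phi>"
    and cyc: "\<And>T. card T = Suc i \<Longrightarrow> comb_diff K \<phi> T = 0" and ncob: "\<not> comb_coboundary K i \<phi>"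
    unfolding comb_cohomology_nonzero_def by blast
  \<comment> \<open>The cocycle condition at \<open>insert v T\<close>, solved for the term that
    removes \<open>v\<close>.\<close>
  have cyc': "\<phi> T = - (alt_sign v (insert v T) * (\<Sum>u\<in>T. alt_sign u (insert v T) * \<phi> (insert v T - {u})))"
    if T: "T \<in> K" "card T = i" "v \<notin> T" for T
  proof -
    have "finite T" using T fin by blast
    then have "0 = (\<Sum>u\<in>insert v T. alt_sign u (insert v T) * \<phi> (insert v T - {u}))"
      using cyc[of "insert v T"] T cone[of T] by (simp add: comb_diff_def)
    also have "\<dots> = alt_sign v (insert v T) * \<phi> T + (\<Sum>u\<in>T. alt_sign u (insert v T) * \<phi> (insert v T - {u}))"
      using \<open>finite T\<close> T(3) by simp
    finally have "alt_sign v (insert v T) * \<phi> T = - (\<Sum>u\<in>T. alt_sign u (insert v T) * \<phi> (insert v T - {u}))"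
      by (simp add: eq_neg_iff_add_eq_0)
    then have "alt_sign v (insert v T) * (alt_sign v (insert v T) * \<phi> T) =
       alt_sign v (insert v T) * (- (\<Sum>u\<in>T. alt_sign u (insert v T) * \<phi> (insert v T - {u})))"
      by (rule arg_cong)
    then show ?thesis
      by (simp add: alt_sign_square flip: mult.assoc)
  qed
  show False
  proof (cases i)
    \<comment> \<open>In degree zero the homotopy has no target; the only candidate is the empty
      set, where \<open>cyc'\<close> has an empty sum.\<close>
    case 0
    have "\<phi> S = 0" for S
    proof (rule ccontr)
      assume "\<phi> S \<noteq> 0"
      then have "S \<in> K" "card S = 0" using \<phi> 0 unfolding comb_cochain_def by auto
      then have "S = {}" using fin by auto
      then show False using cyc'[of S] \<open>S \<in> K\<close> \<open>\<phi> S \<noteq> 0\<close> 0 by simp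
    qed
    then show False using ncob 0 unfolding comb_coboundary_def by simp
  next
    case (Suc p)
    define \<psi> where "\<psi> S = (if v \<in> S then 0 else alt_sign v (insert v S) * \<phi> (insert v S))" for S
    have "comb_cochain K p \<psi>"
      unfolding comb_cochain_def
    proof (intro allI impI)
      fix S assume "\<psi> S \<noteq> 0"
      then have S: "v \<notin> S" "\<phi> (insert v S) \<noteq> 0"
        unfolding \<psi>_def by (auto split: if_splits)
      then have "insert v S \<in> K" "card (insert v S) = i"
        using \<phi> unfolding comb_cochain_def by auto
      then show "S \<in> K \<and> card S = p"
        using S cone fin Suc by auto
    qed
    moreover have "\<phi> T = comb_diff K \<psi> T" if T: "card T = i" for T
    proof (cases "T \<in> K")
      case False
      then show ?thesis using \<phi> by (auto simp: comb_diff_def comb_cochain_def)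
    next
      case True
      then have "finite T" using fin by blast
      show ?thesis
      proof (cases "v \<in> T")
        case True
        have "comb_diff K \<psi> T = (\<Sum>u\<in>T. alt_sign u T * \<psi> (T - {u}))"
          using \<open>T \<in> K\<close> by (simp add: comb_diff_def)
        \<comment> \<open>For \<open>u\<close> other than \<open>v\<close> the set
          \<open>T - {u}\<close> still contains \<open>v\<close>, where \<open>\<psi>\<close> is
          zero; at \<open>u = v\<close> the two equal signs cancel.\<close>
        also have "\<dots> = (\<Sum>u\<in>T. if u = v then \<phi> T else 0)"
          using True alt_sign_square[of v T, where 'a='k]
          by (intro sum.cong) (auto simp: \<psi>_def insert_absorb simp flip: mult.assoc)
        also have "\<dots> = \<phi> T"
          using \<open>finite T\<close> True by simp
        finally show ?thesis ..
      next
        case False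
        have "comb_diff K \<psi> T = (\<Sum>u\<in>T. alt_sign u T * \<psi> (T - {u}))"
          using \<open>T \<in> K\<close> by (simp add: comb_diff_def)
        \<comment> \<open>Exchanging the signs turns the sum into the right-hand side of
          \<open>cyc'\<close>.\<close>
        also have "\<dots> = (\<Sum>u\<in>T. - (alt_sign v (insert v T) * (alt_sign u (insert v T) * \<phi> (insert v T - {u}))))"
        proof (rule sum.cong[OF refl])
          fix u assume u: "u \<in> T"
          then have "insert v (T - {u}) = insert v T - {u}" using False by auto
          then have "alt_sign u T * \<psi> (T - {u}) =
              (alt_sign u T * alt_sign v (insert v T - {u})) * \<phi> (insert v T - {u})"
            using False by (simp add: \<psi>_def)
          also have "\<dots> = - (alt_sign v (insert v T) * (alt_sign u (insert v T) * \<phi> (insert v T - {u})))"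
            unfolding alt_sign_exchange[OF \<open>finite T\<close> u False] by (simp add: mult.assoc)
          finally show "alt_sign u T * \<psi> (T - {u}) =
            - (alt_sign v (insert v T) * (alt_sign u (insert v T) * \<phi> (insert v T - {u})))" .
        qed
        also have "\<dots> = \<phi> T"
          by (subst cyc'[OF \<open>T \<in> K\<close> T False]) (simp add: sum_negf sum_distrib_left)
        finally show ?thesis ..
      qed
    qed
    ultimately show False
      using ncob Suc unfolding comb_coboundary_def by auto
  qed
qed

text \<open>No other set belongs to the family, so the differentials into and out of the only
  cochain vanish and the indicator of \<open>F\<close> is a nontrivial class.\<close>

lemma comb_singleton_nonzero:
  "comb_cohomology_nonzero TYPE('k::field) {F} (card F)"
  unfolding comb_cohomology_nonzero_def
proof (intro exI conjI)
  let ?\<phi> = "\<lambda>S. if S = F then 1 else 0 :: 'k"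
  show "comb_cochain {F} (card F) ?\<phi>"
    by (simp add: comb_cochain_def)
  show "\<forall>T. card T = Suc (card F) \<longrightarrow> comb_diff {F} ?\<phi> T = 0"
    by (auto simp: comb_diff_def)
  show "\<not> comb_coboundary {F} (card F) ?\<phi>"
  proof (cases "card F")
    case 0
    then show ?thesis by (auto simp: comb_coboundary_def)
  next
    case (Suc p)
    have "comb_diff {F} \<psi> F = 0" if \<psi>: "comb_cochain {F} p \<psi>" for \<psi> :: "nat set \<Rightarrow> 'k"
    proof -
      have "\<psi> S = 0" for S using \<psi> Suc unfolding comb_cochain_def by fastforce
      then show ?thesis by (simp add: comb_diff_def)
    qed
    then show ?thesis
      using Suc by (auto simp: comb_coboundary_def)
  qed
qed

text \<open>The zero cochain is a coboundary, so a nontrivial class has a nonzero value somewhere.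
  This later bounds the cohomological degree by the dimension.\<close>

lemma comb_cohomology_nonzeroD:
  assumes "comb_cohomology_nonzero TYPE('k::field) K i"
  obtains S where "S \<in> K" "card S = i"
proof -
  obtain \<phi> :: "nat set \<Rightarrow> 'k" where \<phi>: "comb_cochain K i \<phi>" "\<not> comb_coboundary K i \<phi>"
    using assms unfolding comb_cohomology_nonzero_def by blast
  have "\<exists>S. \<phi> S \<noteq> 0"
  proof (rule ccontr)
    assume "\<not> ?thesis"
    then have "comb_coboundary K i \<phi>"
      by (auto simp: comb_coboundary_def comb_cochain_def comb_diff_def split: nat.split
          intro!: exI[of _ "\<lambda>_. 0"])
    then show False using \<phi> by blast
  qed
  then show ?thesis using \<phi> that unfolding comb_cochain_def by blast
qed

section \<open>Local cohomology of monomial quotients by multidegree\<close>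

definition iexp :: "(nat \<Rightarrow>\<^sub>0 nat) \<Rightarrow> nat \<Rightarrow> int" where
  "iexp m = (\<lambda>v. int (lookup m v))"

definition shift :: "(nat \<Rightarrow> int) \<Rightarrow> (nat \<Rightarrow>\<^sub>0 nat) \<Rightarrow> nat \<Rightarrow> int" where
  "shift a m = (\<lambda>v. a v + int (lookup m v))"

text \<open>Fractions have multidegrees with negative entries, so coefficients are read at integer
  vectors, with value zero at vectors that are no exponents. The fraction \<open>f / x^m\<close>
  then has the coefficient \<open>icoef f (shift a m)\<close> in multidegree
  \<open>a\<close>.\<close>

definition icoef :: "'k::field mpoly \<Rightarrow> (nat \<Rightarrow> int) \<Rightarrow> 'k" where
  "icoef f e = (if \<exists>m. e = iexp m then lookup f (THE m. e = iexp m) else 0)"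

lemma iexp_inject [simp]: "iexp m = iexp n \<longleftrightarrow> m = n"
  by (auto simp: iexp_def fun_eq_iff intro: poly_mapping_eqI)

lemma icoef_iexp [simp]: "icoef f (iexp m) = lookup f m"
  by (auto simp: icoef_def)

lemma icoef_nonzeroD:
  assumes "icoef f e \<noteq> 0"
  obtains m where "m \<in> keys f" "e = iexp m"
  using assms by (cases "\<exists>m. e = iexp m") (auto simp: in_keys_iff, simp add: icoef_def)

lemma icoef_add [simp]: "icoef (f + g) e = icoef f e + icoef g e"
  by (simp add: icoef_def lookup_add)

lemma icoef_diff [simp]: "icoef (f - g) e = icoef f e - icoef g e"
  by (simp add: icoef_def lookup_minus)

lemma icoef_uminus [simp]: "icoef (- f) e = - icoef f e"
  by (simp add: icoef_def)

lemma icoef_0 [simp]: "icoef 0 e = 0"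
  by (simp add: icoef_def)

lemma shift_iexp [simp]: "shift (iexp m) s = iexp (m + s)"
  by (simp add: shift_def iexp_def lookup_add)

lemma shift_shift [simp]: "shift (shift a s) t = shift a (s + t)"
  by (simp add: shift_def lookup_add add.assoc)

lemma shift_inject [simp]: "shift a s = shift b s \<longleftrightarrow> a = b"
  by (auto simp: shift_def fun_eq_iff)

lemma lookup_monomial_mult: "lookup (monomial s * f) (m + s) = lookup f m"
proof -
  have "monomial s * f = (\<Sum>e\<in>keys f. Poly_Mapping.single (s + e) (lookup f e))"
    by (subst mpoly_expand[of f]) (simp add: sum_distrib_left monomial_def mult_single)
  then have "lookup (monomial s * f) (m + s) = (\<Sum>e\<in>keys f. if e = m then lookup f m else 0)"
    by (simp only: lookup_sum) (auto intro!: sum.cong simp: lookup_single when_def add.commute)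
  also have "\<dots> = lookup f m"
    by (auto simp: in_keys_iff)
  finally show ?thesis .
qed

text \<open>If \<open>e\<close> is no exponent, both sides vanish: every exponent of the product is
  divisible by \<open>s\<close>, so \<open>shift e s\<close> cannot be one of them.\<close>

lemma icoef_monomial_mult [simp]: "icoef (monomial s * f) (shift e s) = icoef f e"
proof (cases "\<exists>m. e = iexp m")
  case True
  then show ?thesis by (auto simp: lookup_monomial_mult)
next
  case False
  have "icoef (monomial s * f) (shift e s) = 0"
  proof (rule ccontr)
    assume "\<not> ?thesis"
    then obtain m where m: "m \<in> keys (monomial s * f)" "shift e s = iexp m"
      by (rule icoef_nonzeroD)
    then obtain n where "m = s + n"
      using keys_mult[of "monomial s" f] by auto
    then have "shift e s = shift (iexp n) s"
      using m(2) by (simp add: add.commute)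
    then have "e = iexp n" by (simp only: shift_inject)
    then show False using False by blast
  qed
  moreover have "icoef f e = 0" using False by (simp add: icoef_def)
  ultimately show ?thesis by simp
qed

lemma icoef_monomial_mult' [simp]:
  "icoef (monomial s * f) (shift e (s + t)) = icoef f (shift e t)"
  "icoef (monomial s * f) (shift e (t + s)) = icoef f (shift e t)"
  using icoef_monomial_mult[of s f "shift e t"] by (simp_all add: add.commute)

lemma ring_simps_poly [simp]:
  "f \<otimes>\<^bsub>poly_ring d\<^esub> g = f * g" "f \<oplus>\<^bsub>poly_ring d\<^esub> g = f + g"
  "\<one>\<^bsub>poly_ring d\<^esub> = 1" "\<zero>\<^bsub>poly_ring d\<^esub> = 0"
  by (simp_all add: poly_ring_simps)

section \<open>The quotient by a monomial ideal and its localizations\<close>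

locale monomial_quotient =
  fixes d :: nat and U :: "(nat \<Rightarrow>\<^sub>0 nat) set" and J :: "'k::field mpoly set"
  assumes upset: "expo_upset d U" and J_def: "J = mspan U"
begin

abbreviation "R \<equiv> poly_ring d :: 'k mpoly ring"
abbreviation "M \<equiv> quot_module R J"
abbreviation "coset f \<equiv> J +>\<^bsub>R\<^esub> f"

sublocale R: cring R by (rule cring_poly_ring)
sublocale J: ideal J R unfolding J_def by (rule ideal_mspan[OF upset])

lemma U_add: "m \<in> U \<Longrightarrow> keys u \<subseteq> {..<d} \<Longrightarrow> m + u \<in> U"
  using upset by (simp add: expo_upset_def)

lemma carrier_closed [simp]:
  "f \<in> carrier R \<Longrightarrow> g \<in> carrier R \<Longrightarrow> f * g \<in> carrier R"
  "f \<in> carrier R \<Longrightarrow> g \<in> carrier R \<Longrightarrow> f + g \<in> carrier R"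
  "f \<in> carrier R \<Longrightarrow> - f \<in> carrier R"
  "f \<in> carrier R \<Longrightarrow> g \<in> carrier R \<Longrightarrow> f - g \<in> carrier R"
  "0 \<in> carrier R" "1 \<in> carrier R"
  using R.m_closed[of f g] R.a_closed[of f g] R.a_inv_closed[of f] R.minus_closed[of f g]
    R.zero_closed R.one_closed poly_ring_uminus[of f d] poly_ring_minus[of g d f]
  by simp_all

lemma carrier_M: "x \<in> carrier M \<longleftrightarrow> (\<exists>f\<in>carrier R. x = coset f)"
  by (auto simp: quot_module_def FactRing_def A_RCOSETS_def')

lemma coset_carrier [simp]: "f \<in> carrier R \<Longrightarrow> coset f \<in> carrier M"
  by (auto simp: carrier_M)

lemma smult_M [simp]:
  assumes "r \<in> carrier R" "f \<in> carrier R"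
  shows "r \<odot>\<^bsub>M\<^esub> coset f = coset (r * f)"
  using J.rcoset_mult_add[OF assms] by (simp add: quot_module_def FactRing_def)

lemma add_M [simp]:
  assumes "f \<in> carrier R" "g \<in> carrier R"
  shows "coset f \<oplus>\<^bsub>M\<^esub> coset g = coset (f + g)"
  using J.a_rcos_sum[OF assms] by (simp add: quot_module_def FactRing_def)

lemma zero_M: "\<zero>\<^bsub>M\<^esub> = coset 0"
  using R.a_coset_add_zero[OF J.a_subset] by (simp add: quot_module_def FactRing_def)

lemma coset_eq_iff:
  assumes "f \<in> carrier R" "g \<in> carrier R"
  shows "coset f = coset g \<longleftrightarrow> f - g \<in> J"
  using R.quotient_eq_iff_same_a_r_cos[OF J.is_ideal assms] poly_ring_minus[OF assms(2), of f] by simp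

text \<open>\<open>alive S\<close> consists of the multidegrees in which \<open>(R/J)\<^bsub>x\<^sub>S\<^esub>\<close> is nonzero, and \<open>frac_coef S x s a\<close>
  is the coefficient of the fraction \<open>x/s\<close> in multidegree \<open>a\<close>.\<close>

definition alive :: "nat set \<Rightarrow> (nat \<Rightarrow> int) set" where
  "alive S = {a. (\<forall>v\<ge>d. a v = 0) \<and> (\<forall>v. v \<notin> S \<longrightarrow> 0 \<le> a v) \<and>
     (\<forall>u. keys u \<subseteq> S \<longrightarrow> (\<forall>m\<in>U. iexp m \<noteq> shift a u))}"

definition frac_coef :: "nat set \<Rightarrow> 'k mpoly set \<Rightarrow> 'k mpoly \<Rightarrow> (nat \<Rightarrow> int) \<Rightarrow> 'k" where
  "frac_coef S x s a =
     (if a \<in> alive S then icoef (SOME f. f \<in> x) (shift a (THE m. s = monomial m)) else 0)"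

text \<open>Independence of the chosen representative: two representatives differ by an element of
  \<open>J\<close>, whose exponents lie in \<open>U\<close>, while an alive multidegree never meets
  \<open>U\<close> after a shift by a monomial on \<open>S\<close>.\<close>

lemma frac_coef_eq:
  assumes f: "f \<in> carrier R" and m: "keys m \<subseteq> S"
  shows "frac_coef S (coset f) (monomial m) a = (if a \<in> alive S then icoef f (shift a m) else 0)"
proof (cases "a \<in> alive S")
  case True
  have "f \<in> coset f"
    by (rule J.a_rcos_self[OF f])
  then have "(SOME f'. f' \<in> coset f) \<in> coset f"
    by (rule someI)
  then obtain h where h: "h \<in> J" "(SOME f'. f' \<in> coset f) = h + f"
    by (auto simp: a_r_coset_def')
  have "icoef h (shift a m) = 0"
  proof (rule ccontr)
    assume "\<not> ?thesis"
    then obtain m' where "m' \<in> keys h" "shift a m = iexp m'"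
      by (rule icoef_nonzeroD)
    moreover from this have "iexp m' \<noteq> shift a m"
      using h True m unfolding alive_def J_def mspan_def by blast
    ultimately show False by simp
  qed
  then show ?thesis using True by (simp add: frac_coef_def h(2))
qed (simp add: frac_coef_def)

text \<open>The numerator has nonnegative exponents in the first \<open>d\<close> variables and the
  denominator involves \<open>S\<close> only, so the first two conditions of \<open>alive\<close>
  hold wherever a coefficient is nonzero.\<close>

lemma icoef_outside:
  assumes "f \<in> carrier R" "keys m \<subseteq> S" "S \<subseteq> {..<d}" "icoef f (shift a m) \<noteq> 0"
  shows "\<forall>v\<ge>d. a v = 0" "\<forall>v. v \<notin> S \<longrightarrow> 0 \<le> a v"
proof -
  obtain e where e: "e \<in> keys f" "shift a m = iexp e"
    using assms(4) by (rule icoef_nonzeroD)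
  then have "keys e \<subseteq> {..<d}" using assms(1) by (auto simp: poly_ring_carrier_iff)
  have eq: "a v + int (lookup m v) = int (lookup e v)" for v
    using fun_cong[OF e(2), of v] by (simp add: shift_def iexp_def)
  show "\<forall>v\<ge>d. a v = 0"
  proof safe
    fix v assume "d \<le> v"
    then have "v \<notin> keys e" "v \<notin> keys m" using \<open>keys e \<subseteq> {..<d}\<close> assms(2,3) by auto
    then show "a v = 0" using eq[of v] by (simp add: in_keys_iff)
  qed
  show "\<forall>v. v \<notin> S \<longrightarrow> 0 \<le> a v"
  proof safe
    fix v assume "v \<notin> S"
    then have "v \<notin> keys m" using assms(2) by blast
    then show "0 \<le> a v" using eq[of v] by (simp add: in_keys_iff)
  qed
qed

text \<open>This is the vanishing criterion for the fraction \<open>p / x^n\<close>: a nonzero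
  coefficient in an alive multidegree can never be pushed into \<open>J\<close>, and each remaining
  term of \<open>p\<close> is pushed there by some monomial on \<open>S\<close>.\<close>

lemma monomial_kills_iff:
  assumes p: "p \<in> carrier R" and n: "keys n \<subseteq> S" and S: "S \<subseteq> {..<d}"
  shows "(\<exists>u. keys u \<subseteq> S \<and> monomial u * p \<in> J) \<longleftrightarrow> (\<forall>a\<in>alive S. icoef p (shift a n) = 0)"
proof
  assume "\<exists>u. keys u \<subseteq> S \<and> monomial u * p \<in> J"
  then obtain u where u: "keys u \<subseteq> S" "monomial u * p \<in> J" by blast
  show "\<forall>a\<in>alive S. icoef p (shift a n) = 0"
  proof (rule ballI, rule ccontr)
    fix a assume a: "a \<in> alive S" and "icoef p (shift a n) \<noteq> 0"
    then have "icoef (monomial u * p) (shift a (n + u)) \<noteq> 0" by simp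
    then obtain m where m: "m \<in> keys (monomial u * p)" "shift a (n + u) = iexp m"
      by (rule icoef_nonzeroD)
    then have "m \<in> U" using u by (auto simp: J_def mspan_def)
    moreover have "keys (n + u) \<subseteq> S" using n u by (simp add: keys_add_nat)
    ultimately have "iexp m \<noteq> shift a (n + u)" using a unfolding alive_def by blast
    then show False using m by simp
  qed
next
  assume zero: "\<forall>a\<in>alive S. icoef p (shift a n) = 0"
  have "\<exists>u. keys u \<subseteq> S \<and> e + u \<in> U" if e: "e \<in> keys p" for e
  proof -
    \<comment> \<open>The multidegree of the term \<open>x^e / x^n\<close>; not being alive, it can
      be moved into \<open>U\<close> along \<open>S\<close>.\<close>
    define a where "a = (\<lambda>v. iexp e v - int (lookup n v))"
    have an: "shift a n = iexp e"
      by (simp add: a_def shift_def)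
    then have "icoef p (shift a n) \<noteq> 0"
      using e by (simp add: in_keys_iff)
    then have "a \<notin> alive S" "\<forall>v\<ge>d. a v = 0" "\<forall>v. v \<notin> S \<longrightarrow> 0 \<le> a v"
      using zero icoef_outside[OF p n S] by blast+
    then obtain u m where u: "keys u \<subseteq> S" "m \<in> U" "iexp m = shift a u"
      unfolding alive_def by blast
    have "iexp (e + u) = shift a (n + u)"
      using an by (metis shift_iexp shift_shift)
    also have "\<dots> = iexp (m + n)"
      using u(3) by (metis add.commute shift_iexp shift_shift)
    finally have "e + u = m + n" by simp
    then show ?thesis
      using u U_add[of m n] n S by auto
  qed
  then obtain g where g: "\<And>e. e \<in> keys p \<Longrightarrow> keys (g e) \<subseteq> S \<and> e + g e \<in> U"
    by metis
  \<comment> \<open>One exponent for all terms at once: the sum dominates every \<open>g e\<close>,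
    and \<open>U\<close> is upward closed.\<close>
  define u where "u = (\<Sum>e\<in>keys p. g e)"
  have uS: "keys u \<subseteq> S"
    unfolding u_def using g by (intro keys_sum_subset) blast
  have "u + e \<in> U" if e: "e \<in> keys p" for e
  proof -
    have "u = g e + (\<Sum>e'\<in>keys p - {e}. g e')"
      unfolding u_def by (rule sum.remove) (use e in auto)
    moreover have "keys (\<Sum>e'\<in>keys p - {e}. g e') \<subseteq> S"
      using g by (intro keys_sum_subset) blast
    ultimately show ?thesis
      using U_add[of "e + g e" "\<Sum>e'\<in>keys p - {e}. g e'"] g[OF e] S by (simp add: ac_simps)
  qed
  then have "monomial u * p \<in> J"
    using keys_mult[of "monomial u" p] by (fastforce simp: J_def mspan_def)
  then show "\<exists>u. keys u \<subseteq> S \<and> monomial u * p \<in> J" using uS by blast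
qed

lemma monomials_on_carrier: "S \<subseteq> {..<d} \<Longrightarrow> s \<in> monomials_on S \<Longrightarrow> s \<in> carrier R"
  by (auto simp: monomials_on_def intro!: monomial_carrier)

lemma monomials_onI [simp]: "keys m \<subseteq> S \<Longrightarrow> monomial m \<in> monomials_on S"
  by (auto simp: monomials_on_def)

text \<open>The relation asks for a monomial on \<open>S\<close> that kills the cross difference, so
  \<open>monomial_kills_iff\<close> turns it into equality of coefficients. From here on classes are
  handled through their coefficient functions.\<close>

lemma frac_rel_iff:
  assumes S: "S \<subseteq> {..<d}"
  shows "((x, s), (y, t)) \<in> frac_rel M (monomials_on S) \<longleftrightarrow>
    x \<in> carrier M \<and> y \<in> carrier M \<and> s \<in> monomials_on S \<and> t \<in> monomials_on S \<and>
    frac_coef S x s = frac_coef S y t"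
proof (cases "x \<in> carrier M \<and> y \<in> carrier M \<and> s \<in> monomials_on S \<and> t \<in> monomials_on S")
  case True
  then obtain f g m n where x: "f \<in> carrier R" "x = coset f" and y: "g \<in> carrier R" "y = coset g"
    and s: "keys m \<subseteq> S" "s = monomial m" and t: "keys n \<subseteq> S" "t = monomial n"
    unfolding carrier_M monomials_on_def by blast
  have mc: "monomial m \<in> carrier R" "monomial n \<in> carrier R"
    using s t S by (auto intro!: monomial_carrier)
  define p where "p = monomial n * f - monomial m * g"
  have p: "p \<in> carrier R"
    unfolding p_def using mc x y by simp
  have eq: "u \<odot>\<^bsub>M\<^esub> (t \<odot>\<^bsub>M\<^esub> x) = u \<odot>\<^bsub>M\<^esub> (s \<odot>\<^bsub>M\<^esub> y) \<longleftrightarrow> u * p \<in> J"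
    if u: "u \<in> carrier R" for u
    using u mc x y s t by (simp add: coset_eq_iff p_def right_diff_distrib)
  have "((x, s), (y, t)) \<in> frac_rel M (monomials_on S) \<longleftrightarrow>
      (\<exists>u\<in>monomials_on S. u \<odot>\<^bsub>M\<^esub> (t \<odot>\<^bsub>M\<^esub> x) = u \<odot>\<^bsub>M\<^esub> (s \<odot>\<^bsub>M\<^esub> y))"
    using True by (simp add: frac_rel_def)
  also have "\<dots> \<longleftrightarrow> (\<exists>u\<in>monomials_on S. u * p \<in> J)"
    using eq monomials_on_carrier[OF S] by blast
  also have "\<dots> \<longleftrightarrow> (\<exists>u. keys u \<subseteq> S \<and> monomial u * p \<in> J)"
    by (auto simp: monomials_on_def)
  also have "\<dots> \<longleftrightarrow> (\<forall>a\<in>alive S. icoef p (shift a (m + n)) = 0)"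
    using s t by (intro monomial_kills_iff[OF p _ S]) (simp add: keys_add_nat)
  also have "\<dots> \<longleftrightarrow> (\<forall>a\<in>alive S. icoef f (shift a m) = icoef g (shift a n))"
    by (simp add: p_def)
  also have "\<dots> \<longleftrightarrow> frac_coef S x s = frac_coef S y t"
    using x y s t by (auto simp: fun_eq_iff frac_coef_eq)
  finally show ?thesis using True by blast
qed (auto simp: frac_rel_def)

section \<open>Classes of fractions and their coefficient functions\<close>

definition fraction :: "nat set \<Rightarrow> 'k mpoly \<Rightarrow> (nat \<Rightarrow>\<^sub>0 nat) \<Rightarrow> ('k mpoly set \<times> 'k mpoly) set" where
  "fraction S f m = mod_frac M (monomials_on S) (coset f) (monomial m)"

definition class_coef :: "nat set \<Rightarrow> ('k mpoly set \<times> 'k mpoly) set \<Rightarrow> (nat \<Rightarrow> int) \<Rightarrow> 'k" where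
  "class_coef S X = case_prod (frac_coef S) (SOME p. p \<in> X)"

lemma mem_frac_iff:
  assumes S: "S \<subseteq> {..<d}" and "f \<in> carrier R" "keys m \<subseteq> S"
  shows "(y, t) \<in> fraction S f m \<longleftrightarrow>
    y \<in> carrier M \<and> t \<in> monomials_on S \<and> frac_coef S y t = frac_coef S (coset f) (monomial m)"
  using assms by (auto simp: fraction_def mod_frac_def frac_rel_iff[OF S])

lemma class_coef_frac:
  assumes "S \<subseteq> {..<d}" "f \<in> carrier R" "keys m \<subseteq> S"
  shows "class_coef S (fraction S f m) a = (if a \<in> alive S then icoef f (shift a m) else 0)"
proof -
  have "(coset f, monomial m) \<in> fraction S f m"
    using assms by (simp add: mem_frac_iff)
  then have "(SOME p. p \<in> fraction S f m) \<in> fraction S f m"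
    by (rule someI)
  then have "class_coef S (fraction S f m) = frac_coef S (coset f) (monomial m)"
    using assms by (cases "SOME p. p \<in> fraction S f m") (simp add: class_coef_def mem_frac_iff)
  then show ?thesis using assms by (simp add: frac_coef_eq)
qed

lemma frac_eqI:
  assumes S: "S \<subseteq> {..<d}" and f: "f \<in> carrier R" "keys m \<subseteq> S" and g: "g \<in> carrier R" "keys n \<subseteq> S"
    and eq: "class_coef S (fraction S f m) = class_coef S (fraction S g n)"
  shows "fraction S f m = fraction S g n"
proof -
  have "frac_coef S (coset f) (monomial m) = frac_coef S (coset g) (monomial n)"
    using eq f g S by (auto simp: fun_eq_iff class_coef_frac frac_coef_eq)
  then show ?thesis
    using mem_frac_iff[OF S f] mem_frac_iff[OF S g] by auto
qed

lemma cech_loc_carrier: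
  assumes "S \<subseteq> {..<d}"
  shows "X \<in> carrier (cech_loc d M S) \<longleftrightarrow> (\<exists>f m. f \<in> carrier R \<and> keys m \<subseteq> S \<and> X = fraction S f m)"
proof -
  have "X \<in> carrier (cech_loc d M S) \<longleftrightarrow>
      (\<exists>x\<in>carrier M. \<exists>s\<in>monomials_on S. X = mod_frac M (monomials_on S) x s)"
    by (simp add: cech_loc_def loc_group_def quotient_def mod_frac_def)
  also have "\<dots> \<longleftrightarrow> (\<exists>f m. f \<in> carrier R \<and> keys m \<subseteq> S \<and> X = fraction S f m)"
    unfolding fraction_def
  proof
    assume "\<exists>x\<in>carrier M. \<exists>s\<in>monomials_on S. X = mod_frac M (monomials_on S) x s"
    then obtain x s where x: "x \<in> carrier M" and s: "s \<in> monomials_on S"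
      and X: "X = mod_frac M (monomials_on S) x s"
      by (elim bexE)
    obtain f where f: "f \<in> carrier R" "x = coset f"
      using x by (auto simp: carrier_M)
    obtain m where m: "keys m \<subseteq> S" "s = monomial m"
      using s by (auto simp: monomials_on_def)
    show "\<exists>f m. f \<in> carrier R \<and> keys m \<subseteq> S \<and>
        X = mod_frac M (monomials_on S) (coset f) (monomial m)"
      using f m X by (intro exI[of _ f] exI[of _ m] conjI) simp_all
  next
    assume "\<exists>f m. f \<in> carrier R \<and> keys m \<subseteq> S \<and>
        X = mod_frac M (monomials_on S) (coset f) (monomial m)"
    then obtain f m where f: "f \<in> carrier R" "keys m \<subseteq> S"
      and X: "X = mod_frac M (monomials_on S) (coset f) (monomial m)"
      by (elim exE conjE)
    then show "\<exists>x\<in>carrier M. \<exists>s\<in>monomials_on S. X = mod_frac M (monomials_on S) x s"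
      by (intro bexI[OF _ coset_carrier[OF f(1)]] bexI[OF _ monomials_onI[OF f(2)]])
  qed
  finally show ?thesis .
qed

lemma cech_loc_carrierE:
  assumes "S \<subseteq> {..<d}" "X \<in> carrier (cech_loc d M S)"
  obtains f m where "f \<in> carrier R" "keys m \<subseteq> S" "X = fraction S f m"
  using assms(2) unfolding cech_loc_carrier[OF assms(1)] by (elim exE conjE) (rule that)

text \<open>The tool for all identities in the localization: they become identities in
  \<open>k\<close>, one multidegree at a time.\<close>

lemma class_coef_inj:
  assumes S: "S \<subseteq> {..<d}" and X: "X \<in> carrier (cech_loc d M S)" and Y: "Y \<in> carrier (cech_loc d M S)"
    and "\<And>a. class_coef S X a = class_coef S Y a"
  shows "X = Y"
proof -
  obtain f m where f: "f \<in> carrier R" "keys m \<subseteq> S" "X = fraction S f m"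
    by (rule cech_loc_carrierE[OF S X])
  obtain g n where g: "g \<in> carrier R" "keys n \<subseteq> S" "Y = fraction S g n"
    by (rule cech_loc_carrierE[OF S Y])
  show ?thesis
    using frac_eqI[OF S f(1,2) g(1,2)] assms(4) f(3) g(3) by auto
qed

lemma class_coef_not_alive:
  assumes "S \<subseteq> {..<d}" "X \<in> carrier (cech_loc d M S)" "a \<notin> alive S"
  shows "class_coef S X a = 0"
proof -
  obtain f m where f: "f \<in> carrier R" "keys m \<subseteq> S" "X = fraction S f m"
    by (rule cech_loc_carrierE[OF assms(1,2)])
  then show ?thesis
    using class_coef_frac[OF assms(1) f(1,2)] assms(3) by simp
qed

lemma finite_class_coef:
  assumes S: "S \<subseteq> {..<d}" and X: "X \<in> carrier (cech_loc d M S)"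
  shows "finite {a. class_coef S X a \<noteq> 0}"
proof -
  obtain f m where fm: "f \<in> carrier R" "keys m \<subseteq> S" "X = fraction S f m"
    by (rule cech_loc_carrierE[OF S X])
  have "{a. class_coef S X a \<noteq> 0} \<subseteq> (\<lambda>e v. iexp e v - int (lookup m v)) ` keys f"
  proof
    fix a assume "a \<in> {a. class_coef S X a \<noteq> 0}"
    then have "icoef f (shift a m) \<noteq> 0"
      using class_coef_frac[OF S fm(1,2)] fm(3) by (auto split: if_splits)
    then obtain e where e: "e \<in> keys f" "shift a m = iexp e"
      by (rule icoef_nonzeroD)
    then have "a = (\<lambda>v. iexp e v - int (lookup m v))"
      by (auto simp: shift_def fun_eq_iff) (metis add_diff_cancel_right')
    then show "a \<in> (\<lambda>e v. iexp e v - int (lookup m v)) ` keys f" using e by blast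
  qed
  then show ?thesis by (rule finite_subset) simp
qed

text \<open>The operation of \<open>loc_group\<close> is a union over all pairs of representatives.
  Every pair contributes the same class, because the coefficients of the result depend only on those
  of the factors.\<close>

lemma frac_mult:
  assumes S: "S \<subseteq> {..<d}" and f: "f \<in> carrier R" "keys m \<subseteq> S" and g: "g \<in> carrier R" "keys n \<subseteq> S"
  shows "fraction S f m \<otimes>\<^bsub>cech_loc d M S\<^esub> fraction S g n = fraction S (monomial n * f + monomial m * g) (m + n)"
proof -
  let ?h = "\<lambda>x s y t. mod_frac M (monomials_on S) (t \<odot>\<^bsub>M\<^esub> x \<oplus>\<^bsub>M\<^esub> s \<odot>\<^bsub>M\<^esub> y) (s \<otimes>\<^bsub>R\<^esub> t)"
  have mn: "keys (a + b) \<subseteq> S" if "keys a \<subseteq> S" "keys b \<subseteq> S" for a b :: "nat \<Rightarrow>\<^sub>0 nat"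
    using that by (simp add: keys_add_nat)
  have mc: "monomial a \<in> carrier R" if "keys a \<subseteq> S" for a
    using that S by (auto intro!: monomial_carrier)
  have h: "?h x s y t = fraction S (monomial n * f + monomial m * g) (m + n)"
    if xs: "(x, s) \<in> fraction S f m" and yt: "(y, t) \<in> fraction S g n" for x s y t
  proof -
    have 1: "x \<in> carrier M" "s \<in> monomials_on S" "frac_coef S x s = frac_coef S (coset f) (monomial m)"
      "y \<in> carrier M" "t \<in> monomials_on S" "frac_coef S y t = frac_coef S (coset g) (monomial n)"
      using xs yt mem_frac_iff[OF S f] mem_frac_iff[OF S g] by auto
    then obtain f' m' g' n' where x: "f' \<in> carrier R" "x = coset f'" and y: "g' \<in> carrier R" "y = coset g'"
      and s: "keys m' \<subseteq> S" "s = monomial m'" and t: "keys n' \<subseteq> S" "t = monomial n'"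
      unfolding carrier_M monomials_on_def by blast
    have eqf: "icoef f' (shift a m') = icoef f (shift a m)" if "a \<in> alive S" for a
      using fun_cong[OF 1(3), of a] x s f that by (simp add: frac_coef_eq)
    have eqg: "icoef g' (shift a n') = icoef g (shift a n)" if "a \<in> alive S" for a
      using fun_cong[OF 1(6), of a] y t g that by (simp add: frac_coef_eq)
    have "?h x s y t = fraction S (monomial n' * f' + monomial m' * g') (m' + n')"
      using x y s t mc by (simp add: fraction_def monomial_mult)
    also have "\<dots> = fraction S (monomial n * f + monomial m * g) (m + n)"
      using x y s t f g mn mc
      by (intro frac_eqI[OF S] ext) (simp_all add: class_coef_frac[OF S] eqf eqg)
    finally show ?thesis .
  qed
  let ?F = "fraction S (monomial n * f + monomial m * g) (m + n)"
  have ne: "(coset f, monomial m) \<in> fraction S f m" "(coset g, monomial n) \<in> fraction S g n"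
    using S f g by (simp_all add: mem_frac_iff)
  have "fraction S f m \<otimes>\<^bsub>cech_loc d M S\<^esub> fraction S g n =
      (\<Union>p\<in>fraction S f m. \<Union>q\<in>fraction S g n. ?h (fst p) (snd p) (fst q) (snd q))"
    by (simp add: cech_loc_def loc_group_def case_prod_unfold)
  also have "\<dots> = (\<Union>p\<in>fraction S f m. \<Union>q\<in>fraction S g n. ?F)"
    by (intro SUP_cong refl h) simp_all
  \<comment> \<open>A union of a constant over nonempty index sets.\<close>
  also have "\<dots> = ?F"
    using ne by blast
  finally show ?thesis .
qed

lemma frac_one: "\<one>\<^bsub>cech_loc d M S\<^esub> = fraction S 0 0"
  by (simp add: cech_loc_def loc_group_def fraction_def zero_M monomial_0)

lemma frac_closed:
  "S \<subseteq> {..<d} \<Longrightarrow> f \<in> carrier R \<Longrightarrow> keys m \<subseteq> S \<Longrightarrow> fraction S f m \<in> carrier (cech_loc d M S)"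
  by (subst cech_loc_carrier) auto

lemma frac_mult_closed:
  assumes S: "S \<subseteq> {..<d}" and X: "X \<in> carrier (cech_loc d M S)" and Y: "Y \<in> carrier (cech_loc d M S)"
  shows "X \<otimes>\<^bsub>cech_loc d M S\<^esub> Y \<in> carrier (cech_loc d M S)"
    and "class_coef S (X \<otimes>\<^bsub>cech_loc d M S\<^esub> Y) a = class_coef S X a + class_coef S Y a"
proof -
  obtain f m where f: "f \<in> carrier R" "keys m \<subseteq> S" "X = fraction S f m"
    by (rule cech_loc_carrierE[OF S X])
  obtain g n where g: "g \<in> carrier R" "keys n \<subseteq> S" "Y = fraction S g n"
    by (rule cech_loc_carrierE[OF S Y])
  have mc: "monomial m \<in> carrier R" "monomial n \<in> carrier R"
    using f g S by (auto intro!: monomial_carrier)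
  have c: "monomial n * f + monomial m * g \<in> carrier R" "keys (m + n) \<subseteq> S"
    using f g mc by (simp_all add: keys_add_nat)
  have eq: "X \<otimes>\<^bsub>cech_loc d M S\<^esub> Y = fraction S (monomial n * f + monomial m * g) (m + n)"
    using frac_mult[OF S f(1,2) g(1,2)] f g by simp
  show "X \<otimes>\<^bsub>cech_loc d M S\<^esub> Y \<in> carrier (cech_loc d M S)"
    unfolding eq by (rule frac_closed[OF S c])
  show "class_coef S (X \<otimes>\<^bsub>cech_loc d M S\<^esub> Y) a = class_coef S X a + class_coef S Y a"
    unfolding eq class_coef_frac[OF S c]
    by (simp add: f(3) g(3) class_coef_frac[OF S f(1,2)] class_coef_frac[OF S g(1,2)])
qed

lemma class_coef_one: "S \<subseteq> {..<d} \<Longrightarrow> class_coef S \<one>\<^bsub>cech_loc d M S\<^esub> a = 0"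
  by (simp add: frac_one class_coef_frac)

text \<open>The coefficients turn the operation into addition in \<open>k\<close>, so each axiom
  follows through \<open>class_coef_inj\<close>; the inverse negates the numerator.\<close>

lemma comm_group_cech_loc:
  assumes S: "S \<subseteq> {..<d}"
  shows "comm_group (cech_loc d M S)"
proof (rule comm_groupI)
  note cl = frac_mult_closed[OF S]
  show one: "\<one>\<^bsub>cech_loc d M S\<^esub> \<in> carrier (cech_loc d M S)"
    by (simp add: frac_one frac_closed[OF S])
  fix X assume X: "X \<in> carrier (cech_loc d M S)"
  show "\<one>\<^bsub>cech_loc d M S\<^esub> \<otimes>\<^bsub>cech_loc d M S\<^esub> X = X"
    by (rule class_coef_inj[OF S cl(1)[OF one X] X]) (simp add: cl(2)[OF one X] class_coef_one[OF S])
  obtain f m where f: "f \<in> carrier R" "keys m \<subseteq> S" "X = fraction S f m"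
    by (rule cech_loc_carrierE[OF S X])
  have f': "- f \<in> carrier R" using f by simp
  let ?Y = "fraction S (- f) m"
  have Y: "?Y \<in> carrier (cech_loc d M S)"
    by (rule frac_closed[OF S f' f(2)])
  have "?Y \<otimes>\<^bsub>cech_loc d M S\<^esub> X = \<one>\<^bsub>cech_loc d M S\<^esub>"
    by (rule class_coef_inj[OF S cl(1)[OF Y X] one])
      (simp only: cl(2)[OF Y X] class_coef_one[OF S], simp add: f(3) class_coef_frac[OF S] f(1,2) f')
  then show "\<exists>Y\<in>carrier (cech_loc d M S). Y \<otimes>\<^bsub>cech_loc d M S\<^esub> X = \<one>\<^bsub>cech_loc d M S\<^esub>"
    using Y by blast
  fix Y assume Y: "Y \<in> carrier (cech_loc d M S)"
  show XY: "X \<otimes>\<^bsub>cech_loc d M S\<^esub> Y \<in> carrier (cech_loc d M S)"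
    by (rule cl(1)[OF X Y])
  show "X \<otimes>\<^bsub>cech_loc d M S\<^esub> Y = Y \<otimes>\<^bsub>cech_loc d M S\<^esub> X"
    by (rule class_coef_inj[OF S XY cl(1)[OF Y X]]) (simp add: cl(2)[OF X Y] cl(2)[OF Y X])
  fix Z assume Z: "Z \<in> carrier (cech_loc d M S)"
  show "X \<otimes>\<^bsub>cech_loc d M S\<^esub> Y \<otimes>\<^bsub>cech_loc d M S\<^esub> Z = X \<otimes>\<^bsub>cech_loc d M S\<^esub> (Y \<otimes>\<^bsub>cech_loc d M S\<^esub> Z)"
    by (rule class_coef_inj[OF S cl(1)[OF XY Z] cl(1)[OF X cl(1)[OF Y Z]]])
      (simp add: cl(2)[OF XY Z] cl(2)[OF X cl(1)[OF Y Z]] cl(2)[OF X Y] cl(2)[OF Y Z] add.assoc)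
qed

lemma group_cech_loc: "S \<subseteq> {..<d} \<Longrightarrow> group (cech_loc d M S)"
  using comm_group_cech_loc comm_group_def by blast

lemma class_coef_inv:
  assumes S: "S \<subseteq> {..<d}" and X: "X \<in> carrier (cech_loc d M S)"
  shows "class_coef S (inv\<^bsub>cech_loc d M S\<^esub> X) a = - class_coef S X a"
proof -
  interpret group "cech_loc d M S" by (rule group_cech_loc[OF S])
  have "class_coef S (inv\<^bsub>cech_loc d M S\<^esub> X) a + class_coef S X a = 0"
    using frac_mult_closed(2)[OF S inv_closed[OF X] X, of a] l_inv[OF X] class_coef_one[OF S] by simp
  then show ?thesis by (simp add: eq_neg_iff_add_eq_0)
qed

lemma class_coef_finprod:
  assumes S: "S \<subseteq> {..<d}" and X: "X \<in> A \<rightarrow> carrier (cech_loc d M S)" and "finite A"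
  shows "class_coef S (finprod (cech_loc d M S) X A) a = (\<Sum>v\<in>A. class_coef S (X v) a)"
proof -
  interpret comm_group "cech_loc d M S" by (rule comm_group_cech_loc[OF S])
  show ?thesis
    using \<open>finite A\<close> X
  proof (induction A)
    case empty
    then show ?case by (simp add: class_coef_one[OF S])
  next
    case (insert v A)
    then have "X v \<in> carrier (cech_loc d M S)" "X \<in> A \<rightarrow> carrier (cech_loc d M S)"
      by auto
    then show ?case
      using insert frac_mult_closed(2)[OF S _ finprod_closed, of "X v" X A a] by simp
  qed
qed

lemma loc_map_frac:
  assumes ST: "S \<subseteq> T" and T: "T \<subseteq> {..<d}" and f: "f \<in> carrier R" "keys m \<subseteq> S"
  shows "loc_map M T (fraction S f m) = fraction T f m"
proof -
  have S: "S \<subseteq> {..<d}" and mT: "keys m \<subseteq> T" using assms by auto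
  have self: "(coset f, monomial m) \<in> fraction S f m"
    using S f by (simp add: mem_frac_iff)
  have mono: "monomials_on S \<subseteq> (monomials_on T :: 'k mpoly set)"
    using ST by (auto simp: monomials_on_def)
  have "frac_rel M (monomials_on S) \<subseteq> frac_rel M (monomials_on T)"
    unfolding frac_rel_def using mono by (auto dest: subsetD)
  then have "fraction S f m \<subseteq> fraction T f m"
    unfolding fraction_def mod_frac_def by (rule Image_mono) simp
  then have mem: "frac_coef T y t = frac_coef T (coset f) (monomial m)" if "(y, t) \<in> fraction S f m" for y t
    using that mem_frac_iff[OF T f(1) mT] by blast
  show ?thesis
  proof (intro equalityI subrelI)
    fix z w assume "(z, w) \<in> loc_map M T (fraction S f m)"
    then obtain y t where "(y, t) \<in> fraction S f m" "((y, t), (z, w)) \<in> frac_rel M (monomials_on T)"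
      unfolding loc_map_def by auto
    then show "(z, w) \<in> fraction T f m"
      using mem by (simp add: frac_rel_iff[OF T] mem_frac_iff[OF T f(1) mT])
  next
    fix z w assume "(z, w) \<in> fraction T f m"
    then show "(z, w) \<in> loc_map M T (fraction S f m)"
      unfolding loc_map_def using self by (auto simp: fraction_def mod_frac_def)
  qed
qed

text \<open>The map keeps numerator and denominator, so only the range of alive multidegrees
  changes.\<close>

lemma loc_map_coef:
  assumes ST: "S \<subseteq> T" and T: "T \<subseteq> {..<d}" and X: "X \<in> carrier (cech_loc d M S)"
  shows "loc_map M T X \<in> carrier (cech_loc d M T)"
    and "class_coef T (loc_map M T X) a = (if a \<in> alive T then class_coef S X a else 0)"
proof -
  have S: "S \<subseteq> {..<d}" using ST T by simp
  obtain f m where f: "f \<in> carrier R" "keys m \<subseteq> S" "X = fraction S f m"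
    by (rule cech_loc_carrierE[OF S X])
  have mT: "keys m \<subseteq> T" using f ST by simp
  have eq: "loc_map M T X = fraction T f m"
    using loc_map_frac[OF ST T f(1,2)] f by simp
  show "loc_map M T X \<in> carrier (cech_loc d M T)"
    unfolding eq by (rule frac_closed[OF T f(1) mT])
  \<comment> \<open>A multidegree alive over \<open>T\<close> but not over \<open>S\<close> must be
    negative somewhere outside \<open>S\<close>, and there a fraction with denominator on
    \<open>S\<close> has no term.\<close>
  have "icoef f (shift a m) = 0" if a: "a \<in> alive T" "a \<notin> alive S"
  proof (rule ccontr)
    assume "icoef f (shift a m) \<noteq> 0"
    then have "a \<in> alive S"
      using icoef_outside[OF f(1,2) S] a(1) ST unfolding alive_def by auto
    then show False using a by simp
  qed
  then show "class_coef T (loc_map M T X) a = (if a \<in> alive T then class_coef S X a else 0)"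
    unfolding eq class_coef_frac[OF T f(1) mT] by (auto simp: f(3) class_coef_frac[OF S f(1,2)])
qed

lemma int_mdeg: "keys m \<subseteq> {..<d} \<Longrightarrow> int (mdeg m) = (\<Sum>v<d. int (lookup m v))"
  unfolding mdeg_def of_nat_sum by (rule sum.mono_neutral_left) (auto simp: in_keys_iff)

lemma icoef_sum: "icoef (\<Sum>x\<in>A. g x) e = (\<Sum>x\<in>A. icoef (g x) e)"
  by (simp add: icoef_def lookup_sum)

lemma icoef_single: "icoef (Poly_Mapping.single m c) e = (if e = iexp m then c else 0)"
  by (auto simp: icoef_def lookup_single)

text \<open>Surjectivity onto finitely supported functions on the alive multidegrees. The last
  clause records the exponents of the numerator, so that prescribed multidegrees of equal total
  degree give a homogeneous fraction.\<close>

lemma fraction_exists: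
  assumes S: "S \<subseteq> {..<d}" and A: "finite A" and g: "\<And>a. g a \<noteq> 0 \<Longrightarrow> a \<in> A \<and> a \<in> alive S"
  obtains f m where "f \<in> carrier R" "keys m \<subseteq> S" "\<And>a. class_coef S (fraction S f m) a = g a"
    "\<And>e. e \<in> keys f \<Longrightarrow> \<exists>a\<in>A. iexp e = shift a m"
proof -
  \<comment> \<open>A common denominator: on \<open>S\<close> it is at least
    \<open>\<bar>a v\<bar>\<close> for all \<open>a \<in> A\<close>, which makes
    \<open>shift a m\<close> nonnegative for the alive ones.\<close>
  define m where "m = Abs_poly_mapping (\<lambda>v. if v \<in> S then \<Sum>a\<in>A. nat \<bar>a v\<bar> else 0)"
  have lm: "lookup m v = (if v \<in> S then \<Sum>a\<in>A. nat \<bar>a v\<bar> else 0)" for v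
    unfolding m_def using finite_subset[OF S] by (subst lookup_Abs_poly_mapping) auto
  have m: "keys m \<subseteq> S"
    by (auto simp: in_keys_iff lm split: if_splits)
  define B where "B = {a. g a \<noteq> 0}"
  have BA: "B \<subseteq> A" and Bal: "B \<subseteq> alive S" and finB: "finite B"
    unfolding B_def using g by (auto intro: finite_subset[OF _ A])
  have "\<exists>e. iexp e = shift a m \<and> keys e \<subseteq> {..<d}" if a: "a \<in> B" for a
  proof -
    have alive: "\<forall>v\<ge>d. a v = 0" "\<forall>v. v \<notin> S \<longrightarrow> 0 \<le> a v"
      using Bal a unfolding alive_def by auto
    define e where "e = Abs_poly_mapping (\<lambda>v. nat (shift a m v))"
    have zero: "shift a m v = 0" if "v \<ge> d" for v
      using alive that S by (auto simp: shift_def lm)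
    have le: "lookup e v = nat (shift a m v)" for v
      unfolding e_def
    proof (subst lookup_Abs_poly_mapping)
      have "{v. nat (shift a m v) \<noteq> 0} \<subseteq> {..<d}"
        using zero by (auto simp: not_le[symmetric])
      then show "finite {v. nat (shift a m v) \<noteq> 0}"
        by (rule finite_subset) simp
    qed simp
    have "shift a m v \<ge> 0" for v
    proof (cases "v \<in> S")
      case True
      have "nat \<bar>a v\<bar> \<le> lookup m v"
        unfolding lm using True BA a A
        by (auto intro!: member_le_sum[where f = "\<lambda>a. nat \<bar>a v\<bar>"])
      then show ?thesis by (simp add: shift_def)
    qed (use alive in \<open>simp add: shift_def\<close>)
    then have "iexp e = shift a m"
      by (auto simp: iexp_def le)
    moreover have "keys e \<subseteq> {..<d}"
      using zero by (auto simp: in_keys_iff le not_le[symmetric])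
    ultimately show ?thesis by blast
  qed
  then obtain ex where ex: "\<And>a. a \<in> B \<Longrightarrow> iexp (ex a) = shift a m \<and> keys (ex a) \<subseteq> {..<d}"
    by metis
  define f where "f = (\<Sum>a\<in>B. Poly_Mapping.single (ex a) (g a))"
  have kf: "keys f \<subseteq> ex ` B"
    unfolding f_def by (intro keys_sum_subset) auto
  have f: "f \<in> carrier R"
    using kf ex unfolding poly_ring_carrier_iff by blast
  have co: "icoef f (shift a m) = g a" for a
  proof -
    have "icoef f (shift a m) = (\<Sum>b\<in>B. if b = a then g a else 0)"
      unfolding f_def icoef_sum by (rule sum.cong) (auto simp: icoef_single ex)
    also have "\<dots> = g a"
      using finB by (auto simp: B_def)
    finally show ?thesis .
  qed
  have "class_coef S (fraction S f m) a = g a" for a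
    using g[of a] by (auto simp: class_coef_frac[OF S f m] co)
  moreover have "\<exists>a\<in>A. iexp e = shift a m" if "e \<in> keys f" for e
    using that kf ex BA by blast
  ultimately show ?thesis
    using that f m by blast
qed

section \<open>The Cech complex in a fixed multidegree\<close>

lemma cech_indexD: "S \<in> cech_index d p \<Longrightarrow> S \<subseteq> {..<d}" "S \<in> cech_index d p \<Longrightarrow> card S = p"
  "S \<in> cech_index d p \<Longrightarrow> finite S"
  by (auto simp: cech_index_def intro: finite_subset)

lemma finite_cech_index: "finite (cech_index d p)"
  by (rule finite_subset[of _ "Pow {..<d}"]) (auto simp: cech_index_def)

lemma group_cech: "group (cech_group d M p)"
  unfolding cech_group_def using group_cech_loc cech_indexD by (intro product_group) blast

lemma cech_carrierI:
  "(\<And>S. S \<in> cech_index d p \<Longrightarrow> c S \<in> carrier (cech_loc d M S)) \<Longrightarrow>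
   (\<lambda>S\<in>cech_index d p. c S) \<in> carrier (cech_group d M p)"
  by (simp add: cech_group_def)

lemma cech_carrierD:
  "c \<in> carrier (cech_group d M p) \<Longrightarrow> S \<in> cech_index d p \<Longrightarrow> c S \<in> carrier (cech_loc d M S)"
  by (auto simp: cech_group_def)

definition coef_cochain :: "nat \<Rightarrow> (nat set \<Rightarrow> ('k mpoly set \<times> 'k mpoly) set) \<Rightarrow> (nat \<Rightarrow> int)
    \<Rightarrow> nat set \<Rightarrow> 'k" where
  "coef_cochain p c a S = (if S \<in> cech_index d p then class_coef S (c S) a else 0)"

text \<open>The family indexing the strand of multidegree \<open>a\<close> in the Cech complex: each
  localization contributes at most one copy of \<open>k\<close> there.\<close>

definition alive_sets :: "(nat \<Rightarrow> int) \<Rightarrow> nat set set" where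
  "alive_sets a = {S. S \<subseteq> {..<d} \<and> a \<in> alive S}"

lemma cochain_eqI:
  assumes c: "c \<in> carrier (cech_group d M p)" and c': "c' \<in> carrier (cech_group d M p)"
    and eq: "\<And>S a. S \<in> cech_index d p \<Longrightarrow> class_coef S (c S) a = class_coef S (c' S) a"
  shows "c = c'"
proof (rule PiE_ext)
  show "c \<in> (\<Pi>\<^sub>E S\<in>cech_index d p. carrier (cech_loc d M S))"
    "c' \<in> (\<Pi>\<^sub>E S\<in>cech_index d p. carrier (cech_loc d M S))"
    using c c' by (simp_all add: cech_group_def)
  show "c S = c' S" if "S \<in> cech_index d p" for S
    using class_coef_inj[OF cech_indexD(1)[OF that] cech_carrierD[OF c that] cech_carrierD[OF c' that]]
      eq[OF that] by blast
qed

lemma coef_cochain_comb: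
  "c \<in> carrier (cech_group d M p) \<Longrightarrow> comb_cochain (alive_sets a) p (coef_cochain p c a)"
  unfolding comb_cochain_def
proof (intro allI impI)
  fix S assume c: "c \<in> carrier (cech_group d M p)" and "coef_cochain p c a S \<noteq> 0"
  then have S: "S \<in> cech_index d p" "class_coef S (c S) a \<noteq> 0"
    by (auto simp: coef_cochain_def split: if_splits)
  then have "a \<in> alive S"
    using class_coef_not_alive[OF cech_indexD(1) cech_carrierD[OF c]] by blast
  then show "S \<in> alive_sets a \<and> card S = p"
    using S(1) cech_indexD by (simp add: alive_sets_def)
qed

text \<open>Taking coefficients at \<open>a\<close> is a chain map: \<open>loc_map\<close> keeps or
  kills the coefficient, inversion gives the sign, and the product over \<open>T\<close> becomes a
  sum.\<close>

lemma cech_diff_coef: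
  assumes c: "c \<in> carrier (cech_group d M p)" and T: "T \<in> cech_index d (Suc p)"
  shows "cech_diff d M p c T \<in> carrier (cech_loc d M T)"
    and "class_coef T (cech_diff d M p c T) a = comb_diff (alive_sets a) (coef_cochain p c a) T"
proof -
  have Td: "T \<subseteq> {..<d}" and fin: "finite T" using T cech_indexD by blast+
  interpret comm_group "cech_loc d M T" by (rule comm_group_cech_loc[OF Td])
  define y where "y v = (let y = loc_map M T (c (T - {v}))
      in if even (card {u \<in> T. u < v}) then y else inv\<^bsub>cech_loc d M T\<^esub> y)" for v
  have eq: "cech_diff d M p c T = finprod (cech_loc d M T) y T"
    using T unfolding cech_diff_def y_def by simp
  have idx: "T - {v} \<in> cech_index d p" if "v \<in> T" for v
    using T that fin by (auto simp: cech_index_def)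
  have lm: "loc_map M T (c (T - {v})) \<in> carrier (cech_loc d M T)"
    "class_coef T (loc_map M T (c (T - {v}))) a =
       (if a \<in> alive T then class_coef (T - {v}) (c (T - {v})) a else 0)" if "v \<in> T" for v a
    using loc_map_coef[OF _ Td cech_carrierD[OF c idx[OF that]]] by auto
  have y: "y \<in> T \<rightarrow> carrier (cech_loc d M T)"
    using lm(1) by (auto simp: y_def Let_def)
  show "cech_diff d M p c T \<in> carrier (cech_loc d M T)"
    unfolding eq by (rule finprod_closed[OF y])
  have yc: "class_coef T (y v) a =
      (if a \<in> alive T then alt_sign v T * coef_cochain p c a (T - {v}) else 0)" if "v \<in> T" for v
    using lm[OF that] idx[OF that]
    by (simp add: y_def Let_def class_coef_inv[OF Td] alt_sign_def coef_cochain_def)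
  have "class_coef T (cech_diff d M p c T) a = (\<Sum>v\<in>T. class_coef T (y v) a)"
    unfolding eq by (rule class_coef_finprod[OF Td y fin])
  also have "\<dots> = (\<Sum>v\<in>T. if a \<in> alive T then alt_sign v T * coef_cochain p c a (T - {v}) else 0)"
    by (rule sum.cong[OF refl yc])
  also have "\<dots> = comb_diff (alive_sets a) (coef_cochain p c a) T"
    using Td by (simp add: comb_diff_def alive_sets_def)
  finally show "class_coef T (cech_diff d M p c T) a = comb_diff (alive_sets a) (coef_cochain p c a) T" .
qed

lemma cech_diff_closed:
  "c \<in> carrier (cech_group d M p) \<Longrightarrow> cech_diff d M p c \<in> carrier (cech_group d M (Suc p))"
  using cech_diff_coef(1)[of c p] by (auto simp: cech_group_def cech_diff_def PiE_iff)

lemma cech_mult_coef: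
  assumes c: "c \<in> carrier (cech_group d M p)" and c': "c' \<in> carrier (cech_group d M p)"
    and S: "S \<in> cech_index d p"
  shows "class_coef S ((c \<otimes>\<^bsub>cech_group d M p\<^esub> c') S) a = class_coef S (c S) a + class_coef S (c' S) a"
  using frac_mult_closed(2)[OF cech_indexD(1)[OF S] cech_carrierD[OF c S] cech_carrierD[OF c' S]] S
  by (simp add: cech_group_def)

lemma comb_diff_add:
  "comb_diff K (\<lambda>S. \<phi> S + \<psi> S) T = comb_diff K \<phi> T + comb_diff K \<psi> T"
  by (simp add: comb_diff_def distrib_left sum.distrib)

lemma cech_diff_hom: "cech_diff d M p \<in> hom (cech_group d M p) (cech_group d M (Suc p))"
proof (rule homI)
  fix c c' assume c: "c \<in> carrier (cech_group d M p)" and c': "c' \<in> carrier (cech_group d M p)"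
  interpret G: group "cech_group d M p" by (rule group_cech)
  interpret H: group "cech_group d M (Suc p)" by (rule group_cech)
  show "cech_diff d M p (c \<otimes>\<^bsub>cech_group d M p\<^esub> c') =
      cech_diff d M p c \<otimes>\<^bsub>cech_group d M (Suc p)\<^esub> cech_diff d M p c'"
  proof (rule cochain_eqI)
    fix T a assume T: "T \<in> cech_index d (Suc p)"
    have "coef_cochain p (c \<otimes>\<^bsub>cech_group d M p\<^esub> c') a = (\<lambda>S. coef_cochain p c a S + coef_cochain p c' a S)"
      by (auto simp: coef_cochain_def cech_mult_coef[OF c c'])
    then show "class_coef T (cech_diff d M p (c \<otimes>\<^bsub>cech_group d M p\<^esub> c') T) a =
        class_coef T ((cech_diff d M p c \<otimes>\<^bsub>cech_group d M (Suc p)\<^esub> cech_diff d M p c') T) a"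
      by (simp only: cech_mult_coef[OF cech_diff_closed[OF c] cech_diff_closed[OF c'] T]
          cech_diff_coef(2)[OF _ T] c c' G.m_closed comb_diff_add)
  qed (auto intro: cech_diff_closed c c')
qed (rule cech_diff_closed)

lemma subgroup_coboundaries: "subgroup (cech_coboundaries d M i) (cech_group d M i)"
proof (cases i)
  case 0
  then show ?thesis
    using group.triv_subgroup[OF group_cech] by (simp add: cech_coboundaries_def)
next
  case (Suc p)
  interpret group_hom "cech_group d M p" "cech_group d M (Suc p)" "cech_diff d M p"
    by (intro group_hom.intro group_cech group_hom_axioms.intro cech_diff_hom)
  show ?thesis
    using img_is_subgroup Suc by (simp add: cech_coboundaries_def)
qed

lemma cech_one_coef: "S \<in> cech_index d p \<Longrightarrow> class_coef S (\<one>\<^bsub>cech_group d M p\<^esub> S) a = 0"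
  using cech_indexD(1) by (simp add: cech_group_def class_coef_one)

lemma cocycle_iff:
  assumes z: "z \<in> carrier (cech_group d M i)"
  shows "z \<in> cech_cocycles d M i \<longleftrightarrow>
    (\<forall>a T. card T = Suc i \<longrightarrow> comb_diff (alive_sets a) (coef_cochain i z a) T = 0)"
proof
  assume "z \<in> cech_cocycles d M i"
  then have one: "cech_diff d M i z = \<one>\<^bsub>cech_group d M (Suc i)\<^esub>"
    by (simp add: cech_cocycles_def kernel_def)
  show "\<forall>a T. card T = Suc i \<longrightarrow> comb_diff (alive_sets a) (coef_cochain i z a) T = 0"
  proof (intro allI impI)
    fix a and T :: "nat set" assume "card T = Suc i"
    show "comb_diff (alive_sets a) (coef_cochain i z a) T = 0"
    proof (cases "T \<subseteq> {..<d}")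
      case True
      then have T: "T \<in> cech_index d (Suc i)"
        using \<open>card T = Suc i\<close> by (simp add: cech_index_def)
      show ?thesis
        using cech_diff_coef(2)[OF z T, of a] one cech_one_coef[OF T] by simp
    qed (simp add: comb_diff_def alive_sets_def)
  qed
next
  assume zero: "\<forall>a T. card T = Suc i \<longrightarrow> comb_diff (alive_sets a) (coef_cochain i z a) T = 0"
  interpret group "cech_group d M (Suc i)" by (rule group_cech)
  have "cech_diff d M i z = \<one>\<^bsub>cech_group d M (Suc i)\<^esub>"
  proof (rule cochain_eqI[OF cech_diff_closed[OF z] one_closed])
    fix T a assume T: "T \<in> cech_index d (Suc i)"
    show "class_coef T (cech_diff d M i z T) a = class_coef T (\<one>\<^bsub>cech_group d M (Suc i)\<^esub> T) a"
      using cech_diff_coef(2)[OF z T, of a] zero cech_one_coef[OF T] cech_indexD(2)[OF T] by simp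
  qed
  then show "z \<in> cech_cocycles d M i"
    using z by (simp add: cech_cocycles_def kernel_def)
qed

lemma cochain_exists:
  assumes A: "finite A"
    and g: "\<And>S a. S \<in> cech_index d p \<Longrightarrow> g S a \<noteq> 0 \<Longrightarrow> a \<in> A \<and> a \<in> alive S"
  obtains c where "c \<in> carrier (cech_group d M p)"
    "\<And>S a. S \<in> cech_index d p \<Longrightarrow> class_coef S (c S) a = g S a"
    "\<And>S j. S \<in> cech_index d p \<Longrightarrow> (\<And>a. a \<in> A \<Longrightarrow> (\<Sum>v<d. a v) = j) \<Longrightarrow>
       c S \<in> cech_loc_component M (quot_grading d J) S j"
proof -
  have "\<exists>X. X \<in> carrier (cech_loc d M S) \<and> (\<forall>a. class_coef S X a = g S a) \<and>
      (\<forall>j. (\<forall>a\<in>A. (\<Sum>v<d. a v) = j) \<longrightarrow> X \<in> cech_loc_component M (quot_grading d J) S j)"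
    if S: "S \<in> cech_index d p" for S
  proof -
    note Sd = cech_indexD(1)[OF S]
    obtain f m where f: "f \<in> carrier R" "keys m \<subseteq> S" "\<And>a. class_coef S (fraction S f m) a = g S a"
      and ex: "\<And>e. e \<in> keys f \<Longrightarrow> \<exists>a\<in>A. iexp e = shift a m"
      using fraction_exists[OF Sd A, of "g S"] g[OF S] by blast
    have md: "keys m \<subseteq> {..<d}" using f(2) Sd by blast
    have "fraction S f m \<in> cech_loc_component M (quot_grading d J) S j"
      if j: "\<forall>a\<in>A. (\<Sum>v<d. a v) = j" for j
    proof -
      have "int (mdeg e) = j + int (mdeg m)" if e: "e \<in> keys f" for e
      proof -
        obtain a where a: "a \<in> A" "iexp e = shift a m" using ex[OF e] by blast
        have "keys e \<subseteq> {..<d}" using f(1) e by (simp add: poly_ring_carrier_iff)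
        then have "int (mdeg e) = (\<Sum>v<d. iexp e v)"
          by (simp add: int_mdeg iexp_def)
        also have "\<dots> = (\<Sum>v<d. a v) + int (mdeg m)"
          unfolding a(2) using md by (simp add: int_mdeg shift_def sum.distrib)
        finally show ?thesis using j a by simp
      qed
      then have "f \<in> homogeneous d (j + int (mdeg m))"
        using f(1) by (simp add: homogeneous_def)
      then show ?thesis
        unfolding cech_loc_component_def quot_grading_def fraction_def using f(2) by blast
    qed
    then show ?thesis using frac_closed[OF Sd f(1,2)] f(3) by blast
  qed
  then obtain X where X: "\<And>S. S \<in> cech_index d p \<Longrightarrow> X S \<in> carrier (cech_loc d M S) \<and>
      (\<forall>a. class_coef S (X S) a = g S a) \<and>
      (\<forall>j. (\<forall>a\<in>A. (\<Sum>v<d. a v) = j) \<longrightarrow> X S \<in> cech_loc_component M (quot_grading d J) S j)"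
    by metis
  show ?thesis
    by (rule that[of "\<lambda>S\<in>cech_index d p. X S"]) (use X in \<open>auto intro: cech_carrierI\<close>)
qed

lemma component_degree:
  assumes S: "S \<subseteq> {..<d}" and X: "X \<in> cech_loc_component M (quot_grading d J) S j"
    and a: "class_coef S X a \<noteq> 0"
  shows "(\<Sum>v<d. a v) = j"
proof -
  obtain f m where fm: "X = fraction S f m" "keys m \<subseteq> S" "f \<in> homogeneous d (j + int (mdeg m))"
    using X by (auto simp: cech_loc_component_def quot_grading_def fraction_def)
  then have f: "f \<in> carrier R" by (simp add: homogeneous_def)
  have "icoef f (shift a m) \<noteq> 0"
    using a unfolding fm(1) class_coef_frac[OF S f fm(2)] by (auto split: if_splits)
  then obtain e where e: "e \<in> keys f" "shift a m = iexp e"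
    by (rule icoef_nonzeroD)
  have "keys e \<subseteq> {..<d}" "keys m \<subseteq> {..<d}"
    using f e fm(2) S by (auto simp: poly_ring_carrier_iff)
  have "(\<Sum>v<d. a v) + int (mdeg m) = (\<Sum>v<d. shift a m v)"
    using \<open>keys m \<subseteq> {..<d}\<close> by (simp add: int_mdeg shift_def sum.distrib)
  also have "\<dots> = int (mdeg e)"
    unfolding e(2) using \<open>keys e \<subseteq> {..<d}\<close> by (simp add: int_mdeg iexp_def)
  also have "\<dots> = j + int (mdeg m)"
    using fm(3) e(1) by (simp add: homogeneous_def)
  finally show ?thesis by simp
qed

lemma finite_coef_support:
  assumes z: "z \<in> carrier (cech_group d M i)"
  shows "finite {a. \<exists>S\<in>cech_index d i. class_coef S (z S) a \<noteq> 0}"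
proof -
  have "{a. \<exists>S\<in>cech_index d i. class_coef S (z S) a \<noteq> 0} =
      (\<Union>S\<in>cech_index d i. {a. class_coef S (z S) a \<noteq> 0})"
    by blast
  then show ?thesis
    using finite_class_coef[OF cech_indexD(1) cech_carrierD[OF z]] finite_cech_index by auto
qed

text \<open>The nontrivial direction glues primitives chosen separately in each multidegree into one
  cochain, which is possible because \<open>z\<close> occupies only finitely many
  multidegrees.\<close>

lemma coboundary_iff:
  assumes z: "z \<in> carrier (cech_group d M i)"
  shows "z \<in> cech_coboundaries d M i \<longleftrightarrow> (\<forall>a. comb_coboundary (alive_sets a) i (coef_cochain i z a))"
proof (cases i)
  case 0
  interpret group "cech_group d M 0" by (rule group_cech)
  have "z = \<one>\<^bsub>cech_group d M 0\<^esub> \<longleftrightarrow> (\<forall>a S. coef_cochain 0 z a S = 0)"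
  proof
    assume "\<forall>a S. coef_cochain 0 z a S = 0"
    then have "class_coef S (z S) a = class_coef S (\<one>\<^bsub>cech_group d M 0\<^esub> S) a"
      if "S \<in> cech_index d 0" for S a
      using that cech_one_coef[OF that] unfolding coef_cochain_def by metis
    then show "z = \<one>\<^bsub>cech_group d M 0\<^esub>"
      using z 0 by (intro cochain_eqI[of _ 0]) auto
  qed (auto simp: coef_cochain_def cech_one_coef)
  then show ?thesis
    using 0 by (simp add: cech_coboundaries_def comb_coboundary_def)
next
  case (Suc p)
  show ?thesis
  proof
    assume "z \<in> cech_coboundaries d M i"
    then obtain w where w: "w \<in> carrier (cech_group d M p)" "z = cech_diff d M p w"
      using Suc by (auto simp: cech_coboundaries_def)
    show "\<forall>a. comb_coboundary (alive_sets a) i (coef_cochain i z a)"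
      unfolding comb_coboundary_def Suc nat.case
    proof (intro allI exI conjI impI)
      fix a
      show "comb_cochain (alive_sets a) p (coef_cochain p w a)"
        by (rule coef_cochain_comb[OF w(1)])
      fix T :: "nat set" assume T: "card T = Suc p"
      show "coef_cochain (Suc p) z a T = comb_diff (alive_sets a) (coef_cochain p w a) T"
        using T w(2) cech_diff_coef(2)[OF w(1), of T a]
        by (auto simp: coef_cochain_def cech_index_def comb_diff_def alive_sets_def)
    qed
  next
    assume "\<forall>a. comb_coboundary (alive_sets a) i (coef_cochain i z a)"
    then obtain \<psi> where \<psi>: "\<And>a. comb_cochain (alive_sets a) p (\<psi> a)"
      "\<And>a T. card T = Suc p \<Longrightarrow> coef_cochain (Suc p) z a T = comb_diff (alive_sets a) (\<psi> a) T"
      unfolding comb_coboundary_def Suc nat.case by metis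
    \<comment> \<open>Primitives outside \<open>A\<close> are discarded: \<open>z\<close> has no
      coefficients there, so zero is a primitive, and the rest is finitely supported.\<close>
    define A where "A = {a. \<exists>S\<in>cech_index d i. class_coef S (z S) a \<noteq> 0}"
    have A: "finite A" unfolding A_def by (rule finite_coef_support[OF z])
    define g where "g S a = (if a \<in> A then \<psi> a S else 0)" for S a
    have "a \<in> A \<and> a \<in> alive S" if "g S a \<noteq> 0" for S a
      using that \<psi>(1)[of a] by (auto simp: g_def comb_cochain_def alive_sets_def split: if_splits)
    then obtain w where w: "w \<in> carrier (cech_group d M p)"
      "\<And>S a. S \<in> cech_index d p \<Longrightarrow> class_coef S (w S) a = g S a"
      using cochain_exists[OF A, of p g] by metis
    have cw: "coef_cochain p w a S = g S a" for a S
    proof (cases "S \<in> cech_index d p")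
      case False
      then have "\<psi> a S = 0"
        using \<psi>(1)[of a] by (auto simp: comb_cochain_def alive_sets_def cech_index_def)
      then show ?thesis using False by (simp add: coef_cochain_def g_def)
    qed (simp add: coef_cochain_def w)
    have "z = cech_diff d M p w"
    proof (rule cochain_eqI)
      show "z \<in> carrier (cech_group d M (Suc p))" using z Suc by simp
      fix T a assume T: "T \<in> cech_index d (Suc p)"
      have "class_coef T (z T) a = comb_diff (alive_sets a) (\<lambda>S. g S a) T"
      proof (cases "a \<in> A")
        case True
        then show ?thesis
          using \<psi>(2)[OF cech_indexD(2)[OF T], of a] T by (simp add: coef_cochain_def g_def)
      next
        case False
        then show ?thesis
          using T Suc by (auto simp: g_def A_def comb_diff_def)
      qed
      then show "class_coef T (z T) a = class_coef T (cech_diff d M p w T) a"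
        by (simp add: cech_diff_coef(2)[OF w(1) T] cw comb_diff_def)
    qed (rule cech_diff_closed[OF w(1)])
    then show "z \<in> cech_coboundaries d M i"
      using w(1) Suc by (auto simp: cech_coboundaries_def)
  qed
qed

text \<open>The neutral cochain is homogeneous of every degree. A graded component therefore always
  contains the trivial class and is nontrivial exactly when it contains another one.\<close>

lemma one_component: "\<one>\<^bsub>cech_group d M i\<^esub> \<in> cech_cocycles d M i"
  and one_homogeneous: "S \<in> cech_index d i \<Longrightarrow>
    \<one>\<^bsub>cech_group d M i\<^esub> S \<in> cech_loc_component M (quot_grading d J) S j"
proof -
  interpret group_hom "cech_group d M i" "cech_group d M (Suc i)" "cech_diff d M i"
    by (intro group_hom.intro group_cech group_hom_axioms.intro cech_diff_hom)
  show "\<one>\<^bsub>cech_group d M i\<^esub> \<in> cech_cocycles d M i"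
    by (simp add: cech_cocycles_def kernel_def)
  assume "S \<in> cech_index d i"
  then have "\<one>\<^bsub>cech_group d M i\<^esub> S = fraction S 0 0"
    by (simp add: cech_group_def frac_one)
  moreover have "(0 :: 'k mpoly) \<in> homogeneous d (j + int (mdeg 0))"
    using carrier_closed(5) by (simp add: homogeneous_def)
  ultimately show "\<one>\<^bsub>cech_group d M i\<^esub> S \<in> cech_loc_component M (quot_grading d J) S j"
    by (auto simp: cech_loc_component_def quot_grading_def fraction_def intro!: exI[of _ 0])
qed

text \<open>A nontrivial homogeneous cocycle fails to be a coboundary in some multidegree; it has a
  nonzero coefficient there, which fixes the total degree of that multidegree. Conversely a
  combinatorial class is placed in one multidegree.\<close>

lemma component_nontrivial_iff:
  "local_cohomology_component d M (quot_grading d J) i j \<noteq> {\<one>\<^bsub>local_cohomology d M i\<^esub>} \<longleftrightarrow>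
    (\<exists>a. (\<Sum>v<d. a v) = j \<and> comb_cohomology_nonzero TYPE('k) (alive_sets a) i)"
proof -
  interpret group "cech_group d M i" by (rule group_cech)
  let ?B = "cech_coboundaries d M i"
  let ?hom = "\<lambda>z. z \<in> cech_cocycles d M i \<and>
    (\<forall>S\<in>cech_index d i. z S \<in> cech_loc_component M (quot_grading d J) S j)"
  have coset: "?B #>\<^bsub>cech_group d M i\<^esub> z = ?B \<longleftrightarrow> z \<in> ?B"
    if "z \<in> carrier (cech_group d M i)" for z
    using coset_join1[OF _ that subgroup_coboundaries] coset_join2[OF that subgroup_coboundaries]
      subgroup.subset[OF subgroup_coboundaries] by blast
  have carr: "z \<in> carrier (cech_group d M i)" if "z \<in> cech_cocycles d M i" for z
    using that by (simp add: cech_cocycles_def kernel_def)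
  have "?hom \<one>\<^bsub>cech_group d M i\<^esub>"
    using one_component one_homogeneous by blast
  moreover have "?B #>\<^bsub>cech_group d M i\<^esub> \<one>\<^bsub>cech_group d M i\<^esub> = ?B"
    using coset one_closed subgroup.one_closed[OF subgroup_coboundaries] by blast
  ultimately have "local_cohomology_component d M (quot_grading d J) i j \<noteq> {?B} \<longleftrightarrow>
      (\<exists>z. ?hom z \<and> ?B #>\<^bsub>cech_group d M i\<^esub> z \<noteq> ?B)"
    unfolding local_cohomology_component_def by blast
  also have "\<dots> \<longleftrightarrow> (\<exists>z. ?hom z \<and> z \<notin> ?B)"
    using coset carr by blast
  also have "\<dots> \<longleftrightarrow> (\<exists>a. (\<Sum>v<d. a v) = j \<and> comb_cohomology_nonzero TYPE('k) (alive_sets a) i)"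
  proof
    assume "\<exists>z. ?hom z \<and> z \<notin> ?B"
    then obtain z where z: "z \<in> cech_cocycles d M i" "z \<notin> ?B"
      "\<And>S. S \<in> cech_index d i \<Longrightarrow> z S \<in> cech_loc_component M (quot_grading d J) S j"
      by blast
    note zc = carr[OF z(1)]
    obtain a where a: "\<not> comb_coboundary (alive_sets a) i (coef_cochain i z a)"
      using z(2) coboundary_iff[OF zc] by blast
    have coch: "comb_cochain (alive_sets a) i (coef_cochain i z a)"
      by (rule coef_cochain_comb[OF zc])
    have "comb_cohomology_nonzero TYPE('k) (alive_sets a) i"
      unfolding comb_cohomology_nonzero_def
      using coch a z(1) cocycle_iff[OF zc] by blast
    moreover have "(\<Sum>v<d. a v) = j"
    proof -
      have "\<exists>S. coef_cochain i z a S \<noteq> 0"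
      proof (rule ccontr)
        assume "\<not> ?thesis"
        then have "comb_coboundary (alive_sets a) i (coef_cochain i z a)"
          by (auto simp: comb_coboundary_def comb_cochain_def comb_diff_def split: nat.split
              intro!: exI[of _ "\<lambda>_. 0"])
        then show False using a by blast
      qed
      then obtain S where "S \<in> cech_index d i" "class_coef S (z S) a \<noteq> 0"
        unfolding coef_cochain_def by (auto split: if_splits)
      then show ?thesis
        using component_degree[OF cech_indexD(1) z(3)] by blast
    qed
    ultimately show "\<exists>a. (\<Sum>v<d. a v) = j \<and> comb_cohomology_nonzero TYPE('k) (alive_sets a) i"
      by blast
  next
    assume "\<exists>a. (\<Sum>v<d. a v) = j \<and> comb_cohomology_nonzero TYPE('k) (alive_sets a) i"
    then obtain a and \<phi> :: "nat set \<Rightarrow> 'k" where a: "(\<Sum>v<d. a v) = j"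
      and \<phi>: "comb_cochain (alive_sets a) i \<phi>"
        "\<And>T. card T = Suc i \<Longrightarrow> comb_diff (alive_sets a) \<phi> T = 0"
        "\<not> comb_coboundary (alive_sets a) i \<phi>"
      unfolding comb_cohomology_nonzero_def by blast
    \<comment> \<open>The combinatorial cocycle in multidegree \<open>a\<close>, zero in all
      others.\<close>
    define g where "g S b = (if b = a then \<phi> S else 0)" for S b
    have "b \<in> {a} \<and> b \<in> alive S" if "g S b \<noteq> 0" for S b
      using that \<phi>(1) by (auto simp: g_def comb_cochain_def alive_sets_def split: if_splits)
    then obtain z where z: "z \<in> carrier (cech_group d M i)"
      "\<And>S b. S \<in> cech_index d i \<Longrightarrow> class_coef S (z S) b = g S b"
      "\<And>S. S \<in> cech_index d i \<Longrightarrow> z S \<in> cech_loc_component M (quot_grading d J) S j"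
      using cochain_exists[of "{a}" i g] a by (metis finite.emptyI finite.insertI singletonD)
    have cz: "coef_cochain i z b S = g S b" for b S
    proof (cases "S \<in> cech_index d i")
      case False
      then have "\<phi> S = 0"
        using \<phi>(1) by (auto simp: comb_cochain_def alive_sets_def cech_index_def)
      then show ?thesis using False by (simp add: coef_cochain_def g_def)
    qed (simp add: coef_cochain_def z)
    have cza: "coef_cochain i z a = \<phi>"
      by (simp add: fun_eq_iff cz g_def)
    have czb: "coef_cochain i z b = (\<lambda>_. 0)" if "b \<noteq> a" for b
      using that by (auto simp: cz g_def)
    have "z \<in> cech_cocycles d M i"
      unfolding cocycle_iff[OF z(1)]
    proof (intro allI impI)
      fix b and T :: "nat set" assume "card T = Suc i"
      then show "comb_diff (alive_sets b) (coef_cochain i z b) T = 0"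
        using \<phi>(2) by (cases "b = a") (simp_all add: cza czb comb_diff_def)
    qed
    moreover have "z \<notin> ?B"
      unfolding coboundary_iff[OF z(1)] using \<phi>(3) cza by metis
    ultimately show "\<exists>z. ?hom z \<and> z \<notin> ?B" using z(3) by blast
  qed
  finally show ?thesis
    by (simp add: local_cohomology_def FactGroup_def)
qed

section \<open>A lower bound for the dimension of the quotient\<close>

lemma annihilator_quot: "annihilator R M = J"
proof (intro equalityI subsetI)
  fix r assume "r \<in> annihilator R M"
  then have r: "r \<in> carrier R" and all: "\<And>x. x \<in> carrier M \<Longrightarrow> r \<odot>\<^bsub>M\<^esub> x = \<zero>\<^bsub>M\<^esub>"
    by (auto simp: annihilator_def)
  have "coset r = coset 0"
    using all[OF coset_carrier[OF carrier_closed(6)]] smult_M[OF r carrier_closed(6)] zero_M by simp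
  then show "r \<in> J"
    using coset_eq_iff[OF r carrier_closed(5)] by simp
next
  fix r assume r: "r \<in> J"
  then have rc: "r \<in> carrier R" by (rule J.Icarr)
  have "r \<odot>\<^bsub>M\<^esub> x = \<zero>\<^bsub>M\<^esub>" if x: "x \<in> carrier M" for x
  proof -
    obtain f where f: "f \<in> carrier R" "x = coset f"
      using x unfolding carrier_M by (elim bexE)
    have "r * f - 0 \<in> J"
      using J.I_r_closed[OF r f(1)] by simp
    then have "coset (r * f) = coset 0"
      by (subst coset_eq_iff) (use rc f(1) in simp_all)
    then show ?thesis using rc f by (simp add: zero_M)
  qed
  then show "r \<in> annihilator R M"
    using rc by (simp add: annihilator_def)
qed

lemma coset_mem_image_iff:
  assumes Q: "ideal Q R" "J \<subseteq> Q" and f: "f \<in> carrier R"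
  shows "coset f \<in> (\<lambda>f. coset f) ` Q \<longleftrightarrow> f \<in> Q"
proof
  interpret Q: ideal Q R by fact
  assume "coset f \<in> (\<lambda>f. coset f) ` Q"
  then obtain q where q: "q \<in> Q" "coset f = coset q" by blast
  then have "f - q \<in> Q"
    using coset_eq_iff[OF f Q.Icarr[OF q(1)]] Q(2) by blast
  then have "(f - q) + q \<in> Q"
    using additive_subgroup.a_closed[OF ideal.axioms(1)[OF Q(1)] _ q(1), of "f - q"] by simp
  then show "f \<in> Q" by simp
qed blast

lemma prime_image:
  assumes Q: "primeideal Q R" "J \<subseteq> Q"
  shows "primeideal ((\<lambda>f. coset f) ` Q) (R Quot J)"
proof (rule primeidealI)
  interpret Q: primeideal Q R by fact
  note Qi = Q.is_ideal
  show "ideal ((\<lambda>f. coset f) ` Q) (R Quot J)"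
    by (rule R.ring_ideal_imp_quot_ideal[OF J.is_ideal Qi])
  show "cring (R Quot J)"
    by (rule J.quotient_is_cring[OF R.is_cring])
  have carr: "x \<in> carrier (R Quot J) \<longleftrightarrow> (\<exists>f\<in>carrier R. x = coset f)" for x
    using carrier_M[of x] by (simp add: quot_module_def)
  have "1 \<notin> Q"
    using Q.one_imp_carrier Q.I_notcarr by auto
  then have "coset 1 \<notin> (\<lambda>f. coset f) ` Q"
    using coset_mem_image_iff[OF Qi Q(2)] by simp
  moreover have "coset 1 \<in> carrier (R Quot J)"
    using carr carrier_closed(6) by blast
  ultimately show "carrier (R Quot J) \<noteq> (\<lambda>f. coset f) ` Q"
    by blast
  fix a b assume a: "a \<in> carrier (R Quot J)" and b: "b \<in> carrier (R Quot J)"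
    and ab: "a \<otimes>\<^bsub>R Quot J\<^esub> b \<in> (\<lambda>f. coset f) ` Q"
  obtain f where f: "f \<in> carrier R" "a = coset f"
    using a unfolding carr by (elim bexE)
  obtain g where g: "g \<in> carrier R" "b = coset g"
    using b unfolding carr by (elim bexE)
  have "a \<otimes>\<^bsub>R Quot J\<^esub> b = coset (f * g)"
    using J.rcoset_mult_add[OF f(1) g(1)] f g by (simp add: FactRing_def)
  then have "f * g \<in> Q"
    using ab coset_mem_image_iff[OF Qi Q(2), of "f * g"] f g by simp
  then have "f \<in> Q \<or> g \<in> Q"
    using Q.I_prime[OF f(1) g(1)] by simp
  then show "a \<in> (\<lambda>f. coset f) ` Q \<or> b \<in> (\<lambda>f. coset f) ` Q"
    using f g by blast
qed

text \<open>Starting from \<open>P\<close>, the remaining \<open>d - card P\<close> variables are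
  added one by one, which gives a chain of primes with that many strict steps. The bound later shows
  that an index with nonzero cohomology takes part in the regularity.\<close>

lemma module_dim_ge:
  assumes P: "P \<subseteq> {..<d}" and JP: "J \<subseteq> var_ideal d P"
  shows "ereal (real (d - card P)) \<le> module_dim R M"
proof -
  define xs where "xs = sorted_list_of_set ({..<d} - P)"
  have xs: "set xs = {..<d} - P" "distinct xs"
    by (simp_all add: xs_def)
  have len: "length xs = d - card P"
    using P finite_subset[OF P] by (simp add: xs_def card_Diff_subset)
  define Pk where "Pk k = P \<union> set (take k xs)" for k
  have Pk: "Pk k \<subseteq> {..<d}" "P \<subseteq> Pk k" for k
    using P xs set_take_subset[of k xs] by (auto simp: Pk_def)
  have mono: "(var_ideal d (Pk k) :: 'k mpoly set) \<subseteq> var_ideal d (Pk l)" if "k \<le> l" for k l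
    using that Pk set_take_subset_set_take[OF that, of xs]
    by (subst var_ideal_mono_iff) (auto simp: Pk_def)
  have JQ: "J \<subseteq> var_ideal d (Pk k)" for k
    using JP var_ideal_mono_iff[OF P Pk(1), where 'k='k] Pk(2) by blast
  define Q where "Q k = (\<lambda>f. coset f) ` var_ideal d (Pk k)" for k
  have "primeideal (Q k) (R Quot J)" for k
    unfolding Q_def by (rule prime_image[OF primeideal_var JQ])
  moreover have "Q k \<subset> Q (Suc k)" if k: "k < d - card P" for k
  proof
    show "Q k \<subseteq> Q (Suc k)"
      unfolding Q_def by (intro image_mono mono) simp
    have kl: "k < length xs" using k len by simp
    then have vk: "xs ! k \<in> Pk (Suc k)"
      by (simp add: Pk_def take_Suc_conv_app_nth)
    have "xs ! k \<notin> set (take k xs)"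
      using kl xs(2) by (auto simp: in_set_conv_nth nth_eq_iff_index_eq)
    then have nk: "xs ! k \<notin> Pk k"
      using nth_mem[OF kl] xs(1) by (simp add: Pk_def)
    let ?x = "monomial (Poly_Mapping.single (xs ! k) 1) :: 'k mpoly"
    have x: "?x \<in> carrier R"
      using nth_mem[OF kl] xs(1) by (intro monomial_carrier) auto
    have "coset ?x \<in> Q (Suc k)" "coset ?x \<notin> Q k"
      unfolding Q_def coset_mem_image_iff[OF ideal_mspan[OF expo_upset_pdeg_ge] JQ x]
      using vk nk var_mem_var_ideal[OF Pk(1), where 'k='k] by simp_all
    then show "Q k \<noteq> Q (Suc k)" by blast
  qed
  ultimately show ?thesis
    unfolding module_dim_def annihilator_quot krull_dim_def by (intro Sup_upper) blast
qed

lemma a_invariant_quot_eq: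
  "a_invariant_quot d J i = Sup {ereal (real_of_int j) |j.
     \<exists>a. (\<Sum>v<d. a v) = j \<and> comb_cohomology_nonzero TYPE('k) (alive_sets a) i}"
  unfolding a_invariant_quot_def a_invariant_def component_nontrivial_iff ..

end

section \<open>Asymptotics of the degrees of local cohomology\<close>

text \<open>The limit is the supremum \<open>L\<close> of all quotients \<open>j / n\<close>, finite
  by \<open>bound\<close>. No term exceeds it by definition; from below, a single near-optimal pair
  \<open>n\<close>, \<open>j\<close> yields through \<open>scale\<close> a degree for every large
  \<open>N\<close> whose quotient by \<open>N\<close> tends to \<open>j / n\<close>.\<close>

lemma scaled_Sup_limit:
  fixes Z :: "nat \<Rightarrow> int set" and D :: nat
  defines "\<alpha> \<equiv> \<lambda>n. Sup {ereal (real_of_int j) |j. j \<in> Z n}"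
  assumes bound: "\<And>n j. n \<ge> 1 \<Longrightarrow> j \<in> Z n \<Longrightarrow> j \<le> int D * int n"
    and scale: "\<And>n q r j. n \<ge> 1 \<Longrightarrow> j \<in> Z n \<Longrightarrow> n \<le> q \<Longrightarrow> r < n \<Longrightarrow> (int q + 1) * j \<in> Z (q * n + r)"
  shows "\<exists>L. L \<noteq> \<infinity> \<and> (L = -\<infinity> \<longleftrightarrow> (\<forall>n\<ge>1. Z n = {})) \<and> (\<lambda>n. \<alpha> n / ereal (real n)) \<longlonglongrightarrow> L"
proof (cases "\<forall>n\<ge>1. Z n = {}")
  case True
  \<comment> \<open>An empty supremum is \<open>-\<infinity>\<close>, and division by a positive
    real preserves it.\<close>
  have "\<alpha> n / ereal (real n) = -\<infinity>" if "n \<ge> 1" for n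
    using that True by (simp add: \<alpha>_def bot_ereal_def)
  then have "\<forall>\<^sub>F n in sequentially. -\<infinity> = \<alpha> n / ereal (real n)"
    unfolding eventually_sequentially by metis
  then have "(\<lambda>n. \<alpha> n / ereal (real n)) \<longlonglongrightarrow> -\<infinity>"
    by (rule Lim_transform_eventually[OF tendsto_const])
  then show ?thesis using True by (intro exI[of _ "-\<infinity>"]) simp
next
  case False
  define B where "B = {ereal (real_of_int j / real n) |n j. n \<ge> 1 \<and> j \<in> Z n}"
  define L where "L = Sup B"
  have memL: "ereal (real_of_int j / real n) \<le> L" if "n \<ge> 1" "j \<in> Z n" for n j
    unfolding L_def by (rule Sup_upper) (use that in \<open>auto simp: B_def\<close>)
  have "L \<le> ereal (real D)"
    unfolding L_def
  proof (rule Sup_least)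
    fix x assume "x \<in> B"
    then obtain n j where x: "x = ereal (real_of_int j / real n)" "n \<ge> 1" "j \<in> Z n"
      by (auto simp: B_def)
    have "real_of_int j \<le> real_of_int (int D * int n)"
      using bound[OF x(2,3)] by (simp only: of_int_le_iff)
    then have "real_of_int j \<le> real D * real n" by simp
    then show "x \<le> ereal (real D)"
      using x by (simp add: divide_le_eq)
  qed
  then have ninf: "L \<noteq> \<infinity>" by auto
  obtain n j where nj: "n \<ge> 1" "j \<in> Z n" using False by blast
  then have nminf: "L \<noteq> -\<infinity>" using memL[OF nj] by auto
  obtain l where l: "L = ereal l" using ninf nminf by (cases L) auto
  have upper: "\<alpha> n / ereal (real n) \<le> L" if n: "n \<ge> 1" for n
  proof -
    have "\<alpha> n \<le> ereal (real n) * L"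
      unfolding \<alpha>_def
    proof (rule Sup_least)
      fix x assume "x \<in> {ereal (real_of_int j) |j. j \<in> Z n}"
      then obtain j where j: "x = ereal (real_of_int j)" "j \<in> Z n" by blast
      have "real_of_int j / real n \<le> l"
        using memL[OF n j(2)] l by simp
      then show "x \<le> ereal (real n) * L"
        using n j l by (simp add: divide_le_eq mult.commute)
    qed
    then show ?thesis
      using n by (simp add: ereal_divide_le_pos)
  qed
  have "(\<lambda>n. \<alpha> n / ereal (real n)) \<longlonglongrightarrow> L"
  proof (rule order_tendstoI)
    fix x assume "L < x"
    then show "\<forall>\<^sub>F n in sequentially. \<alpha> n / ereal (real n) < x"
      unfolding eventually_sequentially using upper le_less_trans by blast
  next
    fix x assume "x < L"
    then obtain n j where nj: "n \<ge> 1" "j \<in> Z n" "x < ereal (real_of_int j / real n)"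
      unfolding L_def less_Sup_iff B_def by blast
    define s where "s N = (real (N div n) + 1) * real_of_int j / real N" for N
    \<comment> \<open>Both bounds matter, since \<open>j\<close> may be negative and multiplication
      by it then reverses the estimates.\<close>
    have "(\<lambda>N. (real (N div n) + 1) / real N) \<longlonglongrightarrow> 1 / real n"
    proof (rule tendsto_sandwich[OF _ _ tendsto_const])
      show "(\<lambda>N. 1 / real n + 1 / real N) \<longlonglongrightarrow> 1 / real n"
        using tendsto_add[OF tendsto_const lim_1_over_n, of "1 / real n"] by simp
      have lo: "real N / real n \<le> real (N div n) + 1" for N
      proof -
        have "N \<le> n * (N div n) + n"
          using mod_less_divisor[of n N] nj(1) mult_div_mod_eq[of n N] by linarith
        then have "real N \<le> real (n * (N div n) + n)" by (simp only: of_nat_le_iff)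
        then have "real N \<le> (real (N div n) + 1) * real n"
          by (simp add: algebra_simps)
        then show ?thesis using nj(1) by (simp add: divide_le_eq)
      qed
      have hi: "real (N div n) + 1 \<le> real N / real n + 1" for N
      proof -
        have "real (N div n * n) \<le> real N"
          by (simp only: of_nat_le_iff div_times_less_eq_dividend)
        then show ?thesis using nj(1) by (simp add: le_divide_eq)
      qed
      show "\<forall>\<^sub>F N in sequentially. 1 / real n \<le> (real (N div n) + 1) / real N"
        unfolding eventually_sequentially
      proof (intro exI[of _ 1] allI impI)
        fix N :: nat assume N: "1 \<le> N"
        have "1 / real n = (real N / real n) / real N" using N by simp
        also have "\<dots> \<le> (real (N div n) + 1) / real N"
          by (rule divide_right_mono[OF lo]) simp
        finally show "1 / real n \<le> (real (N div n) + 1) / real N" .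
      qed
      show "\<forall>\<^sub>F N in sequentially. (real (N div n) + 1) / real N \<le> 1 / real n + 1 / real N"
        unfolding eventually_sequentially
      proof (intro exI[of _ 1] allI impI)
        fix N :: nat assume N: "1 \<le> N"
        have "(real (N div n) + 1) / real N \<le> (real N / real n + 1) / real N"
          by (rule divide_right_mono[OF hi]) simp
        also have "\<dots> = 1 / real n + 1 / real N" using N by (simp add: add_divide_distrib)
        finally show "(real (N div n) + 1) / real N \<le> 1 / real n + 1 / real N" .
      qed
    qed
    from tendsto_mult[OF this tendsto_const[of "real_of_int j"]]
    have "s \<longlonglongrightarrow> real_of_int j / real n"
      unfolding s_def by simp
    then have "(\<lambda>N. ereal (s N)) \<longlonglongrightarrow> ereal (real_of_int j / real n)"
      by (simp add: tendsto_ereal)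
    then have "\<forall>\<^sub>F N in sequentially. x < ereal (s N)"
      using nj(3) by (rule order_tendstoD)
    moreover have "\<forall>\<^sub>F N in sequentially. ereal (s N) \<le> \<alpha> N / ereal (real N)"
      unfolding eventually_sequentially
    \<comment> \<open>The threshold \<open>n * n\<close> is what makes the quotient
      \<open>N div n\<close> at least \<open>n\<close>, as \<open>scale\<close> demands.\<close>
    proof (intro exI[of _ "n * n"] allI impI)
      fix N assume N: "n * n \<le> N"
      have "n * n > 0" using nj(1) by simp
      then have Npos: "N > 0" using N by linarith
      have "n * n div n \<le> N div n" by (rule div_le_mono[OF N])
      then have "n \<le> N div n" using nj(1) by simp
      moreover have "N mod n < n" using nj(1) by simp
      ultimately have "(int (N div n) + 1) * j \<in> Z (N div n * n + N mod n)"
        by (rule scale[OF nj(1,2)])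
      then have "(int (N div n) + 1) * j \<in> Z N" by simp
      then have "ereal (real_of_int ((int (N div n) + 1) * j)) \<le> \<alpha> N"
        unfolding \<alpha>_def by (intro Sup_upper) blast
      then have "ereal ((real (N div n) + 1) * real_of_int j) \<le> \<alpha> N" by simp
      then have "ereal ((real (N div n) + 1) * real_of_int j) / ereal (real N) \<le> \<alpha> N / ereal (real N)"
        by (rule ereal_divide_right_mono) (use Npos in simp)
      then show "ereal (s N) \<le> \<alpha> N / ereal (real N)"
        using Npos by (simp add: s_def)
    qed
    ultimately show "\<forall>\<^sub>F n in sequentially. x < \<alpha> n / ereal (real n)"
      by eventually_elim simp
  qed
  then show ?thesis using ninf nminf False by blast
qed

section \<open>Degrees of local cohomology of the symbolic powers\<close>

context squarefree_monomials
begin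

abbreviation "symb n \<equiv> symbolic_power (poly_ring d) I n"

sublocale symb: monomial_quotient d "symbolic_expos n" "symb n" for n
  by unfold_locales (simp_all add: expo_upset_symbolic symbolic_power_eq)

text \<open>Multiplying by a high monomial on \<open>S\<close> satisfies the condition of every
  cover that meets \<open>S\<close>, while a cover disjoint from \<open>S\<close> still sees the sum
  of \<open>a\<close> over it. Only the disjoint covers can keep a multidegree alive.\<close>

lemma alive_symbolic_iff:
  assumes S: "S \<subseteq> {..<d}"
  shows "a \<in> symb.alive n S \<longleftrightarrow> (\<forall>v\<ge>d. a v = 0) \<and> (\<forall>v. v \<notin> S \<longrightarrow> 0 \<le> a v) \<and>
    (\<exists>P\<in>min_covers d E. P \<inter> S = {} \<and> (\<Sum>v\<in>P. a v) < int n)"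
proof (cases "(\<forall>v\<ge>d. a v = 0) \<and> (\<forall>v. v \<notin> S \<longrightarrow> 0 \<le> a v)")
  case True
  have "(\<forall>u. keys u \<subseteq> S \<longrightarrow> (\<forall>m\<in>symbolic_expos n. iexp m \<noteq> shift a u)) \<longleftrightarrow>
      (\<exists>P\<in>min_covers d E. P \<inter> S = {} \<and> (\<Sum>v\<in>P. a v) < int n)"
  proof
    assume "\<exists>P\<in>min_covers d E. P \<inter> S = {} \<and> (\<Sum>v\<in>P. a v) < int n"
    then obtain P where P: "P \<in> min_covers d E" "P \<inter> S = {}" "(\<Sum>v\<in>P. a v) < int n" by blast
    show "\<forall>u. keys u \<subseteq> S \<longrightarrow> (\<forall>m\<in>symbolic_expos n. iexp m \<noteq> shift a u)"
    proof (intro allI impI ballI notI)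
      fix u m assume u: "keys u \<subseteq> S" and m: "m \<in> symbolic_expos n" and eq: "iexp m = shift a u"
      have "int (lookup m v) = a v" if "v \<in> P" for v
      proof -
        have "lookup u v = 0" using that u P(2) by (auto simp: in_keys_iff)
        then show ?thesis using fun_cong[OF eq, of v] by (simp add: iexp_def shift_def)
      qed
      then have "int (pdeg P m) = (\<Sum>v\<in>P. a v)"
        by (simp add: pdeg_def)
      moreover have "n \<le> pdeg P m"
        using m P(1) by (simp add: symbolic_expos_def)
      ultimately show False using P(3) by simp
    qed
  next
    assume no: "\<forall>u. keys u \<subseteq> S \<longrightarrow> (\<forall>m\<in>symbolic_expos n. iexp m \<noteq> shift a u)"
    show "\<exists>P\<in>min_covers d E. P \<inter> S = {} \<and> (\<Sum>v\<in>P. a v) < int n"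
    proof (rule ccontr)
      assume "\<not> ?thesis"
      then have big: "int n \<le> (\<Sum>v\<in>P. a v)" if "P \<in> min_covers d E" "P \<inter> S = {}" for P
        using that by force
      \<comment> \<open>The choice makes every coordinate of \<open>shift a u\<close> in
        \<open>S\<close> at least \<open>n\<close>, so one common element of a cover with
        \<open>S\<close> already suffices.\<close>
      define u where "u = Abs_poly_mapping (\<lambda>v. if v \<in> S then n + nat \<bar>a v\<bar> else 0)"
      have lu: "lookup u v = (if v \<in> S then n + nat \<bar>a v\<bar> else 0)" for v
        unfolding u_def using subset_lessThan_finite[OF S] by (subst lookup_Abs_poly_mapping) auto
      have u: "keys u \<subseteq> S" by (auto simp: in_keys_iff lu split: if_splits)
      define m where "m = Abs_poly_mapping (\<lambda>v. nat (shift a u v))"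
      have zero: "shift a u v = 0" if "v \<ge> d" for v
        using True that S by (auto simp: shift_def lu)
      have lm: "lookup m v = nat (shift a u v)" for v
        unfolding m_def
      proof (subst lookup_Abs_poly_mapping)
        have "{v. nat (shift a u v) \<noteq> 0} \<subseteq> {..<d}"
          using zero by (auto simp: not_le[symmetric])
        then show "finite {v. nat (shift a u v) \<noteq> 0}"
          by (rule finite_subset) simp
      qed simp
      have nonneg: "shift a u v \<ge> 0" for v
        using True by (auto simp: shift_def lu)
      have eq: "iexp m = shift a u"
        using nonneg by (auto simp: iexp_def lm)
      have km: "keys m \<subseteq> {..<d}"
        using zero by (auto simp: in_keys_iff lm not_le[symmetric])
      have "n \<le> pdeg P m" if P: "P \<in> min_covers d E" for P
      proof (cases "P \<inter> S = {}")
        case True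
        have "int (pdeg P m) = (\<Sum>v\<in>P. a v)"
          using True nonneg unfolding pdeg_def of_nat_sum
          by (intro sum.cong) (auto simp: lm shift_def lu)
        then show ?thesis using big[OF P True] by simp
      next
        case False
        then obtain w where w: "w \<in> P" "w \<in> S" by blast
        have "n \<le> lookup m w"
          using w by (simp add: lm shift_def lu)
        also have "\<dots> \<le> pdeg P m"
          unfolding pdeg_def using w min_coversD(3)[OF P] by (intro member_le_sum) auto
        finally show ?thesis .
      qed
      then have "m \<in> symbolic_expos n"
        using km by (simp add: symbolic_expos_def)
      then show False using no u eq by blast
    qed
  qed
  then show ?thesis using True by (simp add: symb.alive_def)
qed (auto simp: symb.alive_def)

definition degrees :: "nat \<Rightarrow> nat \<Rightarrow> int set" where
  "degrees i n = {j. \<exists>a. (\<Sum>v<d. a v) = j \<and> comb_cohomology_nonzero TYPE('k) (symb.alive_sets n a) i}"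

lemma a_invariant_symb: "a_invariant_quot d (symb n) i = Sup {ereal (real_of_int j) |j. j \<in> degrees i n}"
  by (simp add: symb.a_invariant_quot_eq degrees_def)

lemma a_invariant_symb_MInfty_iff: "a_invariant_quot d (symb n) i = -\<infinity> \<longleftrightarrow> degrees i n = {}"
proof
  assume "a_invariant_quot d (symb n) i = -\<infinity>"
  moreover have "ereal (real_of_int j) \<le> a_invariant_quot d (symb n) i" if "j \<in> degrees i n" for j
    unfolding a_invariant_symb using that by (intro Sup_upper) blast
  ultimately show "degrees i n = {}" by fastforce
qed (simp add: a_invariant_symb bot_ereal_def)

lemma mem_alive_sets_iff:
  "S \<in> symb.alive_sets n a \<longleftrightarrow> S \<subseteq> {..<d} \<and> (\<forall>v\<ge>d. a v = 0) \<and> (\<forall>v. v \<notin> S \<longrightarrow> 0 \<le> a v) \<and>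
    (\<exists>P\<in>min_covers d E. P \<inter> S = {} \<and> (\<Sum>v\<in>P. a v) < int n)"
  using alive_symbolic_iff[of S a n] by (auto simp: symb.alive_sets_def)

text \<open>By integrality \<open>x < n\<close> means \<open>x \<le> n - 1\<close>, and
  \<open>n \<le> q\<close> gives \<open>(q + 1) (n - 1) < q n\<close>. In the other direction
  \<open>r < n\<close> gives \<open>q n + r < (q + 1) n\<close>.\<close>

lemma scale_less_iff:
  fixes x :: int
  assumes "n \<le> q" "r < n"
  shows "(int q + 1) * x < int (q * n + r) \<longleftrightarrow> x < int n"
proof
  assume "x < int n"
  then have "(int q + 1) * x \<le> (int q + 1) * (int n - 1)"
    by (intro mult_left_mono) auto
  also have "\<dots> < int (q * n + r)"
    using assms by (simp add: algebra_simps)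
  finally show "(int q + 1) * x < int (q * n + r)" .
next
  assume less: "(int q + 1) * x < int (q * n + r)"
  show "x < int n"
  proof (rule ccontr)
    assume "\<not> x < int n"
    then have "(int q + 1) * int n \<le> (int q + 1) * x"
      by (intro mult_left_mono) auto
    moreover have "int (q * n + r) < (int q + 1) * int n"
      using assms by (simp add: algebra_simps)
    ultimately show False using less by linarith
  qed
qed

lemma alive_sets_scale:
  assumes "n \<le> q" "r < n"
  shows "symb.alive_sets (q * n + r) (\<lambda>v. (int q + 1) * a v) = symb.alive_sets n a"
proof (rule Set.set_eqI)
  fix S
  have pos: "0 \<le> (int q + 1) * x \<longleftrightarrow> 0 \<le> x" for x
    by (simp add: zero_le_mult_iff)
  have zero: "(int q + 1) * x = 0 \<longleftrightarrow> x = 0" for x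
    by simp
  have sum: "(\<Sum>v\<in>P. (int q + 1) * a v) < int (q * n + r) \<longleftrightarrow> (\<Sum>v\<in>P. a v) < int n" for P
    by (simp only: scale_less_iff[OF assms] flip: sum_distrib_left)
  show "S \<in> symb.alive_sets (q * n + r) (\<lambda>v. (int q + 1) * a v) \<longleftrightarrow> S \<in> symb.alive_sets n a"
    unfolding mem_alive_sets_iff pos zero sum ..
qed

lemma degrees_scale:
  assumes "j \<in> degrees i n" "n \<le> q" "r < n"
  shows "(int q + 1) * j \<in> degrees i (q * n + r)"
proof -
  obtain a where a: "(\<Sum>v<d. a v) = j" "comb_cohomology_nonzero TYPE('k) (symb.alive_sets n a) i"
    using assms(1) by (auto simp: degrees_def)
  show ?thesis
    unfolding degrees_def
    by (intro CollectI exI[of _ "\<lambda>v. (int q + 1) * a v"] conjI)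
      (simp_all only: alive_sets_scale[OF assms(2,3)] a flip: sum_distrib_left)
qed

lemma degrees_bound:
  assumes "j \<in> degrees i n"
  shows "j \<le> int d * int n"
proof -
  obtain a where a: "(\<Sum>v<d. a v) = j" "comb_cohomology_nonzero TYPE('k) (symb.alive_sets n a) i"
    using assms by (auto simp: degrees_def)
  have "a v \<le> int n" if v: "v < d" for v
  proof (rule ccontr)
    assume big: "\<not> a v \<le> int n"
    \<comment> \<open>A cover through \<open>v\<close> has sum above \<open>n\<close>, its other
      entries being nonnegative. The covers that count avoid \<open>v\<close>, so moving
      \<open>v\<close> into or out of \<open>S\<close> changes nothing.\<close>
    have notin: "v \<notin> P" if P: "P \<in> min_covers d E" "\<forall>w\<in>P. 0 \<le> a w" "(\<Sum>w\<in>P. a w) < int n" for P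
    proof
      assume "v \<in> P"
      then have "a v \<le> (\<Sum>w\<in>P. a w)"
        using min_coversD(3)[OF P(1)] P(2) by (intro member_le_sum) auto
      then show False using big P(3) by simp
    qed
    have "\<not> comb_cohomology_nonzero TYPE('k) (symb.alive_sets n a) i"
    proof (rule comb_cone_acyclic[where v = v])
      fix S :: "nat set" assume vS: "v \<notin> S"
      have av: "0 \<le> a v" using big by simp
      have eq: "(P \<inter> insert v S = {} \<and> (\<Sum>w\<in>P. a w) < int n) \<longleftrightarrow> (P \<inter> S = {} \<and> (\<Sum>w\<in>P. a w) < int n)"
        if P: "P \<in> min_covers d E" and S: "\<forall>w. w \<notin> S \<longrightarrow> 0 \<le> a w" for P
        using notin[OF P] S by blast
      have nonneg: "(\<forall>w. w \<notin> insert v S \<longrightarrow> 0 \<le> a w) \<longleftrightarrow> (\<forall>w. w \<notin> S \<longrightarrow> 0 \<le> a w)"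
        using av by auto
      show "insert v S \<in> symb.alive_sets n a \<longleftrightarrow> S \<in> symb.alive_sets n a"
        unfolding mem_alive_sets_iff nonneg using v eq by (auto cong: bex_cong)
    next
      fix S assume "S \<in> symb.alive_sets n a"
      then show "finite S"
        using subset_lessThan_finite by (auto simp: mem_alive_sets_iff)
    qed
    then show False using a(2) by blast
  qed
  then have "(\<Sum>v<d. a v) \<le> (\<Sum>v<d. int n)"
    by (intro sum_mono) auto
  then show ?thesis using a(1) by simp
qed

text \<open>A nontrivial class needs a set of \<open>i\<close> elements disjoint from some minimal
  cover \<open>P\<close>, so \<open>i\<close> is at most \<open>d - card P\<close>.\<close>

lemma degrees_dim:
  assumes "j \<in> degrees i n" "n \<ge> 1"
  shows "ereal (real i) \<le> module_dim (poly_ring d) (quot_module (poly_ring d) (symb n))" "i \<le> d"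
proof -
  obtain a where "comb_cohomology_nonzero TYPE('k) (symb.alive_sets n a) i"
    using assms by (auto simp: degrees_def)
  then obtain S where "S \<in> symb.alive_sets n a" "card S = i"
    by (rule comb_cohomology_nonzeroD)
  then obtain P where S: "S \<subseteq> {..<d}" "card S = i" and P: "P \<in> min_covers d E" "P \<inter> S = {}"
    by (auto simp: mem_alive_sets_iff)
  have "S \<subseteq> {..<d} - P" using S P by blast
  then have "i \<le> card ({..<d} - P)"
    unfolding S(2)[symmetric] by (intro card_mono) auto
  also have "\<dots> = d - card P"
    using min_coversD[OF P(1)] by (simp add: card_Diff_subset)
  finally have i: "i \<le> d - card P" .
  \<comment> \<open>For \<open>n \<ge> 1\<close> the order along \<open>P\<close> is at least
    one.\<close>
  have "symb n \<subseteq> var_ideal d P"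
    using P(1) \<open>n \<ge> 1\<close> by (auto simp: symbolic_power_eq mspan_def symbolic_expos_def pdeg_ge_def; fastforce)
  then have "ereal (real (d - card P)) \<le> module_dim (poly_ring d) (quot_module (poly_ring d) (symb n))"
    by (rule symb.module_dim_ge[OF min_coversD(1)[OF P(1)]])
  moreover have "ereal (real i) \<le> ereal (real (d - card P))"
    using i by simp
  ultimately show "ereal (real i) \<le> module_dim (poly_ring d) (quot_module (poly_ring d) (symb n))"
    by (rule order_trans[rotated])
  show "i \<le> d" using i by simp
qed

text \<open>For a proper ideal one nonvanishing class is enough; it is found at \<open>n = 1\<close>
  in a multidegree whose family has a single member.\<close>

lemma degrees_all_empty_iff: "(\<forall>n\<ge>1. \<forall>i. degrees i n = {}) \<longleftrightarrow> I = carrier (poly_ring d)"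
proof
  assume "I = carrier (poly_ring d)"
  then have "min_covers d E = {}" using min_covers_empty_iff by simp
  then have "symb.alive_sets n a = {}" for n a
    by (auto simp: mem_alive_sets_iff)
  then show "\<forall>n\<ge>1. \<forall>i. degrees i n = {}"
    by (auto simp: degrees_def elim: comb_cohomology_nonzeroD)
next
  assume empty: "\<forall>n\<ge>1. \<forall>i. degrees i n = {}"
  show "I = carrier (poly_ring d)"
  proof (rule ccontr)
    assume "I \<noteq> carrier (poly_ring d)"
    then obtain P where P: "P \<in> min_covers d E" using min_covers_empty_iff by blast
    \<comment> \<open>With \<open>a\<close> equal to \<open>-1\<close> exactly on \<open>F\<close>,
      a member of the family contains \<open>F\<close> and avoids some minimal cover. That cover
      lies in \<open>P\<close>, hence equals \<open>P\<close>, and the member is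
      \<open>F\<close>.\<close>
    define F where "F = {..<d} - P"
    define a where "a v = (if v \<in> F then - 1 else 0 :: int)" for v
    have a0: "0 \<le> a v \<longleftrightarrow> v \<notin> F" for v by (simp add: a_def)
    have "symb.alive_sets 1 a = {F}"
    proof (intro equalityI subsetI)
      fix S assume "S \<in> symb.alive_sets 1 a"
      then obtain P' where S: "S \<subseteq> {..<d}" "F \<subseteq> S" and P': "P' \<in> min_covers d E" "P' \<inter> S = {}"
        unfolding mem_alive_sets_iff a0 by blast
      have "P' \<subseteq> P" using S P' min_coversD(1)[OF P'(1)] unfolding F_def by blast
      then have "P' = P" using P P' unfolding min_covers_def by blast
      then have "S = F" using S P'(2) unfolding F_def by blast
      then show "S \<in> {F}" by simp
    next
      fix S assume "S \<in> {F}"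
      moreover have "(\<Sum>v\<in>P. a v) < int 1"
        by (simp add: a_def F_def)
      moreover have "P \<inter> F = {}" by (auto simp: F_def)
      ultimately show "S \<in> symb.alive_sets 1 a"
        unfolding mem_alive_sets_iff a0 using P by (auto simp: F_def a_def)
    qed
    then have "comb_cohomology_nonzero TYPE('k) (symb.alive_sets 1 a) (card F)"
      using comb_singleton_nonzero by simp
    then have "degrees (card F) 1 \<noteq> {}"
      unfolding degrees_def by blast
    then show False using empty by blast
  qed
qed

lemma a_invariant_limit:
  "\<exists>L::ereal. L \<noteq> \<infinity> \<and> (L = -\<infinity> \<longleftrightarrow> (\<forall>n\<ge>1. a_invariant_quot d (symb n) i = -\<infinity>)) \<and>
     (\<lambda>n. a_invariant_quot d (symb n) i / ereal (real n)) \<longlonglongrightarrow> L"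
  \<comment> \<open>Two separate unfoldings: expanding the supremum first would remove the instances
    of the equivalence.\<close>
  unfolding a_invariant_symb_MInfty_iff unfolding a_invariant_symb
  by (rule scaled_Sup_limit[where D = d]) (use degrees_bound degrees_scale in blast)+

text \<open>The bound and the scaling hold with the same constants for every \<open>i\<close>, so
  they pass to the union over all \<open>i\<close>. The shift by \<open>i\<close> is at most
  \<open>d\<close> and disappears after division by \<open>n\<close>.\<close>

lemma regularity_limit:
  "\<exists>L::ereal. L \<noteq> \<infinity> \<and> (L = -\<infinity> \<longleftrightarrow> I = carrier (poly_ring d)) \<and>
     (\<lambda>n. regularity_quot d (symb n) / ereal (real n)) \<longlonglongrightarrow> L"
proof -
  define Z where "Z n = (\<Union>i. degrees i n)" for n
  define \<alpha> where "\<alpha> n = Sup {ereal (real_of_int j) |j. j \<in> Z n}" for n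
  have "\<exists>L. L \<noteq> \<infinity> \<and> (L = -\<infinity> \<longleftrightarrow> (\<forall>n\<ge>1. Z n = {})) \<and> (\<lambda>n. \<alpha> n / ereal (real n)) \<longlonglongrightarrow> L"
    unfolding \<alpha>_def
  proof (rule scaled_Sup_limit[where D = d])
    show "j \<le> int d * int n" if "j \<in> Z n" for n j
      using that degrees_bound by (auto simp: Z_def)
    show "(int q + 1) * j \<in> Z (q * n + r)" if j: "j \<in> Z n" and "n \<le> q" "r < n" for n q r j
    proof -
      obtain i where "j \<in> degrees i n" using j by (auto simp: Z_def)
      then have "(int q + 1) * j \<in> degrees i (q * n + r)"
        using that by (intro degrees_scale)
      then show ?thesis by (auto simp: Z_def)
    qed
  qed
  then obtain L where L: "L \<noteq> \<infinity>" "L = -\<infinity> \<longleftrightarrow> (\<forall>n\<ge>1. Z n = {})" "(\<lambda>n. \<alpha> n / ereal (real n)) \<longlonglongrightarrow> L"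
    by blast
  have "(\<forall>n\<ge>1. Z n = {}) \<longleftrightarrow> I = carrier (poly_ring d)"
    using degrees_all_empty_iff by (simp add: Z_def)
  note Linf = L(2)[unfolded this]
  \<comment> \<open>By \<open>degrees_dim\<close> every index with a nonzero degree is among those
    over which the regularity is taken.\<close>
  have lower: "\<alpha> n \<le> regularity_quot d (symb n)" if n: "n \<ge> 1" for n
    unfolding \<alpha>_def
  proof (rule Sup_least)
    fix x assume "x \<in> {ereal (real_of_int j) |j. j \<in> Z n}"
    then obtain i j where j: "x = ereal (real_of_int j)" "j \<in> degrees i n"
      by (auto simp: Z_def)
    have "x \<le> a_invariant_quot d (symb n) i"
      unfolding a_invariant_symb j(1) using j(2) by (intro Sup_upper) blast
    also have "\<dots> \<le> a_invariant_quot d (symb n) i + ereal (real i)"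
      by (cases "a_invariant_quot d (symb n) i") auto
    also have "\<dots> \<le> regularity_quot d (symb n)"
      unfolding regularity_quot_def regularity_def a_invariant_quot_def
      using degrees_dim(1)[OF j(2) n] by (intro Sup_upper) blast
    finally show "x \<le> regularity_quot d (symb n)" .
  qed
  \<comment> \<open>Indices without degrees contribute \<open>-\<infinity>\<close>; the others are
    at most \<open>d\<close>.\<close>
  have upper: "regularity_quot d (symb n) \<le> \<alpha> n + ereal (real d)" if n: "n \<ge> 1" for n
    unfolding regularity_quot_def regularity_def
  proof (rule Sup_least)
    fix x assume "x \<in> {a_invariant d (quot_module (poly_ring d) (symb n)) (quot_grading d (symb n)) i
        + ereal (real i) |i. ereal (real i) \<le> module_dim (poly_ring d) (quot_module (poly_ring d) (symb n))}"
    then obtain i where x: "x = a_invariant_quot d (symb n) i + ereal (real i)"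
      by (auto simp: a_invariant_quot_def)
    show "x \<le> \<alpha> n + ereal (real d)"
    proof (cases "degrees i n = {}")
      case True
      then have "a_invariant_quot d (symb n) i = -\<infinity>"
        using a_invariant_symb_MInfty_iff by blast
      then show ?thesis by (simp add: x)
    next
      case False
      then have "i \<le> d" using degrees_dim(2) n by blast
      moreover have "a_invariant_quot d (symb n) i \<le> \<alpha> n"
        unfolding a_invariant_symb \<alpha>_def by (intro Sup_subset_mono) (auto simp: Z_def)
      ultimately show ?thesis unfolding x by (intro add_mono) simp_all
    qed
  qed
  have "(\<lambda>n. regularity_quot d (symb n) / ereal (real n)) \<longlonglongrightarrow> L"
  proof (rule tendsto_sandwich[OF _ _ L(3)])
    have "(\<lambda>n. real d / real n) \<longlonglongrightarrow> 0"
      by (rule lim_const_over_n)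
    then have "(\<lambda>n. ereal (real d / real n)) \<longlonglongrightarrow> 0"
      by (simp add: zero_ereal_def tendsto_ereal)
    \<comment> \<open>The added sequence has a finite limit, so the sum rule also covers
      \<open>L = -\<infinity>\<close>.\<close>
    from tendsto_add_ereal_general1[OF _ L(3) this]
    show "(\<lambda>n. \<alpha> n / ereal (real n) + ereal (real d / real n)) \<longlonglongrightarrow> L" by simp
    show "\<forall>\<^sub>F n in sequentially. \<alpha> n / ereal (real n) \<le> regularity_quot d (symb n) / ereal (real n)"
      unfolding eventually_sequentially
      using lower by (intro exI[of _ 1] allI impI ereal_divide_right_mono) auto
    show "\<forall>\<^sub>F n in sequentially. regularity_quot d (symb n) / ereal (real n) \<le>
        \<alpha> n / ereal (real n) + ereal (real d / real n)"
      unfolding eventually_sequentially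
    proof (intro exI[of _ 1] allI impI)
      fix n :: nat assume n: "1 \<le> n"
      have "regularity_quot d (symb n) / ereal (real n) \<le> (\<alpha> n + ereal (real d)) / ereal (real n)"
        using n by (intro ereal_divide_right_mono upper) auto
      also have "\<dots> = \<alpha> n / ereal (real n) + ereal (real d / real n)"
        using n by (cases "\<alpha> n") (auto simp: add_divide_distrib)
      finally show "regularity_quot d (symb n) / ereal (real n) \<le>
        \<alpha> n / ereal (real n) + ereal (real d / real n)" .
    qed
  qed
  then show ?thesis using L(1) Linf by blast
qed

end

theorem theorem1:
  fixes d :: nat and I :: "'k::field mpoly set"
  assumes "squarefree_monomial_ideal d I"
  shows "(\<forall>i. ereal (real i) \<le> krull_dim (poly_ring d Quot I) \<longrightarrow>
            (\<exists>L::ereal. L \<noteq> \<infinity> \<and>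
               (L = -\<infinity> \<longleftrightarrow>
                  (\<forall>n\<ge>1. a_invariant_quot d (symbolic_power (poly_ring d) I n) i = -\<infinity>)) \<and>
               (\<lambda>n. a_invariant_quot d (symbolic_power (poly_ring d) I n) i / ereal (real n))
                 \<longlonglongrightarrow> L)) \<and>
         (\<exists>L::ereal. L \<noteq> \<infinity> \<and>
            (L = -\<infinity> \<longleftrightarrow> I = carrier (poly_ring d)) \<and>
            (\<lambda>n. regularity_quot d (symbolic_power (poly_ring d) I n) / ereal (real n))
              \<longlonglongrightarrow> L)"
proof -
  obtain E where E: "\<And>m. m \<in> E \<Longrightarrow> keys m \<subseteq> {..<d}" "\<And>m v. m \<in> E \<Longrightarrow> lookup m v \<le> 1"
    "I = Idl\<^bsub>poly_ring d\<^esub> (monomial ` E)"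
    using assms unfolding squarefree_monomial_ideal_def by blast
  interpret squarefree_monomials d E I
    by unfold_locales (rule E; assumption)+
  show ?thesis
    using a_invariant_limit regularity_limit by blast
qed

end
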